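(* Every Frobenius maximal parabolic whose smaller block is at most $8$ is log-concave; that is, if $a,b$ are positive coprime integers with $\min(a,b)\le 8$, then $W(a,b)$ is log-concave. The same is true when the smaller block is $10$, i.e. when $a,b$ are coprime and $\min(a,b)=10$.
   Context: For positive integers $a,b$, let $$W(a,b)=\left\{\begin{pmatrix}X&Z\\0&Y\end{pmatrix}: X\in\operatorname{Mat}_a(\mathbb C),\ Y\in\operatorname{Mat}_b(\mathbb C),\ Z\in\operatorname{Mat}_{a\times b}(\mathbb C),\ \operatorname{tr}X+\operatorname{tr}Y=0\right\},$$ a Lie algebra under the commutator (a maximal parabolic of type $A$, with blocks of sizes $a$ and $b$). A finite-dimensional complex Lie algebra $\mathfrak g$ is Frobenius if there is $\varphi\in\mathfrak g^*$ such that the bilinear form $B_\varphi(x,y)=\varphi([x,y])$ is nondegenerate; such $\varphi$ is called a Frobenius functional and determines a unique principal element $h\in\mathfrak g$ by $\varphi([h,x])=\varphi(x)$ for all $x\in\mathfrak g$. It is known that $W(a,b)$ is Frobenius exactly when $\gcd(a,b)=1$, and that the multiset of eigenvalues of $\operatorname{ad}h$ (with algebraic multiplicities) does not depend on the choice of Frobenius functional; this multiset is the Ooms spectrum. The distinct eigenvalues are integers forming an unbroken interval. The multiplicity sequence is the sequence of multiplicities, listed in order of increasing distinct eigenvalue. A positive sequence $(c_0,\ldots,c_t)$ is log-concave if $c_j^2\ge c_{j-1}c_{j+1}$ for $1\le j<t$. "$W(a,b)$ is log-concave" means that the multiplicity sequence of its Ooms spectrum is log-concave. *)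

theory Defs
  imports Jordan_Normal_Form.VS_Connect Jordan_Normal_Form.Char_Poly
begin

definition mat_trace :: "'a :: comm_monoid_add mat \<Rightarrow> 'a" where
  "mat_trace A = (\<Sum>i<dim_row A. A $$ (i, i))"

definition lie_bracket :: "'a :: ring mat \<Rightarrow> 'a mat \<Rightarrow> 'a mat" where
  "lie_bracket A B = A * B - B * A"

definition max_parabolic :: "nat \<Rightarrow> nat \<Rightarrow> complex mat set" where
  "max_parabolic a b =
     {four_block_mat X Z (0\<^sub>m b a) Y | X Y Z.
        X \<in> carrier_mat a a \<and> Y \<in> carrier_mat b b \<and> Z \<in> carrier_mat a b \<and>
        mat_trace X + mat_trace Y = 0}"

text \<open>
  Below, \<open>L\<close> is the carrier of a Lie algebra of complex \<open>n \<times> n\<close> matrices under the commutator.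
  An element of the dual space of \<open>L\<close> is given by a function on all matrices, of which only the
  values on \<open>L\<close> are relevant.
\<close>

definition linear_functional_on :: "complex mat set \<Rightarrow> (complex mat \<Rightarrow> complex) \<Rightarrow> bool" where
  "linear_functional_on L \<phi> \<longleftrightarrow>
     (\<forall>x\<in>L. \<forall>y\<in>L. \<phi> (x + y) = \<phi> x + \<phi> y) \<and> (\<forall>c. \<forall>x\<in>L. \<phi> (c \<cdot>\<^sub>m x) = c * \<phi> x)"

text \<open>
  The form \<open>(x, y) \<mapsto> \<phi> [x, y]\<close> is alternating, so nondegeneracy in one argument is the same as
  nondegeneracy in the other.
\<close>

definition frobenius_functional ::
  "nat \<Rightarrow> complex mat set \<Rightarrow> (complex mat \<Rightarrow> complex) \<Rightarrow> bool" where
  "frobenius_functional n L \<phi> \<longleftrightarrow>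
     linear_functional_on L \<phi> \<and>
     (\<forall>x\<in>L. (\<forall>y\<in>L. \<phi> (lie_bracket x y) = 0) \<longrightarrow> x = 0\<^sub>m n n)"

definition principal_element ::
  "complex mat set \<Rightarrow> (complex mat \<Rightarrow> complex) \<Rightarrow> complex mat \<Rightarrow> bool" where
  "principal_element L \<phi> h \<longleftrightarrow> h \<in> L \<and> (\<forall>x\<in>L. \<phi> (lie_bracket h x) = \<phi> x)"

abbreviation mat_subspace :: "nat \<Rightarrow> complex mat set \<Rightarrow> (complex, complex mat) module" where
  "mat_subspace n L \<equiv> (module_mat TYPE(complex) n n)\<lparr>carrier := L\<rparr>"

definition ordered_basis :: "nat \<Rightarrow> complex mat set \<Rightarrow> complex mat list \<Rightarrow> bool" where
  "ordered_basis n L bs \<longleftrightarrow>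
     distinct bs \<and> vectorspace.basis class_ring (mat_subspace n L) (set bs)"

text \<open>Column \<open>j\<close> of \<open>A\<close> holds the coordinates of the image of the \<open>j\<close>-th basis element.\<close>

definition represents ::
  "nat \<Rightarrow> complex mat list \<Rightarrow> (complex mat \<Rightarrow> complex mat) \<Rightarrow> complex mat \<Rightarrow> bool" where
  "represents n bs T A \<longleftrightarrow>
     A \<in> carrier_mat (length bs) (length bs) \<and>
     (\<forall>j<length bs. T (bs ! j) =
        mat n n (\<lambda>(p, q). \<Sum>i<length bs. A $$ (i, j) * (bs ! i) $$ (p, q)))"

text \<open>
  The eigenvalues of \<open>ad h\<close> with algebraic multiplicities, i.e. the roots of its characteristic
  polynomial. The relation admits every choice of the Frobenius functional and of the basis in
  which the characteristic polynomial is computed; no independence of these choices is built in.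
\<close>

definition is_ooms_spectrum :: "nat \<Rightarrow> complex mat set \<Rightarrow> complex multiset \<Rightarrow> bool" where
  "is_ooms_spectrum n L M \<longleftrightarrow>
     (\<exists>\<phi> h bs A. frobenius_functional n L \<phi> \<and> principal_element L \<phi> h \<and>
        ordered_basis n L bs \<and> represents n bs (lie_bracket h) A \<and> M = proots (char_poly A))"

text \<open>
  There is such a list \<open>cs\<close>, and then exactly one, if and only if all elements of \<open>M\<close> are real.
\<close>

definition multiplicity_sequence :: "complex multiset \<Rightarrow> nat list \<Rightarrow> bool" where
  "multiplicity_sequence M cs \<longleftrightarrow>
     (\<exists>es :: real list. sorted_wrt (<) es \<and> complex_of_real ` set es = set_mset M \<and>
        cs = map (\<lambda>e. count M (complex_of_real e)) es)"

definition log_concave :: "nat list \<Rightarrow> bool" where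
  "log_concave cs \<longleftrightarrow>
     cs \<noteq> [] \<and> (\<forall>c\<in>set cs. 0 < c) \<and>
     (\<forall>j. 1 \<le> j \<and> j + 1 < length cs \<longrightarrow> cs ! (j - 1) * cs ! (j + 1) \<le> (cs ! j)\<^sup>2)"

text \<open>
  The first conjunct makes the notion meaningful only for Frobenius parabolics; the second one
  ranges over all Frobenius functionals.
\<close>

definition log_concave_parabolic :: "nat \<Rightarrow> nat \<Rightarrow> bool" where
  "log_concave_parabolic a b \<longleftrightarrow>
     (\<exists>M. is_ooms_spectrum (a + b) (max_parabolic a b) M) \<and>
     (\<forall>M. is_ooms_spectrum (a + b) (max_parabolic a b) M \<longrightarrow>
        (\<exists>cs. multiplicity_sequence M cs \<and> log_concave cs))"

end

theory Submission
  imports Defs "Jordan_Normal_Form.Schur_Decomposition"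
begin

text \<open>
  Write an element of the block upper triangular matrix algebra as a triple \<open>(X, Y, Z)\<close> of two
  diagonal blocks and the off-diagonal block. Since \<open>W(a, b)\<close> is trace-free, every functional on it
  is \<open>x \<mapsto> tr (F x)\<close> for a trace-free block lower triangular \<open>F\<close> with blocks \<open>A\<close>, \<open>B\<close> (diagonal) and
  \<open>U\<close> (below the diagonal). Then \<open>\<phi> [h, x] = e \<phi> x\<close> for all \<open>x\<close> means that \<open>F h - h F - e F\<close> vanishes
  outside the upper right block, that is, that three matrix equations hold (\<open>structure_eqs\<close>).
  With \<open>e = 0\<close> they describe the kernel of the form of \<open>\<phi>\<close>, with \<open>e = 1\<close> the principal elements.

  If \<open>\<phi>\<close> is Frobenius and \<open>a \<le> b\<close>, then \<open>U\<close> is injective, so after a change of basis it is the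
  inclusion of the first \<open>a\<close> coordinates. In this normal form the equations determine \<open>Z\<close> and part of
  \<open>Y\<close>, and what remains is the same system for \<open>(a, b - a)\<close>. Transposition exchanges the
  two blocks, so the Euclidean algorithm runs down to \<open>(1, 0)\<close>. It shows that for every Frobenius
  functional the diagonal blocks of a principal element have, up to a common shift, the eigenvalues
  \<open>exponents a b\<close> (\<open>principal_element_roots\<close>); run backwards, it constructs a Frobenius functional
  with a principal element (\<open>frobenius_data_exists\<close>). Making \<open>h\<close> upper triangular also
  triangularizes \<open>ad h\<close>, so the Ooms spectrum consists of the differences of these eigenvalues at the
  block upper triangular positions, with one \<open>0\<close> removed for the identity matrix
  (\<open>ooms_spectrum_count\<close>).

  It remains to prove a statement on integer sequences. Multiplicities are symmetric under
  \<open>k \<mapsto> 1 - k\<close>, so only \<open>k \<ge> 1\<close> matters. Fix \<open>a\<close> and \<open>r\<close> and let \<open>b = q a + r\<close>. Passing from \<open>q\<close> to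
  \<open>q + 1\<close> adds a constant to the multiplicities near the centre and shifts the others by one. So once
  \<open>q\<close> is large, log-concavity is inherited from \<open>q\<close> to \<open>q + 1\<close>, provided that the central part is
  concave (\<open>half_log_concave_stable\<close>). This leaves finitely many \<open>q\<close> for each of the finitely
  many pairs of coprime \<open>a\<close> and \<open>r < a\<close>, which are checked by symbolic evaluation
  (\<open>check_checked_families\<close>).
\<close>

section \<open>Counting eigenvalue differences\<close>

text \<open>The number of ways to write \<open>k\<close> as a difference of an entry of \<open>xs\<close> and an entry of \<open>ys\<close>;
  the lists stand for multisets of eigenvalues.\<close>

definition diff_count :: "int list \<Rightarrow> int list \<Rightarrow> int \<Rightarrow> int" where
  "diff_count xs ys k = (\<Sum>x\<leftarrow>xs. \<Sum>y\<leftarrow>ys. of_bool (x - y = k))"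

lemma diff_count_append_left: "diff_count (xs @ xs') ys k = diff_count xs ys k + diff_count xs' ys k"
  by (simp add: diff_count_def)

lemma diff_count_append_right: "diff_count xs (ys @ ys') k = diff_count xs ys k + diff_count xs ys' k"
  by (simp add: diff_count_def sum_list_addf)

lemma diff_count_shift_left: "diff_count (map (\<lambda>x. x + c) xs) ys k = diff_count xs ys (k - c)"
proof -
  have "(x + c - y = k) = (x - y = k - c)" for x y by auto
  then show ?thesis by (simp add: diff_count_def o_def)
qed

lemma diff_count_shift_right: "diff_count xs (map (\<lambda>x. x + c) ys) k = diff_count xs ys (k + c)"
proof -
  have "(x - (y + c) = k) = (x - y = k + c)" for x y by auto
  then show ?thesis by (simp add: diff_count_def o_def)
qed

lemma diff_count_flip: "diff_count ys xs k = diff_count xs ys (- k)"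
proof (induction xs)
  case Nil
  then show ?case by (simp add: diff_count_def)
next
  case (Cons x xs)
  have "diff_count ys (x # xs) k = diff_count ys [x] k + diff_count ys xs k"
    using diff_count_append_right[of ys "[x]" xs k] by simp
  moreover have "diff_count (x # xs) ys (- k) = diff_count [x] ys (- k) + diff_count xs ys (- k)"
    using diff_count_append_left[of "[x]" xs ys "- k"] by simp
  moreover have "diff_count ys [x] k = diff_count [x] ys (- k)"
  proof -
    have "(y - x = k) = (x - y = - k)" for y by auto
    then show ?thesis by (simp add: diff_count_def)
  qed
  ultimately show ?case using Cons.IH by simp
qed

lemma diff_count_nonneg: "0 \<le> diff_count xs ys k"
  unfolding diff_count_def by (intro sum_list_nonneg) (auto intro!: sum_list_nonneg)

lemma diff_count_eq_0:
  assumes "\<And>x y. x \<in> set xs \<Longrightarrow> y \<in> set ys \<Longrightarrow> x - y \<noteq> k"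
  shows "diff_count xs ys k = 0"
proof -
  have "(\<Sum>y\<leftarrow>ys. of_bool (x - y = k)) = (0::int)" if "x \<in> set xs" for x
    using assms[OF that] by (induction ys) auto
  then have "map (\<lambda>x. \<Sum>y\<leftarrow>ys. of_bool (x - y = k)) xs = map (\<lambda>_. 0::int) xs"
    by simp
  then show ?thesis by (simp only: diff_count_def) simp
qed

text \<open>Eigenvalues of the two diagonal blocks of a principal element for \<open>(a, b)\<close>, normalized up to a
  common shift, by the Euclidean algorithm. Coprime arguments end in \<open>(1, 0)\<close>, where the block of
  size \<open>1\<close> has the eigenvalue \<open>0\<close> and the other block is empty. For \<open>a = b = 1\<close> the first of the two
  reductions is used.\<close>

fun exponents :: "nat \<Rightarrow> nat \<Rightarrow> int list \<times> int list" where
  "exponents a b =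
     (if a = 0 \<or> b = 0 then ([0], [])
      else if a \<le> b then (let (P, Q) = exponents a (b - a) in (map (\<lambda>x. x + 1) P, P @ Q))
      else (let (P, Q) = exponents (a - b) b in (P @ Q, map (\<lambda>x. x - 1) Q)))"

declare exponents.simps[simp del]

text \<open>The multiplicity of \<open>k\<close> in the spectrum belonging to the eigenvalues \<open>P\<close> and \<open>Q\<close> of the diagonal
  blocks. The last summand accounts for the trace condition.\<close>

definition spectrum_count :: "int list \<times> int list \<Rightarrow> int \<Rightarrow> int" where
  "spectrum_count PQ k = diff_count (fst PQ) (fst PQ) k + diff_count (snd PQ) (snd PQ) k
     + diff_count (fst PQ) (snd PQ) k - of_bool (k = 0)"

text \<open>In both Euclidean steps the multiplicities grow by \<open>V k + V (1 - k)\<close> for some \<open>V\<close>. This gives the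
  symmetry under \<open>k \<mapsto> 1 - k\<close>, and the growth rate along the family \<open>b = q a + r\<close>.\<close>

lemma spectrum_count_step_left:
  "spectrum_count (map (\<lambda>x. x + 1) P, P @ Q) k =
     spectrum_count (P, Q) k + (diff_count P P k + diff_count Q P k) + (diff_count P P (1 - k) + diff_count Q P (1 - k))"
  using diff_count_flip[of P P "k - 1"] diff_count_flip[of Q P "1 - k"]
  by (simp add: spectrum_count_def diff_count_append_left diff_count_append_right diff_count_shift_left
      diff_count_shift_right)

lemma spectrum_count_step_right:
  "spectrum_count (P @ Q, map (\<lambda>x. x - 1) Q) k =
     spectrum_count (P, Q) k + (diff_count Q Q k + diff_count Q P k) + (diff_count Q Q (1 - k) + diff_count Q P (1 - k))"
  using diff_count_flip[of Q Q "k - 1"] diff_count_flip[of Q P "1 - k"] 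
    diff_count_shift_left[of "-1" Q] diff_count_shift_right[of _ "-1" Q]
  by (simp add: spectrum_count_def diff_count_append_left diff_count_append_right)

lemma spectrum_count_exponents_sym: "spectrum_count (exponents a b) (1 - k) = spectrum_count (exponents a b) k"
proof (induction a b rule: exponents.induct)
  case (1 a b)
  consider "a = 0 \<or> b = 0" | "a \<noteq> 0" "b \<noteq> 0" "a \<le> b" | "a \<noteq> 0" "b \<noteq> 0" "\<not> a \<le> b"
    by blast
  then show ?case
  proof cases
    case 1
    then show ?thesis by (auto simp: exponents.simps[of a b] spectrum_count_def diff_count_def)
  next
    case 2
    obtain P Q where PQ: "exponents a (b - a) = (P, Q)" by fastforce
    have "exponents a b = (map (\<lambda>x. x + 1) P, P @ Q)"
      using 2 by (simp add: exponents.simps[of a b] PQ)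
    with 1(1) 2 PQ show ?thesis by (simp add: spectrum_count_step_left)
  next
    case 3
    obtain P Q where PQ: "exponents (a - b) b = (P, Q)" by fastforce
    have "exponents a b = (P @ Q, map (\<lambda>x. x - 1) Q)"
      using 3 by (simp add: exponents.simps[of a b] PQ)
    with 1(2) 3 PQ show ?thesis by (simp add: spectrum_count_step_right)
  qed
qed

section \<open>Log-concavity along families of spectra\<close>

text \<open>Log-concavity without internal zeros of a sequence that is symmetric under \<open>k \<mapsto> 1 - k\<close>, expressed
  by the indices \<open>k \<ge> 1\<close>; at \<open>k = 1\<close> the left neighbour is \<open>c 0 = c 1\<close>.\<close>

definition half_log_concave :: "(int \<Rightarrow> int) \<Rightarrow> bool" where
  "half_log_concave c \<longleftrightarrow>
     (\<exists>t\<ge>1. \<forall>k\<ge>1. 0 \<le> c k \<and> (0 < c k \<longleftrightarrow> k \<le> t)) \<and>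
     (\<forall>k\<ge>1. c (k - 1) * c (k + 1) \<le> c k * c k)"

lemma int_concave_imp_log_concave:
  fixes x y z :: int
  assumes "0 \<le> x" "0 \<le> z" "x + z \<le> 2 * y"
  shows "x * z \<le> y * y"
proof -
  have "4 * (x * z) = (x + z) * (x + z) - (x - z) * (x - z)" by (simp add: algebra_simps)
  also have "\<dots> \<le> (x + z) * (x + z)" by simp
  also have "\<dots> \<le> (2 * y) * (2 * y)" using assms by (intro mult_mono) auto
  finally show ?thesis by simp
qed

text \<open>The growth pattern of the multiplicities \<open>s q\<close> in the family \<open>b = q a + r\<close>: the increment is
  symmetrized from \<open>V q\<close>, and \<open>V q\<close> itself accumulates shifts of one fixed even function \<open>N\<close>. All
  initial data vanish from distance \<open>D\<close> on.\<close>

locale growing_sequence =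
  fixes s V :: "nat \<Rightarrow> int \<Rightarrow> int" and N :: "int \<Rightarrow> int" and D :: int
  assumes s_Suc: "s (Suc q) k = s q k + V q k + V q (1 - k)"
    and V_Suc: "V (Suc q) k = N k + V q (k + 1)"
    and N_even: "N (- k) = N k"
    and D_pos: "1 \<le> D"
    and N_supp: "D \<le> \<bar>k\<bar> \<Longrightarrow> N k = 0"
    and V0_supp: "D \<le> \<bar>k\<bar> \<Longrightarrow> V 0 k = 0"
    and s0_supp: "D \<le> k \<Longrightarrow> s 0 k = 0"
    and s_sym: "s q (1 - k) = s q k"
    and N_nonneg: "0 \<le> N k"
    and V0_nonneg: "0 \<le> V 0 k"
begin

lemma V_nonneg: "0 \<le> V q k"
  by (induction q arbitrary: k) (auto simp: V_Suc V0_nonneg N_nonneg)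

lemma V_supp: "D \<le> k \<Longrightarrow> V q k = 0"
  using D_pos by (induction q arbitrary: k) (auto simp: V_Suc V0_supp N_supp)

lemma V_diff: "D \<le> k + int q \<Longrightarrow> V q k - V q (k + 1) = N k"
proof (induction q arbitrary: k)
  case 0
  then show ?case using D_pos by (auto simp: V0_supp N_supp)
next
  case (Suc q)
  have "V q (k + 1) - V q (k + 1 + 1) = N (k + 1)" using Suc.prems by (intro Suc.IH) auto
  then show ?case by (simp add: V_Suc)
qed

text \<open>Near the centre the increment does not depend on \<open>k\<close>.\<close>

lemma increment_constant:
  assumes "0 \<le> k" "k + D \<le> int q + 1"
  shows "V q k + V q (1 - k) = V q 0 + V q 1"
  using assms
proof (induction k rule: int_ge_induct)
  case base
  then show ?case by simp
next
  case (step k)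
  have "V q k - V q (k + 1) = N k" using step D_pos by (intro V_diff) auto
  moreover have "V q (- k) - V q (- k + 1) = N (- k)" using step by (intro V_diff) auto
  ultimately show ?case using step by (simp add: N_even algebra_simps)
qed

text \<open>Away from the centre a step is a translation.\<close>

lemma s_shift: "D \<le> k \<Longrightarrow> s (Suc q) (k + 1) = s q k"
proof (induction q arbitrary: k)
  case 0
  then show ?case using D_pos by (simp add: s_Suc s0_supp V0_supp)
next
  case (Suc q)
  have "s (Suc (Suc q)) (k + 1) = s (Suc q) (k + 1) + V (Suc q) (k + 1) + V (Suc q) (- k)"
    by (simp add: s_Suc[of "Suc q"])
  also have "s (Suc q) (k + 1) = s q k" by (rule Suc.IH[OF Suc.prems])
  also have "V (Suc q) (k + 1) = V q k"
    using Suc.prems D_pos by (simp add: V_supp)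
  also have "V (Suc q) (- k) = V q (1 - k)"
    using Suc.prems by (simp add: V_Suc N_supp)
  finally show ?case by (simp add: s_Suc)
qed

lemma s_supp: "D + int q \<le> k \<Longrightarrow> s q k = 0"
proof (induction q arbitrary: k)
  case 0
  then show ?case by (simp add: s0_supp)
next
  case (Suc q)
  have "s (Suc q) (k - 1 + 1) = s q (k - 1)" using Suc.prems by (intro s_shift) auto
  with Suc show ?case by simp
qed

text \<open>For \<open>k \<le> D + 1\<close> the sequence stays concave because a constant is added to it, and concavity implies
  log-concavity. For \<open>k > D + 1\<close> the three values involved are shifted values of \<open>s q\<close>. The hypothesis
  on \<open>q\<close> guarantees that the increment is constant far enough.\<close>

lemma half_log_concave_Suc:
  assumes q: "2 * D + 1 \<le> int q"
    and lc: "half_log_concave (s q)"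
    and pos: "0 < s q (D + 1)"
    and conc: "\<And>k. 1 \<le> k \<Longrightarrow> k \<le> D + 1 \<Longrightarrow> s q (k - 1) + s q (k + 1) \<le> 2 * s q k"
  shows "half_log_concave (s (Suc q))"
    and "0 < s (Suc q) (D + 1)"
    and "\<And>k. 1 \<le> k \<Longrightarrow> k \<le> D + 1 \<Longrightarrow> s (Suc q) (k - 1) + s (Suc q) (k + 1) \<le> 2 * s (Suc q) k"
proof -
  obtain t where t: "t \<ge> 1" "\<And>k. k \<ge> 1 \<Longrightarrow> 0 \<le> s q k \<and> (0 < s q k \<longleftrightarrow> k \<le> t)"
    and lcq: "\<And>k. k \<ge> 1 \<Longrightarrow> s q (k - 1) * s q (k + 1) \<le> s q k * s q k"
    using lc unfolding half_log_concave_def by auto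
  have Dt: "D + 1 \<le> t" using t(2)[of "D + 1"] pos D_pos by auto
  have ge: "s q k \<le> s (Suc q) k" for k
    using V_nonneg[of q k] V_nonneg[of q "1 - k"] by (simp add: s_Suc)
  show "0 < s (Suc q) (D + 1)" using pos ge[of "D + 1"] by simp
  \<comment> \<open>The range reaches \<open>D + 2\<close> because concavity at \<open>D + 1\<close> involves the right neighbour.\<close>
  have const: "s (Suc q) k = s q k + (V q 0 + V q 1)" if "0 \<le> k" "k \<le> D + 2" for k
    using increment_constant[of k q] that q by (simp add: s_Suc)
  show conc': "s (Suc q) (k - 1) + s (Suc q) (k + 1) \<le> 2 * s (Suc q) k" if "1 \<le> k" "k \<le> D + 1" for k
    using const[of "k - 1"] const[of k] const[of "k + 1"] conc[of k] that by simp
  have shift: "s (Suc q) k = s q (k - 1)" if "D + 1 \<le> k" for k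
    using s_shift[of "k - 1" q] that by simp
  have sign: "0 \<le> s (Suc q) k \<and> (0 < s (Suc q) k \<longleftrightarrow> k \<le> t + 1)" if k: "1 \<le> k" for k
  proof (cases "k \<le> D + 1")
    case True
    then show ?thesis using t(2)[OF k] ge[of k] Dt by auto
  next
    case False
    then show ?thesis using shift[of k] t(2)[of "k - 1"] D_pos by auto
  qed
  have lc': "s (Suc q) (k - 1) * s (Suc q) (k + 1) \<le> s (Suc q) k * s (Suc q) k" if k: "1 \<le> k" for k
  proof (cases "k \<le> D + 1")
    case True
    have "0 \<le> s (Suc q) (k - 1)"
      using sign[of "k - 1"] sign[of 1] s_sym[of "Suc q" 1] k by (cases "k = 1") auto
    moreover have "0 \<le> s (Suc q) (k + 1)" using sign[of "k + 1"] k by simp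
    ultimately show ?thesis using conc'[OF k True] by (intro int_concave_imp_log_concave)
  next
    case False
    then show ?thesis
      using lcq[of "k - 1"] shift[of "k - 1"] shift[of k] shift[of "k + 1"] D_pos
      by (simp add: algebra_simps)
  qed
  show "half_log_concave (s (Suc q))"
    unfolding half_log_concave_def using sign lc' t(1) by (intro conjI exI[of _ "t + 1"]) auto
qed

lemma half_log_concave_stable:
  assumes "2 * D + 1 \<le> int q0"
    and "half_log_concave (s q0)"
    and "0 < s q0 (D + 1)"
    and "\<And>k. 1 \<le> k \<Longrightarrow> k \<le> D + 1 \<Longrightarrow> s q0 (k - 1) + s q0 (k + 1) \<le> 2 * s q0 k"
    and "q0 \<le> q"
  shows "half_log_concave (s q)"
proof -
  have "half_log_concave (s q) \<and> 0 < s q (D + 1) \<and>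
      (\<forall>k. 1 \<le> k \<longrightarrow> k \<le> D + 1 \<longrightarrow> s q (k - 1) + s q (k + 1) \<le> 2 * s q k)"
    using \<open>q0 \<le> q\<close>
  proof (induction q rule: dec_induct)
    case base
    then show ?case using assms by auto
  next
    case (step n)
    show ?case using half_log_concave_Suc[of n] step assms(1) by auto
  qed
  then show ?thesis by blast
qed

end

lemma spectrum_count_eq_0:
  assumes "\<And>x y. x \<in> set P \<union> set Q \<Longrightarrow> y \<in> set P \<union> set Q \<Longrightarrow> x - y \<noteq> k" and "k \<noteq> 0"
  shows "spectrum_count (P, Q) k = 0"
  using assms by (simp add: spectrum_count_def diff_count_eq_0)

text \<open>The eigenvalue lists for \<open>(a, q a + r)\<close>.\<close>

definition family :: "nat \<Rightarrow> nat \<Rightarrow> nat \<Rightarrow> int list \<times> int list" where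
  "family a r q = exponents a (q * a + r)"

text \<open>The half-increment of the multiplicities in this family; see \<open>spectrum_count_step_left\<close>.\<close>

definition family_V :: "nat \<Rightarrow> nat \<Rightarrow> nat \<Rightarrow> int \<Rightarrow> int" where
  "family_V a r q k = diff_count (fst (family a r q)) (fst (family a r q)) k
     + diff_count (snd (family a r q)) (fst (family a r q)) k"

lemma family_Suc:
  assumes "0 < a"
  shows "family a r (Suc q) = (map (\<lambda>x. x + 1) (fst (family a r q)), fst (family a r q) @ snd (family a r q))"
proof -
  have "exponents a (a + q * a + r) = (case exponents a (q * a + r) of (P, Q) \<Rightarrow> (map (\<lambda>x. x + 1) P, P @ Q))"
    using assms exponents.simps[of a "a + q * a + r"] by simp
  then show ?thesis by (simp add: family_def case_prod_beta)
qed

lemma diff_count_family: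
  assumes "0 < a"
  shows "diff_count (fst (family a r q)) (fst (family a r q)) = diff_count (fst (exponents a r)) (fst (exponents a r))"
proof (induction q)
  case 0
  then show ?case by (simp add: family_def)
next
  case (Suc q)
  have "diff_count (fst (family a r (Suc q))) (fst (family a r (Suc q))) k =
      diff_count (fst (family a r q)) (fst (family a r q)) k" for k
    by (simp add: family_Suc[OF assms] diff_count_shift_left diff_count_shift_right)
  with Suc show ?case by auto
qed

text \<open>Any two entries differ by less than \<open>D\<close>.\<close>

definition span_less :: "int \<Rightarrow> int list \<Rightarrow> bool" where
  "span_less D xs \<longleftrightarrow> list_all (\<lambda>x. list_all (\<lambda>y. x - y < D) xs) xs"

lemma growing_sequence_family:
  assumes a: "0 < a" and span: "span_less D (fst (exponents a r) @ snd (exponents a r))" and D: "1 \<le> D"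
  shows "growing_sequence (\<lambda>q. spectrum_count (family a r q)) (family_V a r)
           (diff_count (fst (exponents a r)) (fst (exponents a r))) D"
proof -
  let ?P = "fst (exponents a r)" and ?Q = "snd (exponents a r)"
  have far: "x - y < D" if "x \<in> set ?P \<union> set ?Q" "y \<in> set ?P \<union> set ?Q" for x y
    using span that unfolding span_less_def list_all_iff by auto
  have ne: "x - y \<noteq> k" if "D \<le> \<bar>k\<bar>" "x \<in> set ?P \<union> set ?Q" "y \<in> set ?P \<union> set ?Q" for x y k
    using far[of x y] far[of y x] that by auto
  show ?thesis
  proof
    fix q k
    show "spectrum_count (family a r (Suc q)) k =
        spectrum_count (family a r q) k + family_V a r q k + family_V a r q (1 - k)"
      by (simp add: family_Suc[OF a] spectrum_count_step_left family_V_def)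
    show "family_V a r (Suc q) k = diff_count ?P ?P k + family_V a r q (k + 1)"
      using diff_count_family[OF a, of r q] diff_count_family[OF a, of r "Suc q"]
      by (simp add: family_V_def family_Suc[OF a] diff_count_append_left diff_count_shift_right diff_count_shift_left)
    show "spectrum_count (family a r q) (1 - k) = spectrum_count (family a r q) k"
      by (simp add: family_def spectrum_count_exponents_sym)
  next
    fix k
    show "diff_count ?P ?P (- k) = diff_count ?P ?P k" by (rule diff_count_flip[symmetric])
    show "diff_count ?P ?P k = 0" if "D \<le> \<bar>k\<bar>" using ne[OF that] by (auto intro: diff_count_eq_0)
    show "family_V a r 0 k = 0" if "D \<le> \<bar>k\<bar>"
      using ne[OF that] by (simp add: family_V_def family_def diff_count_eq_0)
    show "spectrum_count (family a r 0) k = 0" if "D \<le> k"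
    proof -
      have "spectrum_count (?P, ?Q) k = 0" using that D by (intro spectrum_count_eq_0 ne) auto
      then show ?thesis by (simp add: family_def)
    qed
    show "0 \<le> family_V a r 0 k" "0 \<le> diff_count ?P ?P k"
      by (auto simp: family_V_def diff_count_nonneg)
  qed (rule D)
qed

section \<open>A finite check for each family\<close>

text \<open>The following functions decide the conditions on rows of numbers \<open>c 1, c 2, \<dots>\<close> given as lists.\<close>

fun list_log_concave :: "int list \<Rightarrow> bool" where
  "list_log_concave (x # y # z # zs) \<longleftrightarrow> x * z \<le> y * y \<and> list_log_concave (y # z # zs)"
| "list_log_concave _ \<longleftrightarrow> True"

fun list_concave :: "int list \<Rightarrow> bool" where
  "list_concave (x # y # z # zs) \<longleftrightarrow> x + z \<le> y + y \<and> list_concave (y # z # zs)"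
| "list_concave _ \<longleftrightarrow> True"

fun positive_then_zero :: "int list \<Rightarrow> bool" where
  "positive_then_zero (x # xs) \<longleftrightarrow> (if x = 0 then list_all (\<lambda>y. y = 0) xs else 0 < x \<and> positive_then_zero xs)"
| "positive_then_zero [] \<longleftrightarrow> True"

lemma list_log_concave_nth:
  "list_log_concave xs \<Longrightarrow> i + 2 < length xs \<Longrightarrow> xs ! i * xs ! (i + 2) \<le> xs ! (i + 1) * xs ! (i + 1)"
proof (induction xs arbitrary: i rule: list_log_concave.induct)
  case (1 x y z zs)
  then show ?case by (cases i) auto
qed auto

lemma list_concave_nth:
  "list_concave xs \<Longrightarrow> i + 2 < length xs \<Longrightarrow> xs ! i + xs ! (i + 2) \<le> 2 * xs ! (i + 1)"
proof (induction xs arbitrary: i rule: list_concave.induct)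
  case (1 x y z zs)
  then show ?case by (cases i) auto
qed auto

lemma positive_then_zero_nth:
  "positive_then_zero xs \<Longrightarrow>
     \<exists>t\<le>length xs. (\<forall>i<length xs. 0 \<le> xs ! i \<and> (0 < xs ! i \<longleftrightarrow> i < t))"
proof (induction xs)
  case Nil
  then show ?case by simp
next
  case (Cons x xs)
  show ?case
  proof (cases "x = 0")
    case True
    then have "\<forall>i<length (x # xs). (x # xs) ! i = 0"
      using Cons.prems by (auto simp: nth_Cons list_all_length split: nat.splits)
    then show ?thesis by (intro exI[of _ 0]) auto
  next
    case False
    then obtain t where "t \<le> length xs" "\<forall>i<length xs. 0 \<le> xs ! i \<and> (0 < xs ! i \<longleftrightarrow> i < t)"
      and "0 < x"
      using Cons by auto
    then show ?thesis
      by (intro exI[of _ "Suc t"]) (auto simp: nth_Cons split: nat.splits)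
  qed
qed

fun add_lists :: "int list \<Rightarrow> int list \<Rightarrow> int list" where
  "add_lists (x # xs) (y # ys) = (x + y) # add_lists xs ys"
| "add_lists _ _ = []"

lemma add_lists_eq: "add_lists xs ys = map2 (+) xs ys"
  by (induction xs ys rule: add_lists.induct) auto

text \<open>The row starts at index \<open>1\<close>. Its head is repeated in front because the symmetry gives \<open>c 0 = c 1\<close>.\<close>

definition good_row :: "int list \<Rightarrow> bool" where
  "good_row s \<longleftrightarrow> 0 < hd s \<and> positive_then_zero s \<and> list_log_concave (hd s # s)"

text \<open>A run of the recursion of \<open>growing_sequence\<close>. The lists \<open>s\<close>, \<open>u\<close>, \<open>v\<close> hold the values \<open>s q k\<close>, \<open>V q k\<close> and
  \<open>V q (1 - k)\<close> for \<open>k = 1, 2, \<dots>\<close>, and the constant lists \<open>N\<close>, \<open>M\<close> hold \<open>N k\<close> and \<open>N (k - 1)\<close>. Each new row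
  is checked, and the last one also for positivity and concavity up to index \<open>D + 1\<close>, where \<open>D = d\<close>.
  The second function only serves to evaluate each new row once.\<close>

fun check_rows :: "nat \<Rightarrow> int list \<Rightarrow> int list \<Rightarrow> nat \<Rightarrow> int list \<Rightarrow> int list \<Rightarrow> int list \<Rightarrow> bool"
  and check_row :: "nat \<Rightarrow> int list \<Rightarrow> int list \<Rightarrow> nat \<Rightarrow> int list \<Rightarrow> int list \<Rightarrow> int list \<Rightarrow> bool" where
  "check_rows d N M 0 s u v \<longleftrightarrow> 0 < s ! d \<and> list_concave (take (d + 3) (hd s # s))"
| "check_rows d N M (Suc n) s u v \<longleftrightarrow> check_row d N M n (add_lists s (add_lists u v))
     (add_lists N (tl u @ [0])) (add_lists M (hd u # butlast v))"
| "check_row d N M n s u v \<longleftrightarrow> good_row s \<and> check_rows d N M n s u v"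

text \<open>The values of \<open>f\<close> at \<open>1, \<dots>, d\<close>, padded by \<open>n\<close> zeros.\<close>

definition table :: "nat \<Rightarrow> nat \<Rightarrow> (int \<Rightarrow> int) \<Rightarrow> int list" where
  "table d n f = map (\<lambda>k. f (int k + 1)) [0..<d] @ replicate n 0"

lemma table_eq:
  assumes "\<And>k. int d < k \<Longrightarrow> f k = 0"
  shows "table d n f = map (\<lambda>k. f (int k + 1)) [0..<d + n]"
proof -
  have "map (\<lambda>k. f (int k + 1)) [d..<d + n] = replicate n 0"
    using assms by (intro nth_equalityI) auto
  then show ?thesis by (simp only: table_def upt_add_eq_append[OF le0] map_append)
qed

context growing_sequence
begin

lemma half_log_concave_good_row:
  assumes row: "good_row (map (\<lambda>k. s q (int k + 1)) [0..<T])" and T: "D + int q \<le> int T"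
  shows "half_log_concave (s q)"
proof -
  let ?xs = "map (\<lambda>k. s q (int k + 1)) [0..<T]"
  have T0: "0 < T" using T D_pos by simp
  have hd: "hd ?xs = s q 0" using T0 s_sym[of q 0] by (simp add: hd_map)
  obtain t where t: "t \<le> T" "\<And>i. i < T \<Longrightarrow> 0 \<le> s q (int i + 1) \<and> (0 < s q (int i + 1) \<longleftrightarrow> i < t)"
    using row positive_then_zero_nth[of ?xs] unfolding good_row_def by auto
  have "1 \<le> t" using row hd t(2)[of 0] T0 s_sym[of q 0] unfolding good_row_def by auto
  moreover have "0 \<le> s q k \<and> (0 < s q k \<longleftrightarrow> k \<le> int t)" if "1 \<le> k" for k
  proof (cases "k \<le> int T")
    case True
    then show ?thesis using t(2)[of "nat (k - 1)"] that by auto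
  next
    case False
    then show ?thesis using s_supp[of q k] T t(1) by auto
  qed
  moreover have "s q (k - 1) * s q (k + 1) \<le> s q k * s q k" if k: "1 \<le> k" for k
  proof (cases "k + 1 \<le> int T")
    case True
    have ex: "(s q 0 # ?xs) ! i = s q (int i)" if "i \<le> T" for i
      using that by (cases i) (auto simp: add.commute)
    show ?thesis
      using list_log_concave_nth[of "s q 0 # ?xs" "nat (k - 1)"] row True k
        ex[of "nat (k - 1)"] ex[of "nat (k - 1) + 1"] ex[of "nat (k - 1) + 2"]
      unfolding good_row_def hd by (simp add: algebra_simps)
  next
    case False
    then have "s q (k + 1) = 0" using T by (intro s_supp) auto
    then show ?thesis by simp
  qed
  ultimately show ?thesis unfolding half_log_concave_def by (intro conjI exI[of _ "int t"]) auto
qed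

lemma check_rows_sound:
  assumes "check_rows d (map (\<lambda>k. N (int k + 1)) [0..<T]) (map (\<lambda>k. N (int k)) [0..<T]) n
      (map (\<lambda>k. s q (int k + 1)) [0..<T]) (map (\<lambda>k. V q (int k + 1)) [0..<T])
      (map (\<lambda>k. V q (- int k)) [0..<T])"
    and "D + int q + int n \<le> int T" and "int d = D" and "2 * D + 1 \<le> int q + int n"
    and "q = 0 \<or> half_log_concave (s q)"
  shows "0 < q' \<Longrightarrow> q \<le> q' \<Longrightarrow> half_log_concave (s q')"
  using assms
proof (induction n arbitrary: q)
  case 0
  let ?xs = "map (\<lambda>k. s q (int k + 1)) [0..<T]"
  have dT: "d + 2 < T" using 0 D_pos by linarith
  have hd: "hd ?xs = s q 0" using dT s_sym[of q 0] by (simp add: hd_map)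
  have q0: "2 * D + 1 \<le> int q" using 0 by simp
  have pos: "0 < s q (D + 1)" and con: "list_concave (take (d + 3) (s q 0 # ?xs))"
    using "0.prems"(3) dT \<open>int d = D\<close> hd by auto
  have ex: "take (d + 3) (s q 0 # ?xs) ! i = s q (int i)" if "i < d + 3" for i
    using that dT by (cases i) (auto simp: add.commute)
  have "s q (k - 1) + s q (k + 1) \<le> 2 * s q k" if "1 \<le> k" "k \<le> D + 1" for k
    using list_concave_nth[OF con, of "nat (k - 1)"] that dT \<open>int d = D\<close>
      ex[of "nat (k - 1)"] ex[of "nat (k - 1) + 1"] ex[of "nat (k - 1) + 2"]
    by (simp add: algebra_simps)
  moreover have "half_log_concave (s q)" using 0 q0 D_pos by auto
  ultimately show ?case using half_log_concave_stable[OF q0 _ pos] 0 by blast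
next
  case (Suc n)
  let ?m = "\<lambda>f. map f [0..<T]"
  have T0: "0 < T" and DT: "D \<le> int T" using Suc.prems D_pos by linarith+
  have 1: "add_lists (?m (\<lambda>k. s q (int k + 1))) (add_lists (?m (\<lambda>k. V q (int k + 1))) (?m (\<lambda>k. V q (- int k))))
      = ?m (\<lambda>k. s (Suc q) (int k + 1))"
    unfolding add_lists_eq by (intro nth_equalityI) (auto simp: s_Suc)
  have 2: "add_lists (?m (\<lambda>k. N (int k + 1))) (tl (?m (\<lambda>k. V q (int k + 1))) @ [0])
      = ?m (\<lambda>k. V (Suc q) (int k + 1))"
    unfolding add_lists_eq using T0 DT
    by (intro nth_equalityI) (auto simp: V_Suc nth_append nth_tl V_supp algebra_simps not_less intro!: V_supp[symmetric])
  have 3: "add_lists (?m (\<lambda>k. N (int k))) (hd (?m (\<lambda>k. V q (int k + 1))) # butlast (?m (\<lambda>k. V q (- int k))))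
      = ?m (\<lambda>k. V (Suc q) (- int k))"
  proof (rule nth_equalityI)
    show "length (add_lists (?m (\<lambda>k. N (int k))) (hd (?m (\<lambda>k. V q (int k + 1))) # butlast (?m (\<lambda>k. V q (- int k)))))
        = length (?m (\<lambda>k. V (Suc q) (- int k)))"
      using T0 by (simp add: add_lists_eq)
    fix i
    assume "i < length (add_lists (?m (\<lambda>k. N (int k))) (hd (?m (\<lambda>k. V q (int k + 1))) # butlast (?m (\<lambda>k. V q (- int k)))))"
    then have i: "i < T" using T0 by (simp add: add_lists_eq)
    have "hd (?m (\<lambda>k. V q (int k + 1))) = V q 1" using T0 by (simp add: hd_map)
    then show "add_lists (?m (\<lambda>k. N (int k))) (hd (?m (\<lambda>k. V q (int k + 1))) # butlast (?m (\<lambda>k. V q (- int k)))) ! i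
        = ?m (\<lambda>k. V (Suc q) (- int k)) ! i"
      using i by (cases i) (simp_all add: add_lists_eq V_Suc N_even nth_butlast)
  qed
  have good: "good_row (?m (\<lambda>k. s (Suc q) (int k + 1)))"
    and rest: "check_rows d (?m (\<lambda>k. N (int k + 1))) (?m (\<lambda>k. N (int k))) n (?m (\<lambda>k. s (Suc q) (int k + 1)))
       (?m (\<lambda>k. V (Suc q) (int k + 1))) (?m (\<lambda>k. V (Suc q) (- int k)))"
    using Suc.prems(3) unfolding check_rows.simps check_row.simps 1 2 3 by auto
  have lc: "half_log_concave (s (Suc q))"
    using Suc.prems by (intro half_log_concave_good_row[OF good]) auto
  show ?case
  proof (cases "q' = q")
    case True
    then show ?thesis using Suc.prems by auto
  next
    case False
    then show ?thesis using Suc.prems lc by (intro Suc.IH[of "Suc q"] rest) auto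
  qed
qed

end

text \<open>The check for the family that starts with the eigenvalue lists \<open>P\<close> and \<open>Q\<close>, for \<open>n\<close> steps and
  with \<open>D = d\<close>.\<close>

definition check_lists :: "nat \<Rightarrow> nat \<Rightarrow> int list \<Rightarrow> int list \<Rightarrow> bool" where
  "check_lists d n P Q \<longleftrightarrow> span_less (int d) (P @ Q) \<and>
     check_rows d (table d n (diff_count P P)) (table d n (\<lambda>k. diff_count P P (k - 1))) n
       (table d n (spectrum_count (P, Q))) (table d n (\<lambda>k. diff_count P P k + diff_count Q P k))
       (table d n (\<lambda>k. diff_count P P (1 - k) + diff_count Q P (1 - k)))"

text \<open>The bound \<open>D = a + 1\<close> on the differences suffices for the pairs of interest, and that it holds is part
  of the check; \<open>2 D + 1\<close> steps reach the stable range.\<close>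

definition check_family :: "nat \<Rightarrow> nat \<Rightarrow> bool" where
  "check_family a r \<longleftrightarrow> check_lists (Suc a) (2 * a + 3) (fst (exponents a r)) (snd (exponents a r))"

lemma check_family_sound:
  assumes check: "check_family a r" and a: "0 < a" and q: "0 < q"
  shows "half_log_concave (spectrum_count (exponents a (q * a + r)))"
proof -
  let ?P = "fst (exponents a r)" and ?Q = "snd (exponents a r)"
  let ?d = "Suc a" and ?n = "2 * a + 3"
  have span: "span_less (int ?d) (?P @ ?Q)"
    using check unfolding check_family_def check_lists_def by blast
  interpret growing_sequence "\<lambda>q. spectrum_count (family a r q)" "family_V a r" "diff_count ?P ?P" "int ?d"
    by (rule growing_sequence_family[OF a span]) simp
  have V0: "family_V a r 0 k = diff_count ?P ?P k + diff_count ?Q ?P k" for k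
    by (simp add: family_V_def family_def)
  have s0: "spectrum_count (family a r 0) = spectrum_count (?P, ?Q)" by (simp add: family_def)
  have "half_log_concave (spectrum_count (family a r q))"
  proof (rule check_rows_sound[where T = "?d + ?n" and n = ?n and q = 0 and d = ?d])
    have t: "table ?d ?n (diff_count ?P ?P) = map (\<lambda>k. diff_count ?P ?P (int k + 1)) [0..<?d + ?n]"
      "table ?d ?n (\<lambda>k. diff_count ?P ?P (k - 1)) = map (\<lambda>k. diff_count ?P ?P (int k)) [0..<?d + ?n]"
      "table ?d ?n (spectrum_count (?P, ?Q)) = map (\<lambda>k. spectrum_count (family a r 0) (int k + 1)) [0..<?d + ?n]"
      "table ?d ?n (\<lambda>k. diff_count ?P ?P k + diff_count ?Q ?P k) = map (\<lambda>k. family_V a r 0 (int k + 1)) [0..<?d + ?n]"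
      "table ?d ?n (\<lambda>k. diff_count ?P ?P (1 - k) + diff_count ?Q ?P (1 - k)) =
         map (\<lambda>k. family_V a r 0 (- int k)) [0..<?d + ?n]"
      using N_supp V0_supp s0_supp by (subst table_eq; simp add: V0 s0)+
    show "check_rows ?d (map (\<lambda>k. diff_count ?P ?P (int k + 1)) [0..<?d + ?n])
        (map (\<lambda>k. diff_count ?P ?P (int k)) [0..<?d + ?n]) ?n
        (map (\<lambda>k. spectrum_count (family a r 0) (int k + 1)) [0..<?d + ?n])
        (map (\<lambda>k. family_V a r 0 (int k + 1)) [0..<?d + ?n])
        (map (\<lambda>k. family_V a r 0 (- int k)) [0..<?d + ?n])"
      using check unfolding check_family_def check_lists_def t by blast
  qed (use q in auto)
  then show ?thesis by (simp add: family_def)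
qed

text \<open>All coprime pairs \<open>(a, r)\<close> with \<open>r < a\<close> for the relevant sizes \<open>a\<close> of the smaller block.\<close>

definition checked_families :: "(nat \<times> nat) list" where
  "checked_families = concat (map (\<lambda>a. map (Pair a) (filter (\<lambda>r. gcd a r = 1) [0..<a]))
     [1, 2, 3, 4, 5, 6, 7, 8, 10])"

lemma check_checked_families: "list_all (\<lambda>(a, r). check_family a r) checked_families"
  by code_simp

lemma checked_families_complete:
  assumes "0 < a" "a \<le> 8 \<or> a = 10" "r < a" "coprime a r"
  shows "(a, r) \<in> set checked_families"
proof -
  have mem: "(a, r) \<in> set (concat (map (\<lambda>a. map (Pair a) (filter (\<lambda>r. gcd a r = 1) [0..<a])) as)) \<longleftrightarrow>
      a \<in> set as \<and> r < a \<and> gcd a r = 1" for as :: "nat list"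
    by auto
  have "a \<in> set [1, 2, 3, 4, 5, 6, 7, 8, 10]" using assms(1,2) by auto
  moreover have "gcd a r = 1" using assms(4) by (simp only: coprime_iff_gcd_eq_1)
  ultimately show ?thesis
    unfolding checked_families_def mem using assms(3) by (intro conjI)
qed

theorem half_log_concave_exponents:
  assumes a: "0 < a" and ab: "a \<le> b" and co: "coprime a b" and small: "a \<le> 8 \<or> a = 10"
  shows "half_log_concave (spectrum_count (exponents a b))"
proof -
  have "coprime a (b mod a)" using co by (simp add: coprime_iff_gcd_eq_1 gcd.commute gcd_red_nat[symmetric])
  then have "(a, b mod a) \<in> set checked_families"
    using a small by (intro checked_families_complete) auto
  then have "check_family a (b mod a)" using check_checked_families by (auto simp: list_all_iff)
  moreover have "0 < b div a" using a ab by (simp add: div_greater_zero_iff)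
  ultimately have "half_log_concave (spectrum_count (exponents a (b div a * a + b mod a)))"
    using a by (intro check_family_sound)
  then show ?thesis by simp
qed

section \<open>The equations of a principal element\<close>

text \<open>With \<open>F\<close> the block lower triangular matrix with blocks \<open>A\<close>, \<open>U\<close>, \<open>B\<close> and \<open>h\<close> the block upper triangular
  matrix with blocks \<open>X\<close>, \<open>Z\<close>, \<open>Y\<close>, the equations say that \<open>F h - h F = e F\<close> outside the upper right
  block. The parameter \<open>e\<close> is \<open>0\<close> for the kernel of the form of the functional given by \<open>F\<close>, and \<open>1\<close>
  for its principal elements.\<close>

definition structure_eqs ::
  "nat \<Rightarrow> nat \<Rightarrow> complex \<Rightarrow> complex mat \<Rightarrow> complex mat \<Rightarrow> complex mat \<Rightarrow>
     complex mat \<Rightarrow> complex mat \<Rightarrow> complex mat \<Rightarrow> bool" where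
  "structure_eqs a b e A B U X Y Z \<longleftrightarrow>
     X \<in> carrier_mat a a \<and> Y \<in> carrier_mat b b \<and> Z \<in> carrier_mat a b \<and>
     U * X - Y * U = e \<cdot>\<^sub>m U \<and> A * X - X * A - Z * U = e \<cdot>\<^sub>m A \<and> B * Y - Y * B + U * Z = e \<cdot>\<^sub>m B"

text \<open>The functional given by \<open>A\<close>, \<open>B\<close>, \<open>U\<close> has only scalar matrices in its kernel. Here the kernel is taken
  in the algebra without trace condition, which is the direct sum of \<open>W(a, b)\<close> and the scalars.\<close>

definition frobenius_data :: "nat \<Rightarrow> nat \<Rightarrow> complex mat \<Rightarrow> complex mat \<Rightarrow> complex mat \<Rightarrow> bool" where
  "frobenius_data a b A B U \<longleftrightarrow>
     A \<in> carrier_mat a a \<and> B \<in> carrier_mat b b \<and> U \<in> carrier_mat b a \<and>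
     (\<forall>X Y Z. structure_eqs a b 0 A B U X Y Z \<longrightarrow>
        (\<exists>c. X = c \<cdot>\<^sub>m 1\<^sub>m a \<and> Y = c \<cdot>\<^sub>m 1\<^sub>m b \<and> Z = 0\<^sub>m a b))"

lemma eq_zero_matI:
  assumes "M \<in> carrier_mat n m" "\<And>i j. i < n \<Longrightarrow> j < m \<Longrightarrow> M $$ (i, j) = 0"
  shows "M = 0\<^sub>m n m"
  using assms by (intro eq_matI) auto

lemma four_block_mat_eq_iff:
  assumes "A \<in> carrier_mat n1 m1" "B \<in> carrier_mat n1 m2" "C \<in> carrier_mat n2 m1" "D \<in> carrier_mat n2 m2"
    and "A' \<in> carrier_mat n1 m1" "B' \<in> carrier_mat n1 m2" "C' \<in> carrier_mat n2 m1" "D' \<in> carrier_mat n2 m2"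
  shows "four_block_mat A B C D = four_block_mat A' B' C' D' \<longleftrightarrow> A = A' \<and> B = B' \<and> C = C' \<and> D = D'"
proof
  assume eq: "four_block_mat A B C D = four_block_mat A' B' C' D'"
  have e: "four_block_mat A B C D $$ (i, j) = four_block_mat A' B' C' D' $$ (i, j)" for i j
    using eq by simp
  have "A = A'" 
  proof (rule eq_matI)
    fix i j assume "i < dim_row A'" "j < dim_col A'"
    then show "A $$ (i, j) = A' $$ (i, j)" using e[of i j] assms by auto
  qed (use assms in auto)
  moreover have "B = B'"
  proof (rule eq_matI)
    fix i j assume "i < dim_row B'" "j < dim_col B'"
    then show "B $$ (i, j) = B' $$ (i, j)" using e[of i "m1 + j"] assms by auto
  qed (use assms in auto)
  moreover have "C = C'"
  proof (rule eq_matI)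
    fix i j assume "i < dim_row C'" "j < dim_col C'"
    then show "C $$ (i, j) = C' $$ (i, j)" using e[of "n1 + i" j] assms by auto
  qed (use assms in auto)
  moreover have "D = D'"
  proof (rule eq_matI)
    fix i j assume "i < dim_row D'" "j < dim_col D'"
    then show "D $$ (i, j) = D' $$ (i, j)" using e[of "n1 + i" "m1 + j"] assms by auto
  qed (use assms in auto)
  ultimately show "A = A' \<and> B = B' \<and> C = C' \<and> D = D'" by blast
qed auto

lemma four_block_mat_cases:
  assumes M: "M \<in> carrier_mat (n1 + n2) (m1 + m2)"
  obtains A B C D where "M = four_block_mat A B C D" "A \<in> carrier_mat n1 m1" "B \<in> carrier_mat n1 m2"
    "C \<in> carrier_mat n2 m1" "D \<in> carrier_mat n2 m2"
proof -
  obtain A B C D where s: "split_block M n1 m1 = (A, B, C, D)" by (cases "split_block M n1 m1") auto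
  from split_block[OF s, of n2 m2] M that show ?thesis by auto
qed

lemma mult_block_triangular:
  fixes X :: "complex mat"
  assumes "X \<in> carrier_mat a a" "Z \<in> carrier_mat a b" "Y \<in> carrier_mat b b"
    "X' \<in> carrier_mat a a" "Z' \<in> carrier_mat a b" "Y' \<in> carrier_mat b b"
  shows "four_block_mat X Z (0\<^sub>m b a) Y * four_block_mat X' Z' (0\<^sub>m b a) Y' =
    four_block_mat (X * X') (X * Z' + Z * Y') (0\<^sub>m b a) (Y * Y')"
  using assms by (subst mult_four_block_mat[where ?nr1.0 = a and ?nr2.0 = b and ?n1.0 = a and ?n2.0 = b])
    (auto simp: left_mult_zero_mat[of _ b] right_mult_zero_mat[of _ _ b])

text \<open>The inclusion of the first \<open>a\<close> of \<open>a + c\<close> coordinates.\<close>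

definition embedding_mat :: "nat \<Rightarrow> nat \<Rightarrow> complex mat" where
  "embedding_mat a c = mat (a + c) a (\<lambda>(i, j). if i = j then 1 else 0)"

lemma embedding_mat_carrier[simp]: "embedding_mat a c \<in> carrier_mat (a + c) a"
  by (simp add: embedding_mat_def)

lemma dim_embedding_mat[simp]: "dim_row (embedding_mat a c) = a + c" "dim_col (embedding_mat a c) = a"
  by (simp_all add: embedding_mat_def)

lemma embedding_mat_mult:
  assumes "X \<in> carrier_mat a n" "i < a + c" "j < n"
  shows "(embedding_mat a c * X) $$ (i, j) = (if i < a then X $$ (i, j) else 0)"
proof -
  have "(embedding_mat a c * X) $$ (i, j) = (\<Sum>k = 0..<a. (if i = k then 1 else 0) * X $$ (k, j))"
    using assms by (simp add: embedding_mat_def scalar_prod_def)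
  also have "\<dots> = (\<Sum>k = 0..<a. if i = k then X $$ (k, j) else 0)"
    by (intro sum.cong) auto
  finally show ?thesis by simp
qed

lemma mult_embedding_mat:
  assumes "Y \<in> carrier_mat r (a + c)" "i < r" "j < a"
  shows "(Y * embedding_mat a c) $$ (i, j) = Y $$ (i, j)"
proof -
  have "(Y * embedding_mat a c) $$ (i, j) = (\<Sum>k = 0..<a + c. Y $$ (i, k) * (if k = j then 1 else 0))"
    using assms by (simp add: embedding_mat_def scalar_prod_def)
  also have "\<dots> = (\<Sum>k = 0..<a + c. if k = j then Y $$ (i, k) else 0)"
    by (intro sum.cong) auto
  finally show ?thesis using assms by simp
qed

lemma mat_minus_eq_swap:
  fixes P :: "complex mat"
  assumes "P \<in> carrier_mat n m" "Z \<in> carrier_mat n m" "E \<in> carrier_mat n m"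
  shows "P - Z = E \<longleftrightarrow> Z = P - E"
proof
  assume eq: "P - Z = E"
  show "Z = P - E" unfolding eq[symmetric] using assms by (intro eq_matI) auto
next
  assume eq: "Z = P - E"
  show "P - Z = E" unfolding eq using assms by (intro eq_matI) auto
qed

lemma mat_solve_summand:
  fixes P :: "complex mat"
  assumes "P \<in> carrier_mat n m" "Q \<in> carrier_mat n m" "Z \<in> carrier_mat n m" "E \<in> carrier_mat n m"
  shows "P - Q + Z = E \<longleftrightarrow> Z = E - P + Q"
proof
  assume eq: "P - Q + Z = E"
  show "Z = E - P + Q" unfolding eq[symmetric] using assms by (intro eq_matI) auto
next
  assume eq: "Z = E - P + Q"
  show "P - Q + Z = E" unfolding eq using assms by (intro eq_matI) auto
qed

lemma mat_add_minus_rotate: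
  fixes P :: "complex mat"
  assumes "P \<in> carrier_mat n m" "Q \<in> carrier_mat n m" "R \<in> carrier_mat n m"
  shows "P + Q - R = Q - R + P"
  using assms by (intro eq_matI) auto

lemma mat_eliminate_summand:
  fixes P :: "complex mat"
  assumes "P \<in> carrier_mat n m" "Q \<in> carrier_mat n m" "R \<in> carrier_mat n m"
    "P' \<in> carrier_mat n m" "Q' \<in> carrier_mat n m" "E \<in> carrier_mat n m" "E' \<in> carrier_mat n m"
  shows "P - (Q + R) + (P' - Q' - E') = E \<longleftrightarrow> P' + P - (Q' + Q) - R = E' + E"
proof
  assume eq: "P - (Q + R) + (P' - Q' - E') = E"
  show "P' + P - (Q' + Q) - R = E' + E"
    unfolding eq[symmetric] using assms by (intro eq_matI) auto
next
  assume eq: "P' + P - (Q' + Q) - R = E' + E"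
  have "E = E' + E - E'" using assms by (intro eq_matI) auto
  then have "E = P' + P - (Q' + Q) - R - E'" by (simp only: eq)
  then show "P - (Q + R) + (P' - Q' - E') = E"
    using assms by (simp only:) (intro eq_matI, auto)
qed

lemma minus_four_block_mat:
  assumes "A \<in> carrier_mat n1 m1" "B \<in> carrier_mat n1 m2" "C \<in> carrier_mat n2 m1" "D \<in> carrier_mat n2 m2"
    and "A' \<in> carrier_mat n1 m1" "B' \<in> carrier_mat n1 m2" "C' \<in> carrier_mat n2 m1" "D' \<in> carrier_mat n2 m2"
  shows "four_block_mat A B C D - four_block_mat A' B' C' D' =
    four_block_mat (A - A') (B - B') (C - C') (D - D')"
  using assms by (intro eq_matI) auto

text \<open>The Euclidean step. If \<open>U\<close> is the inclusion, the equations for \<open>(a, a + c)\<close> determine \<open>Z\<close> and are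
  otherwise the equations for \<open>(a, c)\<close>. The upper left block of the larger solution is shifted by
  \<open>e\<close>, which is where the eigenvalues move.\<close>

lemma structure_eqs_embedding_blocks:
  assumes A: "A \<in> carrier_mat a a"
    and B: "B11 \<in> carrier_mat a a" "B12 \<in> carrier_mat a c" "B21 \<in> carrier_mat c a" "B22 \<in> carrier_mat c c"
    and X: "X \<in> carrier_mat a a" and V: "V \<in> carrier_mat a c" and Y: "Y \<in> carrier_mat c c"
    and Z: "Z1 \<in> carrier_mat a a" "Z2 \<in> carrier_mat a c"
  shows "structure_eqs a (a + c) e A (four_block_mat B11 B12 B21 B22) (embedding_mat a c)
      (X + e \<cdot>\<^sub>m 1\<^sub>m a) (four_block_mat X V (0\<^sub>m c a) Y) (four_block_mat Z1 Z2 (0\<^sub>m 0 a) (0\<^sub>m 0 c)) \<longleftrightarrow>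
    structure_eqs a c e (A + B11) B22 B21 X Y V \<and> Z1 = A * X - X * A - e \<cdot>\<^sub>m A \<and>
    Z2 = e \<cdot>\<^sub>m B12 - (B11 * V + B12 * Y) + (X * B12 + V * B22)" (is "?L \<longleftrightarrow> ?R")
proof -
  let ?J = "embedding_mat a c"
  let ?B = "four_block_mat B11 B12 B21 B22"
  let ?X = "X + e \<cdot>\<^sub>m 1\<^sub>m a" and ?Y = "four_block_mat X V (0\<^sub>m c a) Y"
    and ?Z = "four_block_mat Z1 Z2 (0\<^sub>m 0 a) (0\<^sub>m 0 c)"
  note cs = A B X V Y Z
  have Yc: "?Y \<in> carrier_mat (a + c) (a + c)" and Bc: "?B \<in> carrier_mat (a + c) (a + c)"
    using cs by auto
  have Zc: "?Z \<in> carrier_mat a (a + c)" using four_block_carrier_mat[OF Z(1), of "0\<^sub>m 0 c" 0 c Z2 "0\<^sub>m 0 a"] by simp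
  have Xc: "?X \<in> carrier_mat a a" using X by simp
  have 1: "?J * ?X - ?Y * ?J = e \<cdot>\<^sub>m ?J"
  proof (rule eq_matI)
    fix i j assume "i < dim_row (e \<cdot>\<^sub>m ?J)" "j < dim_col (e \<cdot>\<^sub>m ?J)"
    then have ij: "i < a + c" "j < a" by (auto simp: embedding_mat_def)
    then show "(?J * ?X - ?Y * ?J) $$ (i, j) = (e \<cdot>\<^sub>m ?J) $$ (i, j)"
      using embedding_mat_mult[OF Xc ij] mult_embedding_mat[OF Yc ij] cs
      by (auto simp: embedding_mat_def)
  qed (use cs in auto)
  have ZJ: "?Z * ?J = Z1"
  proof (rule eq_matI)
    fix i j assume ij: "i < dim_row Z1" "j < dim_col Z1"
    then show "(?Z * ?J) $$ (i, j) = Z1 $$ (i, j)"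
      using mult_embedding_mat[OF Zc, of i j] cs by auto
  qed (use cs Zc in \<open>auto simp: embedding_mat_def\<close>)
  have comm: "A * ?X - ?X * A = A * X - X * A"
    using cs by (simp add: mult_add_distrib_mat[of _ a a] add_mult_distrib_mat[of _ a a])
      (intro eq_matI, auto)
  have 2: "A * ?X - ?X * A - ?Z * ?J = e \<cdot>\<^sub>m A \<longleftrightarrow> Z1 = A * X - X * A - e \<cdot>\<^sub>m A"
    unfolding comm ZJ
    using cs by (intro mat_minus_eq_swap[of _ a a]) auto
  have JZ: "?J * ?Z = four_block_mat Z1 Z2 (0\<^sub>m c a) (0\<^sub>m c c)"
  proof (rule eq_matI)
    fix i j assume "i < dim_row (four_block_mat Z1 Z2 (0\<^sub>m c a) (0\<^sub>m c c))" "j < dim_col (four_block_mat Z1 Z2 (0\<^sub>m c a) (0\<^sub>m c c))"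
    then have "i < a + c" "j < a + c" using cs by auto
    then show "(?J * ?Z) $$ (i, j) = four_block_mat Z1 Z2 (0\<^sub>m c a) (0\<^sub>m c c) $$ (i, j)"
      using embedding_mat_mult[OF Zc, of i c j] cs by auto
  qed (use cs Zc in \<open>auto simp: embedding_mat_def\<close>)
  have BY: "?B * ?Y = four_block_mat (B11 * X) (B11 * V + B12 * Y) (B21 * X) (B21 * V + B22 * Y)"
    using cs by (subst mult_four_block_mat[where ?nr1.0 = a and ?nr2.0 = c and ?n1.0 = a and ?n2.0 = c]) (auto simp: right_mult_zero_mat[of _ _ c])
  have YB: "?Y * ?B = four_block_mat (X * B11 + V * B21) (X * B12 + V * B22) (Y * B21) (Y * B22)"
    using cs by (subst mult_four_block_mat[where ?nr1.0 = a and ?nr2.0 = c and ?n1.0 = a and ?n2.0 = c]) (auto simp: left_mult_zero_mat[of _ a])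
  have 3: "?B * ?Y - ?Y * ?B + ?J * ?Z = four_block_mat
      (B11 * X - (X * B11 + V * B21) + Z1) (B11 * V + B12 * Y - (X * B12 + V * B22) + Z2)
      (B21 * X - Y * B21) (B21 * V + B22 * Y - Y * B22)"
  proof -
    have cs': "B11 * X \<in> carrier_mat a a" "B11 * V + B12 * Y \<in> carrier_mat a c"
      "B21 * X \<in> carrier_mat c a" "B21 * V + B22 * Y \<in> carrier_mat c c"
      "X * B11 + V * B21 \<in> carrier_mat a a" "X * B12 + V * B22 \<in> carrier_mat a c"
      "Y * B21 \<in> carrier_mat c a" "Y * B22 \<in> carrier_mat c c"
      using cs by auto
    have cs'': "B11 * X - (X * B11 + V * B21) \<in> carrier_mat a a"
      "B11 * V + B12 * Y - (X * B12 + V * B22) \<in> carrier_mat a c"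
      "B21 * X - Y * B21 \<in> carrier_mat c a" "B21 * V + B22 * Y - Y * B22 \<in> carrier_mat c c"
      using cs'(5-8) by (auto intro: minus_carrier_mat)
    show ?thesis
      unfolding JZ BY YB minus_four_block_mat[OF cs']
        add_four_block_mat[OF cs'' Z zero_carrier_mat zero_carrier_mat]
        right_add_zero_mat[OF cs''(3)] right_add_zero_mat[OF cs''(4)] ..
  qed
  have 4: "e \<cdot>\<^sub>m ?B = four_block_mat (e \<cdot>\<^sub>m B11) (e \<cdot>\<^sub>m B12) (e \<cdot>\<^sub>m B21) (e \<cdot>\<^sub>m B22)"
    using cs by (intro smult_four_block_mat) auto
  have 5: "?B * ?Y - ?Y * ?B + ?J * ?Z = e \<cdot>\<^sub>m ?B \<longleftrightarrow>
      B11 * X - (X * B11 + V * B21) + Z1 = e \<cdot>\<^sub>m B11 \<and>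
      B11 * V + B12 * Y - (X * B12 + V * B22) + Z2 = e \<cdot>\<^sub>m B12 \<and>
      B21 * X - Y * B21 = e \<cdot>\<^sub>m B21 \<and> B21 * V + B22 * Y - Y * B22 = e \<cdot>\<^sub>m B22"
    unfolding 3 4 using cs by (intro four_block_mat_eq_iff[where ?n1.0 = a and ?m1.0 = a and ?n2.0 = c and ?m2.0 = c]) auto
  have 6: "B11 * V + B12 * Y - (X * B12 + V * B22) + Z2 = e \<cdot>\<^sub>m B12 \<longleftrightarrow>
      Z2 = e \<cdot>\<^sub>m B12 - (B11 * V + B12 * Y) + (X * B12 + V * B22)"
    using cs by (intro mat_solve_summand[of _ a c]) auto
  have 7: "B21 * V + B22 * Y - Y * B22 = e \<cdot>\<^sub>m B22 \<longleftrightarrow> B22 * Y - Y * B22 + B21 * V = e \<cdot>\<^sub>m B22"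
    using cs by (subst mat_add_minus_rotate[of _ c c]) auto
  have 8: "B11 * X - (X * B11 + V * B21) + Z1 = e \<cdot>\<^sub>m B11 \<longleftrightarrow>
      (A + B11) * X - X * (A + B11) - V * B21 = e \<cdot>\<^sub>m (A + B11)"
    if "Z1 = A * X - X * A - e \<cdot>\<^sub>m A"
  proof -
    have "(A + B11) * X = A * X + B11 * X" "X * (A + B11) = X * A + X * B11"
      "e \<cdot>\<^sub>m (A + B11) = e \<cdot>\<^sub>m A + e \<cdot>\<^sub>m B11"
      using cs by (auto simp: mult_add_distrib_mat[of _ a a] add_mult_distrib_mat[of _ a a] add_smult_distrib_left_mat)
    then show ?thesis unfolding that using cs
      by (simp only:) (intro mat_eliminate_summand[of _ a a], auto)
  qed
  show ?thesis
    unfolding structure_eqs_def 2 5 6 7 using 1 8 cs Xc Yc Zc by blast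
qed

text \<open>All solutions have the block form assumed in \<open>structure_eqs_embedding_blocks\<close>.\<close>

lemma structure_eqs_embedding_form:
  assumes eqs: "structure_eqs a (a + c) e A B (embedding_mat a c) X Y Z"
  obtains V Y' Z1 Z2 where "Y = four_block_mat (X - e \<cdot>\<^sub>m 1\<^sub>m a) V (0\<^sub>m c a) Y'"
    "Z = four_block_mat Z1 Z2 (0\<^sub>m 0 a) (0\<^sub>m 0 c)"
    "V \<in> carrier_mat a c" "Y' \<in> carrier_mat c c" "Z1 \<in> carrier_mat a a" "Z2 \<in> carrier_mat a c"
proof -
  let ?J = "embedding_mat a c"
  have X: "X \<in> carrier_mat a a" and Y: "Y \<in> carrier_mat (a + c) (a + c)"
    and Z: "Z \<in> carrier_mat (a + 0) (a + c)" and eq: "?J * X - Y * ?J = e \<cdot>\<^sub>m ?J"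
    using eqs by (auto simp: structure_eqs_def)
  obtain Y11 V Y21 Y' where Yb: "Y = four_block_mat Y11 V Y21 Y'"
    "Y11 \<in> carrier_mat a a" "V \<in> carrier_mat a c" "Y21 \<in> carrier_mat c a" "Y' \<in> carrier_mat c c"
    using four_block_mat_cases[OF Y] by blast
  obtain Z1 Z2 Z3 Z4 where Zb: "Z = four_block_mat Z1 Z2 Z3 Z4"
    "Z1 \<in> carrier_mat a a" "Z2 \<in> carrier_mat a c" "Z3 \<in> carrier_mat 0 a" "Z4 \<in> carrier_mat 0 c"
    using four_block_mat_cases[OF Z] by blast
  have entry: "(if i < a then X $$ (i, j) else 0) - Y $$ (i, j) = (if i = j then e else 0)"
    if "i < a + c" "j < a" for i j
  proof -
    have "(?J * X - Y * ?J) $$ (i, j) = (e \<cdot>\<^sub>m ?J) $$ (i, j)" by (simp only: eq)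
    then show ?thesis
      using embedding_mat_mult[OF X that] mult_embedding_mat[OF Y that] that X Y
      by (auto simp: embedding_mat_def)
  qed
  have "Y11 = X - e \<cdot>\<^sub>m 1\<^sub>m a"
  proof (rule eq_matI)
    fix i j assume "i < dim_row (X - e \<cdot>\<^sub>m 1\<^sub>m a)" "j < dim_col (X - e \<cdot>\<^sub>m 1\<^sub>m a)"
    then show "Y11 $$ (i, j) = (X - e \<cdot>\<^sub>m 1\<^sub>m a) $$ (i, j)"
      using entry[of i j] Yb X by (auto simp: algebra_simps split: if_splits)
  qed (use Yb X in auto)
  moreover have "Y21 = 0\<^sub>m c a"
  proof (rule eq_zero_matI)
    fix i j assume ij: "i < c" "j < a"
    then show "Y21 $$ (i, j) = 0"
      using entry[of "a + i" j] Yb X by auto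
  qed (use Yb X in auto)
  moreover have "Z3 = 0\<^sub>m 0 a" "Z4 = 0\<^sub>m 0 c" using Zb by (auto intro!: eq_matI)
  ultimately show ?thesis using Yb Zb that by blast
qed

lemma frobenius_data_embedding:
  assumes A: "A \<in> carrier_mat a a"
    and B: "B11 \<in> carrier_mat a a" "B12 \<in> carrier_mat a c" "B21 \<in> carrier_mat c a" "B22 \<in> carrier_mat c c"
  shows "frobenius_data a (a + c) A (four_block_mat B11 B12 B21 B22) (embedding_mat a c) \<longleftrightarrow>
    frobenius_data a c (A + B11) B22 B21" (is "?L \<longleftrightarrow> ?R")
proof
  assume L: ?L
  show ?R unfolding frobenius_data_def
  proof (intro conjI allI impI)
    fix X Y V assume eqs: "structure_eqs a c 0 (A + B11) B22 B21 X Y V"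
    then have cs: "X \<in> carrier_mat a a" "Y \<in> carrier_mat c c" "V \<in> carrier_mat a c"
      by (auto simp: structure_eqs_def)
    define Z1 where "Z1 = A * X - X * A - 0 \<cdot>\<^sub>m A"
    define Z2 where "Z2 = 0 \<cdot>\<^sub>m B12 - (B11 * V + B12 * Y) + (X * B12 + V * B22)"
    have Zc: "Z1 \<in> carrier_mat a a" "Z2 \<in> carrier_mat a c"
      using A B cs by (auto simp: Z1_def Z2_def)
    have "structure_eqs a (a + c) 0 A (four_block_mat B11 B12 B21 B22) (embedding_mat a c)
      (X + 0 \<cdot>\<^sub>m 1\<^sub>m a) (four_block_mat X V (0\<^sub>m c a) Y) (four_block_mat Z1 Z2 (0\<^sub>m 0 a) (0\<^sub>m 0 c))"
      using structure_eqs_embedding_blocks[OF A B cs(1,3,2) Zc] eqs Z1_def Z2_def by simp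
    then obtain d where d: "X + 0 \<cdot>\<^sub>m 1\<^sub>m a = d \<cdot>\<^sub>m 1\<^sub>m a"
      "four_block_mat X V (0\<^sub>m c a) Y = d \<cdot>\<^sub>m 1\<^sub>m (a + c)"
      using L unfolding frobenius_data_def by meson
    have "d \<cdot>\<^sub>m 1\<^sub>m (a + c) = four_block_mat (d \<cdot>\<^sub>m 1\<^sub>m a) (0\<^sub>m a c) (0\<^sub>m c a) (d \<cdot>\<^sub>m 1\<^sub>m c)"
      by (intro eq_matI) auto
    with d have "X = d \<cdot>\<^sub>m 1\<^sub>m a \<and> V = 0\<^sub>m a c \<and> 0\<^sub>m c a = (0\<^sub>m c a :: complex mat) \<and> Y = d \<cdot>\<^sub>m 1\<^sub>m c"
      using cs by (subst four_block_mat_eq_iff[symmetric]) auto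
    then show "\<exists>d. X = d \<cdot>\<^sub>m 1\<^sub>m a \<and> Y = d \<cdot>\<^sub>m 1\<^sub>m c \<and> V = 0\<^sub>m a c" by blast
  qed (use A B in auto)
next
  assume R: ?R
  show ?L unfolding frobenius_data_def
  proof (intro conjI allI impI)
    fix X Y Z
    assume eqs: "structure_eqs a (a + c) 0 A (four_block_mat B11 B12 B21 B22) (embedding_mat a c) X Y Z"
    obtain V Y' Z1 Z2 where f: "Y = four_block_mat (X - 0 \<cdot>\<^sub>m 1\<^sub>m a) V (0\<^sub>m c a) Y'"
      "Z = four_block_mat Z1 Z2 (0\<^sub>m 0 a) (0\<^sub>m 0 c)"
      "V \<in> carrier_mat a c" "Y' \<in> carrier_mat c c" "Z1 \<in> carrier_mat a a" "Z2 \<in> carrier_mat a c"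
      using structure_eqs_embedding_form[OF eqs] by blast
    have X: "X \<in> carrier_mat a a" using eqs by (auto simp: structure_eqs_def)
    have X0: "X - 0 \<cdot>\<^sub>m 1\<^sub>m a = X" "X + 0 \<cdot>\<^sub>m 1\<^sub>m a = X" using X by (auto intro!: eq_matI)
    have red: "structure_eqs a c 0 (A + B11) B22 B21 X Y' V"
      and Z1: "Z1 = A * X - X * A - 0 \<cdot>\<^sub>m A"
      and Z2: "Z2 = 0 \<cdot>\<^sub>m B12 - (B11 * V + B12 * Y') + (X * B12 + V * B22)"
      using structure_eqs_embedding_blocks[OF A B X f(3-6), of 0] eqs f(1,2) X0 by auto
    obtain d where d: "X = d \<cdot>\<^sub>m 1\<^sub>m a" "Y' = d \<cdot>\<^sub>m 1\<^sub>m c" "V = 0\<^sub>m a c"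
      using R red unfolding frobenius_data_def by blast
    have "Z1 = 0\<^sub>m a a" unfolding Z1 d using A
      by (simp add: mult_smult_distrib[of _ a a] mult_smult_assoc_mat[of _ a a]) (intro eq_matI, auto)
    moreover have "Z2 = 0\<^sub>m a c" unfolding Z2 d using B
      by (simp add: mult_smult_distrib[of _ a c] mult_smult_assoc_mat[of _ a a] left_mult_zero_mat[of _ c] right_mult_zero_mat[of _ a])
         (intro eq_matI, auto)
    ultimately have "Z = 0\<^sub>m a (a + c)" unfolding f(2) by (auto intro!: eq_matI)
    moreover have "Y = d \<cdot>\<^sub>m 1\<^sub>m (a + c)" unfolding f(1) X0 d by (auto intro!: eq_matI)
    ultimately show "\<exists>d. X = d \<cdot>\<^sub>m 1\<^sub>m a \<and> Y = d \<cdot>\<^sub>m 1\<^sub>m (a + c) \<and> Z = 0\<^sub>m a (a + c)"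
      using d(1) by blast
  qed (use A B in auto)
qed

lemma mult_conj_mat:
  assumes "g \<in> carrier_mat b b" "h \<in> carrier_mat b b" "h * g = 1\<^sub>m b"
    and "M \<in> carrier_mat r b" "N \<in> carrier_mat b c"
  shows "(M * h) * (g * N) = M * (N :: complex mat)"
proof -
  have "(M * h) * (g * N) = M * (h * (g * N))" using assms by (intro assoc_mult_mat) auto
  also have "h * (g * N) = (h * g) * N" using assms by (intro assoc_mult_mat[symmetric]) auto
  finally show ?thesis using assms by simp
qed

lemma structure_eqs_conj:
  assumes gh: "g \<in> carrier_mat b b" "h \<in> carrier_mat b b" "h * g = 1\<^sub>m b"
    and cs: "A \<in> carrier_mat a a" "B \<in> carrier_mat b b" "U \<in> carrier_mat b a"
    and eqs: "structure_eqs a b e A B U X Y Z"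
  shows "structure_eqs a b e A (g * B * h) (g * U) X (g * Y * h) (Z * h)"
proof -
  have xs: "X \<in> carrier_mat a a" "Y \<in> carrier_mat b b" "Z \<in> carrier_mat a b"
    and e1: "U * X - Y * U = e \<cdot>\<^sub>m U" and e2: "A * X - X * A - Z * U = e \<cdot>\<^sub>m A"
    and e3: "B * Y - Y * B + U * Z = e \<cdot>\<^sub>m B"
    using eqs by (auto simp: structure_eqs_def)
  have 1: "(g * Y * h) * (g * U) = g * (Y * U)"
    using mult_conj_mat[OF gh, of "g * Y" b U a] gh cs xs by (simp add: assoc_mult_mat[of _ b b _ b _ a])
  have 2: "(Z * h) * (g * U) = Z * U"
    using mult_conj_mat[OF gh, of Z a U a] gh cs xs by simp
  have conj: "(g * M * h) * (g * N * h) = g * (M * N) * h"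
    if "M \<in> carrier_mat b b" "N \<in> carrier_mat b b" for M N
  proof -
    have "(g * M * h) * (g * N * h) = (g * M * h) * (g * (N * h))"
      using gh that by (simp add: assoc_mult_mat[of _ b b _ b _ b])
    also have "\<dots> = (g * M) * (N * h)" using mult_conj_mat[OF gh, of "g * M" b "N * h" b] gh that by simp
    finally show ?thesis using gh that by (simp add: assoc_mult_mat[of _ b b _ b _ b])
  qed
  have 3: "(g * U) * (Z * h) = g * (U * Z) * h"
  proof -
    have "(g * U) * (Z * h) = (g * U * Z) * h" using gh cs xs by (intro assoc_mult_mat[symmetric]) auto
    also have "g * U * Z = g * (U * Z)" using gh cs xs by (intro assoc_mult_mat) auto
    finally show ?thesis .
  qed
  have "(g * U) * X - (g * Y * h) * (g * U) = g * (U * X - Y * U)"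
    unfolding 1 using gh cs xs by (simp add: mult_minus_distrib_mat[of _ b b _ a] assoc_mult_mat[of _ b b _ a _ a])
  also have "\<dots> = e \<cdot>\<^sub>m (g * U)" unfolding e1 using gh cs by (simp add: mult_smult_distrib[of _ b b])
  finally have "(g * U) * X - (g * Y * h) * (g * U) = e \<cdot>\<^sub>m (g * U)" .
  moreover have "g * B * h * (g * Y * h) - g * Y * h * (g * B * h) + g * U * (Z * h) = e \<cdot>\<^sub>m (g * B * h)"
  proof -
    have "e \<cdot>\<^sub>m (g * B * h) = g * (e \<cdot>\<^sub>m B) * h"
      using gh cs by (simp add: mult_smult_distrib[of _ b b] mult_smult_assoc_mat[of _ b b])
    also have "\<dots> = g * (B * Y - Y * B + U * Z) * h" by (simp only: e3)
    also have "\<dots> = g * (B * Y) * h - g * (Y * B) * h + g * (U * Z) * h"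
    proof -
      have p: "B * Y \<in> carrier_mat b b" "Y * B \<in> carrier_mat b b" "U * Z \<in> carrier_mat b b"
        using cs xs by auto
      have "g * (B * Y - Y * B + U * Z) = g * (B * Y) - g * (Y * B) + g * (U * Z)"
        by (simp only: mult_add_distrib_mat[OF gh(1) minus_carrier_mat[OF p(2)] p(3)]
            mult_minus_distrib_mat[OF gh(1) p(1,2)])
      moreover have q: "g * (B * Y) \<in> carrier_mat b b" "g * (Y * B) \<in> carrier_mat b b"
        "g * (U * Z) \<in> carrier_mat b b"
        using gh p by (auto intro: mult_carrier_mat)
      moreover have "(g * (B * Y) - g * (Y * B) + g * (U * Z)) * h =
          g * (B * Y) * h - g * (Y * B) * h + g * (U * Z) * h"
        by (simp only: add_mult_distrib_mat[OF minus_carrier_mat[OF q(2)] q(3) gh(2)]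
            minus_mult_distrib_mat[OF q(1,2) gh(2)])
      ultimately show ?thesis by simp
    qed
    finally show ?thesis using conj cs xs 3 by simp
  qed
  ultimately show ?thesis unfolding structure_eqs_def 2 using e2 gh xs by auto
qed

lemma frobenius_data_conj:
  assumes gh: "g \<in> carrier_mat b b" "h \<in> carrier_mat b b" "h * g = 1\<^sub>m b" "g * h = 1\<^sub>m b"
    and frob: "frobenius_data a b A B U"
  shows "frobenius_data a b A (g * B * h) (g * U)"
  unfolding frobenius_data_def
proof (intro conjI allI impI)
  have cs: "A \<in> carrier_mat a a" "B \<in> carrier_mat b b" "U \<in> carrier_mat b a"
    using frob by (auto simp: frobenius_data_def)
  then show "A \<in> carrier_mat a a" "g * B * h \<in> carrier_mat b b" "g * U \<in> carrier_mat b a"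
    using gh by auto
  have cancel_left: "h * (g * M) = M" if "M \<in> carrier_mat b n" for M :: "complex mat" and n
    using gh that assoc_mult_mat[of h b b g b M n] by simp
  have cancel_right: "M * h * g = M" if "M \<in> carrier_mat n b" for M :: "complex mat" and n
    using gh that assoc_mult_mat[of M n b h b g b] by simp
  have cancel_inner_left: "g * (h * M) = M" if "M \<in> carrier_mat b n" for M :: "complex mat" and n
    using gh that assoc_mult_mat[of g b b h b M n] by simp
  have cancel_inner_right: "M * g * h = M" if "M \<in> carrier_mat n b" for M :: "complex mat" and n
    using gh that assoc_mult_mat[of M n b g b h b] by simp
  fix X Y Z assume eqs: "structure_eqs a b 0 A (g * B * h) (g * U) X Y Z"
  then have xs: "X \<in> carrier_mat a a" "Y \<in> carrier_mat b b" "Z \<in> carrier_mat a b"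
    by (auto simp: structure_eqs_def)
  have "structure_eqs a b 0 A (h * (g * B * h) * g) (h * (g * U)) X (h * Y * g) (Z * g)"
    using gh cs by (intro structure_eqs_conj[OF _ _ _ _ _ _ eqs]) auto
  moreover have "h * (g * B * h) * g = B"
  proof -
    have "h * (g * B * h) = h * (g * (B * h))" using gh cs by (simp add: assoc_mult_mat[of _ b b _ b _ b])
    then show ?thesis using cancel_left[of "B * h" b] cancel_right[of B b] gh cs by simp
  qed
  ultimately have "structure_eqs a b 0 A B U X (h * Y * g) (Z * g)" using cancel_left[of U a] cs by simp
  then obtain d where d: "X = d \<cdot>\<^sub>m 1\<^sub>m a" "h * Y * g = d \<cdot>\<^sub>m 1\<^sub>m b" "Z * g = 0\<^sub>m a b"
    using frob unfolding frobenius_data_def by blast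
  have "Y = g * (h * Y * g) * h"
  proof -
    have "g * (h * Y * g) = g * (h * (Y * g))" using gh xs by (simp add: assoc_mult_mat[of _ b b _ b _ b])
    then show ?thesis using cancel_inner_left[of "Y * g" b] cancel_inner_right[of Y b] gh xs by simp
  qed
  then have "Y = d \<cdot>\<^sub>m 1\<^sub>m b"
    unfolding d using gh
    by (simp only: mult_smult_distrib[OF gh(1) one_carrier_mat] right_mult_one_mat[OF gh(1)]
        mult_smult_assoc_mat[OF gh(1,2)])
  moreover have "Z = Z * g * h" using cancel_inner_right[of Z a] xs by simp
  then have "Z = 0\<^sub>m a b" unfolding d using gh by simp
  ultimately show "\<exists>d. X = d \<cdot>\<^sub>m 1\<^sub>m a \<and> Y = d \<cdot>\<^sub>m 1\<^sub>m b \<and> Z = 0\<^sub>m a b" using d by blast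
qed

section \<open>Normal form of the off-diagonal block and duality\<close>

text \<open>A matrix with at least as many rows as columns and a nontrivial kernel has a nontrivial left kernel: it becomes a singular
  square matrix after appending zero columns.\<close>

lemma exists_left_kernel_vec:
  fixes U :: "complex mat"
  assumes U: "U \<in> carrier_mat b a" and ab: "a \<le> b"
    and v: "v \<in> carrier_vec a" "v \<noteq> 0\<^sub>v a" "U *\<^sub>v v = 0\<^sub>v b"
  obtains w where "w \<in> carrier_vec b" "w \<noteq> 0\<^sub>v b" "transpose_mat U *\<^sub>v w = 0\<^sub>v a"
proof -
  define S where "S = mat b b (\<lambda>(i, j). if j < a then U $$ (i, j) else 0)"
  define v' where "v' = vec b (\<lambda>i. if i < a then v $ i else 0)"
  have S: "S \<in> carrier_mat b b" and v': "v' \<in> carrier_vec b" by (simp_all add: S_def v'_def)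
  have "S *\<^sub>v v' = 0\<^sub>v b"
  proof (rule eq_vecI)
    fix i assume i: "i < dim_vec (0\<^sub>v b :: complex vec)"
    then have i: "i < b" by simp
    have "(S *\<^sub>v v') $ i = (\<Sum>j = 0..<b. (if j < a then U $$ (i, j) * v $ j else 0))"
      using i by (auto simp: S_def v'_def scalar_prod_def intro!: sum.cong)
    also have "\<dots> = (\<Sum>j \<in> {0..<b} \<inter> {j. j < a}. U $$ (i, j) * v $ j)"
      by (subst sum.inter_restrict) auto
    also have "{0..<b} \<inter> {j. j < a} = {0..<a}" using ab by auto
    also have "(\<Sum>j = 0..<a. U $$ (i, j) * v $ j) = (U *\<^sub>v v) $ i"
      using i U v(1) by (simp add: scalar_prod_def)
    finally show "(S *\<^sub>v v') $ i = 0\<^sub>v b $ i" using i v(3) by simp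
  qed (simp add: S_def)
  moreover have "v' \<noteq> 0\<^sub>v b"
  proof
    assume eq: "v' = 0\<^sub>v b"
    have "v = 0\<^sub>v a"
    proof (rule eq_vecI)
      fix i assume "i < dim_vec (0\<^sub>v a :: complex vec)"
      then show "v $ i = 0\<^sub>v a $ i" using ab arg_cong[OF eq, of "\<lambda>x. x $ i"] by (simp add: v'_def)
    qed (use v(1) in simp)
    then show False using v(2) by simp
  qed
  ultimately have "det S = 0" using det_0_iff_vec_prod_zero_field[OF S] v' by blast
  then have "det (transpose_mat S) = 0" using det_transpose[OF S] by simp
  then obtain w where w: "w \<in> carrier_vec b" "w \<noteq> 0\<^sub>v b" "transpose_mat S *\<^sub>v w = 0\<^sub>v b"
    using det_0_iff_vec_prod_zero_field[of "transpose_mat S" b] S by auto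
  have "transpose_mat U *\<^sub>v w = 0\<^sub>v a"
  proof (rule eq_vecI)
    fix j assume "j < dim_vec (0\<^sub>v a :: complex vec)"
    then have j: "j < a" by simp
    have "(transpose_mat U *\<^sub>v w) $ j = (transpose_mat S *\<^sub>v w) $ j"
      using j ab U w(1) by (simp add: S_def scalar_prod_def)
    then show "(transpose_mat U *\<^sub>v w) $ j = 0\<^sub>v a $ j" using w(3) j ab by simp
  qed (use U in simp)
  with w that show ?thesis by blast
qed

text \<open>Otherwise there are a vector \<open>v\<close> in the kernel and a vector \<open>w\<close> in the left kernel of \<open>U\<close>, and the
  rank one matrix \<open>Z = v w\<^sup>T\<close> with \<open>X = Y = 0\<close> is a nonscalar solution of the homogeneous equations.\<close>

lemma frobenius_data_injective:
  assumes frob: "frobenius_data a b A B U" and ab: "a \<le> b"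
    and v: "v \<in> carrier_vec a" "U *\<^sub>v v = 0\<^sub>v b"
  shows "v = 0\<^sub>v a"
proof (rule ccontr)
  assume v0: "v \<noteq> 0\<^sub>v a"
  have cs: "A \<in> carrier_mat a a" "B \<in> carrier_mat b b" "U \<in> carrier_mat b a"
    using frob by (auto simp: frobenius_data_def)
  obtain w where w: "w \<in> carrier_vec b" "w \<noteq> 0\<^sub>v b" "transpose_mat U *\<^sub>v w = 0\<^sub>v a"
    using exists_left_kernel_vec[OF cs(3) ab v(1) v0 v(2)] by blast
  define Z where "Z = mat a b (\<lambda>(i, j). v $ i * w $ j)"
  have Z: "Z \<in> carrier_mat a b" by (simp add: Z_def)
  have "U * Z = 0\<^sub>m b b"
  proof (rule eq_zero_matI)
    fix i j assume ij: "i < b" "j < b"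
    have "(U * Z) $$ (i, j) = (U *\<^sub>v v) $ i * w $ j"
      using ij cs v(1) by (simp add: Z_def scalar_prod_def sum_distrib_right mult.assoc)
    then show "(U * Z) $$ (i, j) = 0" using v(2) ij by simp
  qed (use cs in \<open>auto simp: Z_def\<close>)
  moreover have "Z * U = 0\<^sub>m a a"
  proof (rule eq_zero_matI)
    fix i j assume ij: "i < a" "j < a"
    have "(Z * U) $$ (i, j) = v $ i * (transpose_mat U *\<^sub>v w) $ j"
      using ij cs w(1) by (simp add: Z_def scalar_prod_def sum_distrib_left mult_ac)
    then show "(Z * U) $$ (i, j) = 0" using w(3) ij by simp
  qed (use cs in \<open>auto simp: Z_def\<close>)
  ultimately have "structure_eqs a b 0 A B U (0\<^sub>m a a) (0\<^sub>m b b) Z"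
    unfolding structure_eqs_def using cs Z by (auto intro!: eq_matI)
  then have "Z = 0\<^sub>m a b" using frob unfolding frobenius_data_def by blast
  moreover obtain i where "i < a" "v $ i \<noteq> 0" using v0 v(1) by (metis carrier_vecD eq_vecI index_zero_vec)
  moreover obtain j where "j < b" "w $ j \<noteq> 0" using w(1,2) by (metis carrier_vecD eq_vecI index_zero_vec)
  ultimately have "v $ i * w $ j = 0" by (metis Z_def index_mat(1) index_zero_mat(1) split_conv)
  then show False using \<open>v $ i \<noteq> 0\<close> \<open>w $ j \<noteq> 0\<close> by simp
qed

lemma injective_mat_normal_form:
  fixes U :: "complex mat"
  assumes U: "U \<in> carrier_mat (a + c) a"
    and inj: "\<And>v. v \<in> carrier_vec a \<Longrightarrow> U *\<^sub>v v = 0\<^sub>v (a + c) \<Longrightarrow> v = 0\<^sub>v a"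
  obtains g h where "g \<in> carrier_mat (a + c) (a + c)" "h \<in> carrier_mat (a + c) (a + c)"
    "h * g = 1\<^sub>m (a + c)" "g * h = 1\<^sub>m (a + c)" "g * U = embedding_mat a c"
proof -
  define C where "C = gauss_jordan_single U"
  note gj = gauss_jordan_single[OF U C_def[symmetric]]
  obtain g h where gh: "C = g * U" "g \<in> carrier_mat (a + c) (a + c)" "h \<in> carrier_mat (a + c) (a + c)"
    "g * h = 1\<^sub>m (a + c)" "h * g = 1\<^sub>m (a + c)"
    using gj(4) by blast
  have C: "C \<in> carrier_mat (a + c) a" by (rule gj(2))
  obtain f where f: "pivot_fun C f a" using gj(3) C unfolding row_echelon_form_def by auto
  have dim: "dim_row C = a + c" using C by auto
  note pf = pivot_funD[OF dim f]
  have piv: "snd ` set (pivot_positions C) = {0..<a}"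
  proof (rule ccontr)
    assume "\<not> ?thesis"
    note fb = find_base_vector[OF gj(3) C this]
    then show False using inj gj(1) by blast
  qed
  \<comment> \<open>The pivot function is strictly increasing and hits every column, so it is the identity there.\<close>
  have lower: "f i = a \<or> i \<le> f i" if "i < a + c" for i
    using pivot_bound[OF dim f, of 0 i] that by auto
  have fi: "f k = k" if "k < a" for k
    using that
  proof (induction k rule: less_induct)
    case (less k)
    have "k \<in> snd ` set (pivot_positions C)" using piv less.prems by auto
    then obtain i where i: "i < a + c" "f i = k" using pivot_positions(1)[OF C f] by auto
    then have "i \<le> k" using lower[of i] less.prems by auto
    moreover have "\<not> i < k" using less.IH[of i] i less.prems by auto
    ultimately show ?case using i by simp
  qed
  have "C = embedding_mat a c"
  proof (rule eq_matI)
    fix i j assume "i < dim_row (embedding_mat a c)" "j < dim_col (embedding_mat a c)"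
    then have ij: "i < a + c" "j < a" by auto
    then show "C $$ (i, j) = embedding_mat a c $$ (i, j)"
      using pf(4)[of j] pf(5)[of j i] fi[of j] by (auto simp: embedding_mat_def)
  qed (use C in auto)
  with gh that show ?thesis by blast
qed

text \<open>Transposition with a sign exchanges the roles of the two blocks.\<close>

lemma structure_eqs_dual:
  assumes cs: "A \<in> carrier_mat a a" "B \<in> carrier_mat b b" "U \<in> carrier_mat b a"
    and eqs: "structure_eqs a b e A B U X Y Z"
  shows "structure_eqs b a e (transpose_mat B) (transpose_mat A) (transpose_mat U)
    (- transpose_mat Y) (- transpose_mat X) (- transpose_mat Z)"
proof -
  have xs: "X \<in> carrier_mat a a" "Y \<in> carrier_mat b b" "Z \<in> carrier_mat a b"
    and e1: "U * X - Y * U = e \<cdot>\<^sub>m U" and e2: "A * X - X * A - Z * U = e \<cdot>\<^sub>m A"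
    and e3: "B * Y - Y * B + U * Z = e \<cdot>\<^sub>m B"
    using eqs by (auto simp: structure_eqs_def)
  have tm: "transpose_mat M * - transpose_mat N = - transpose_mat (N * M)"
    "- transpose_mat M * transpose_mat N = - transpose_mat (N * M)"
    if "M \<in> carrier_mat n m" "N \<in> carrier_mat k n" for M N :: "complex mat" and n m k
    using that by (simp_all add: transpose_mult[of N k n M m])
  have UX: "U * X \<in> carrier_mat b a" "Y * U \<in> carrier_mat b a"
    and BY: "B * Y \<in> carrier_mat b b" "Y * B \<in> carrier_mat b b" "U * Z \<in> carrier_mat b b"
    and AX: "A * X \<in> carrier_mat a a" "X * A \<in> carrier_mat a a" "Z * U \<in> carrier_mat a a"
    using cs xs by auto
  have 1: "- transpose_mat Q - - transpose_mat P = transpose_mat (P - Q)"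
    if "P \<in> carrier_mat n m" "Q \<in> carrier_mat n m" for P Q :: "complex mat" and n m
    using that by (intro eq_matI) auto
  have 2: "- transpose_mat Q - - transpose_mat P - - transpose_mat R = transpose_mat (P - Q + R)"
    if "P \<in> carrier_mat n m" "Q \<in> carrier_mat n m" "R \<in> carrier_mat n m" for P Q R :: "complex mat" and n m
    using that by (intro eq_matI) auto
  have 3: "- transpose_mat Q - - transpose_mat P + - transpose_mat R = transpose_mat (P - Q - R)"
    if "P \<in> carrier_mat n m" "Q \<in> carrier_mat n m" "R \<in> carrier_mat n m" for P Q R :: "complex mat" and n m
    using that by (intro eq_matI) auto
  have 4: "transpose_mat (e \<cdot>\<^sub>m M) = e \<cdot>\<^sub>m transpose_mat M" for M :: "complex mat"
    by (intro eq_matI) auto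
  show ?thesis
    unfolding structure_eqs_def tm(1)[OF cs(3) xs(2)] tm(2)[OF xs(1) cs(3)]
      tm(1)[OF cs(2) xs(2)] tm(2)[OF xs(2) cs(2)] tm(2)[OF xs(3) cs(3)]
      tm(1)[OF cs(1) xs(1)] tm(2)[OF xs(1) cs(1)] tm(1)[OF cs(3) xs(3)]
      1[OF UX] 2[OF BY] 3[OF AX] e1 e2 e3 4
    using xs by auto
qed

lemma frobenius_data_dual:
  assumes frob: "frobenius_data a b A B U"
  shows "frobenius_data b a (transpose_mat B) (transpose_mat A) (transpose_mat U)"
  unfolding frobenius_data_def
proof (intro conjI allI impI)
  have cs: "A \<in> carrier_mat a a" "B \<in> carrier_mat b b" "U \<in> carrier_mat b a"
    using frob by (auto simp: frobenius_data_def)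
  then show tcs: "transpose_mat B \<in> carrier_mat b b" "transpose_mat A \<in> carrier_mat a a"
    "transpose_mat U \<in> carrier_mat a b" by auto
  fix X Y Z
  assume eqs: "structure_eqs b a 0 (transpose_mat B) (transpose_mat A) (transpose_mat U) X Y Z"
  have xs: "X \<in> carrier_mat b b" "Y \<in> carrier_mat a a" "Z \<in> carrier_mat b a"
    using eqs by (auto simp: structure_eqs_def)
  obtain d where d: "- transpose_mat Y = d \<cdot>\<^sub>m 1\<^sub>m a" "- transpose_mat X = d \<cdot>\<^sub>m 1\<^sub>m b"
    "- transpose_mat Z = 0\<^sub>m a b"
  proof -
    have "structure_eqs a b 0 A B U (- transpose_mat Y) (- transpose_mat X) (- transpose_mat Z)"
      using structure_eqs_dual[OF tcs eqs] by simp
    then show ?thesis using frob that unfolding frobenius_data_def by meson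
  qed
  have inv: "M = - transpose_mat (- transpose_mat M)" for M :: "complex mat"
    by (intro eq_matI) auto
  have "- transpose_mat (d \<cdot>\<^sub>m 1\<^sub>m n) = (- d) \<cdot>\<^sub>m 1\<^sub>m n" for n
    by (intro eq_matI) auto
  moreover have "- transpose_mat (0\<^sub>m a b) = (0\<^sub>m b a :: complex mat)"
    by (intro eq_matI) auto
  ultimately show "\<exists>d. X = d \<cdot>\<^sub>m 1\<^sub>m b \<and> Y = d \<cdot>\<^sub>m 1\<^sub>m a \<and> Z = 0\<^sub>m b a"
    using inv[of X] inv[of Y] inv[of Z] unfolding d by (intro exI[of _ "- d"]) auto
qed

section \<open>Eigenvalues of principal elements\<close>

text \<open>\<open>es\<close> lists the eigenvalues of \<open>M\<close> with algebraic multiplicities.\<close>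

definition has_roots :: "complex mat \<Rightarrow> complex list \<Rightarrow> bool" where
  "has_roots M es \<longleftrightarrow> char_poly M = (\<Prod>e\<leftarrow>es. [:- e, 1:])"

lemma has_roots_affine:
  assumes M: "M \<in> carrier_mat n n" and roots: "has_roots M es"
  shows "has_roots (s \<cdot>\<^sub>m M + t \<cdot>\<^sub>m 1\<^sub>m n) (map (\<lambda>e. s * e + t) es)"
proof -
  obtain T P Q where "schur_decomposition M es = (T, P, Q)" by (cases "schur_decomposition M es")
  with schur_decomposition[OF M _ this] roots
  have wit: "similar_mat_wit M T P Q" and tri: "upper_triangular T" and diag: "diag_mat T = es"
    by (auto simp: has_roots_def)
  note w = similar_mat_witD2[OF M wit]
  have "similar_mat_wit (s \<cdot>\<^sub>m M + t \<cdot>\<^sub>m 1\<^sub>m n) (s \<cdot>\<^sub>m T + t \<cdot>\<^sub>m 1\<^sub>m n) P Q"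
  proof (rule similar_mat_witI[of _ _ n])
    have "P * (s \<cdot>\<^sub>m T + t \<cdot>\<^sub>m 1\<^sub>m n) = s \<cdot>\<^sub>m (P * T) + t \<cdot>\<^sub>m P"
      using w by (simp add: mult_add_distrib_mat[of P n n _ n] mult_smult_distrib[of P n n _ n])
    also have "\<dots> * Q = s \<cdot>\<^sub>m (P * T * Q) + t \<cdot>\<^sub>m (P * Q)"
      using w by (simp add: add_mult_distrib_mat[of _ n n _ Q n] mult_smult_assoc_mat[of _ n n])
    finally show "s \<cdot>\<^sub>m M + t \<cdot>\<^sub>m 1\<^sub>m n = P * (s \<cdot>\<^sub>m T + t \<cdot>\<^sub>m 1\<^sub>m n) * Q"
      using w by simp
  qed (use w in auto)
  then have "char_poly (s \<cdot>\<^sub>m M + t \<cdot>\<^sub>m 1\<^sub>m n) = char_poly (s \<cdot>\<^sub>m T + t \<cdot>\<^sub>m 1\<^sub>m n)"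
    by (intro char_poly_similar) (auto simp: similar_mat_def)
  also have "\<dots> = (\<Prod>e\<leftarrow>diag_mat (s \<cdot>\<^sub>m T + t \<cdot>\<^sub>m 1\<^sub>m n). [:- e, 1:])"
  proof (rule char_poly_upper_triangular[of _ n])
    show "upper_triangular (s \<cdot>\<^sub>m T + t \<cdot>\<^sub>m 1\<^sub>m n)"
      using w upper_triangularD[OF tri] by (intro upper_triangularI) auto
  qed (use w in auto)
  also have "diag_mat (s \<cdot>\<^sub>m T + t \<cdot>\<^sub>m 1\<^sub>m n) = map (\<lambda>e. s * e + t) es"
    unfolding diag[symmetric] using w by (auto simp: diag_mat_def)
  finally show ?thesis unfolding has_roots_def .
qed

lemma has_roots_neg_transpose:
  assumes M: "M \<in> carrier_mat n n" and roots: "has_roots M es"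
  shows "has_roots (- transpose_mat M) (map uminus es)"
proof -
  have "has_roots (transpose_mat M) es" using roots M by (simp add: has_roots_def)
  from has_roots_affine[OF _ this, of n "- 1" 0] M
  have "has_roots ((- 1) \<cdot>\<^sub>m transpose_mat M + 0 \<cdot>\<^sub>m 1\<^sub>m n) (map (\<lambda>e. - e) es)" by simp
  moreover have "(- 1) \<cdot>\<^sub>m transpose_mat M + 0 \<cdot>\<^sub>m 1\<^sub>m n = - transpose_mat M"
    using M by (intro eq_matI) auto
  ultimately show ?thesis by simp
qed

lemma has_roots_four_block:
  assumes "X \<in> carrier_mat n n" "V \<in> carrier_mat n m" "Y \<in> carrier_mat m m"
    and "has_roots X xs" "has_roots Y ys"
  shows "has_roots (four_block_mat X V (0\<^sub>m m n) Y) (xs @ ys)"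
  using char_poly_0_block[OF refl _ _ assms(1-3)] assms(4,5) by (auto simp: has_roots_def)

lemma has_roots_similar:
  assumes gh: "g \<in> carrier_mat b b" "h \<in> carrier_mat b b" "h * g = 1\<^sub>m b" "g * h = 1\<^sub>m b"
    and Y: "Y \<in> carrier_mat b b"
  shows "has_roots (g * Y * h) es \<longleftrightarrow> has_roots Y es"
proof -
  have "similar_mat_wit (g * Y * h) Y g h"
    using assms by (intro similar_mat_witI[of _ _ b]) auto
  then have "char_poly (g * Y * h) = char_poly Y"
    by (intro char_poly_similar) (auto simp: similar_mat_def)
  then show ?thesis by (simp add: has_roots_def)
qed

lemma has_roots_exists:
  assumes "M \<in> carrier_mat n n"
  shows "\<exists>es. has_roots M es"
  using char_poly_factorized[OF assms] by (auto simp: has_roots_def)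

lemma has_roots_mset:
  assumes "mset es = mset fs"
  shows "has_roots M es \<longleftrightarrow> has_roots M fs"
proof -
  have "(\<Prod>e\<leftarrow>es. [:- e, 1:]) = (\<Prod>e\<leftarrow>fs. [:- e, 1:])"
    using assms by (metis mset_map prod_mset_prod_list)
  then show ?thesis by (simp add: has_roots_def)
qed

lemma has_roots_cong:
  assumes "has_roots M es" "es = fs"
  shows "has_roots M fs"
  using assms by simp

text \<open>The Euclidean step for principal elements, with its effect on the eigenvalues.\<close>

lemma principal_reduction:
  assumes frob: "frobenius_data a (a + c) A B U" and eqs: "structure_eqs a (a + c) 1 A B U X Y Z"
  obtains A' B' U' X' Y' V where "frobenius_data a c A' B' U'" "structure_eqs a c 1 A' B' U' X' Y' V"
    "\<And>xs ys. has_roots X' xs \<Longrightarrow> has_roots Y' ys \<Longrightarrow>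
       has_roots X (map (\<lambda>x. x + 1) xs) \<and> has_roots Y (xs @ ys)"
proof -
  have cs: "A \<in> carrier_mat a a" "B \<in> carrier_mat (a + c) (a + c)" "U \<in> carrier_mat (a + c) a"
    using frob by (auto simp: frobenius_data_def)
  have xs: "X \<in> carrier_mat a a" "Y \<in> carrier_mat (a + c) (a + c)" "Z \<in> carrier_mat a (a + c)"
    using eqs by (auto simp: structure_eqs_def)
  obtain g h where gh: "g \<in> carrier_mat (a + c) (a + c)" "h \<in> carrier_mat (a + c) (a + c)"
    "h * g = 1\<^sub>m (a + c)" "g * h = 1\<^sub>m (a + c)" "g * U = embedding_mat a c"
    using injective_mat_normal_form[OF cs(3)] frobenius_data_injective[OF frob] by auto
  have "g * B * h \<in> carrier_mat (a + c) (a + c)" using gh cs by simp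
  then obtain B11 B12 B21 B22 where B: "g * B * h = four_block_mat B11 B12 B21 B22"
    "B11 \<in> carrier_mat a a" "B12 \<in> carrier_mat a c" "B21 \<in> carrier_mat c a" "B22 \<in> carrier_mat c c"
    using four_block_mat_cases by blast
  have frob': "frobenius_data a c (A + B11) B22 B21"
    using frobenius_data_conj[OF gh(1-4) frob] frobenius_data_embedding[OF cs(1) B(2-5)]
    by (simp only: B(1) gh(5))
  have eqs': "structure_eqs a (a + c) 1 A (g * B * h) (embedding_mat a c) X (g * Y * h) (Z * h)"
    using structure_eqs_conj[OF gh(1-3) cs eqs] by (simp only: gh(5))
  obtain V Y' Z1 Z2 where f: "g * Y * h = four_block_mat (X - 1 \<cdot>\<^sub>m 1\<^sub>m a) V (0\<^sub>m c a) Y'"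
    "Z * h = four_block_mat Z1 Z2 (0\<^sub>m 0 a) (0\<^sub>m 0 c)"
    "V \<in> carrier_mat a c" "Y' \<in> carrier_mat c c" "Z1 \<in> carrier_mat a a" "Z2 \<in> carrier_mat a c"
    using structure_eqs_embedding_form[OF eqs'] by blast
  define X' where "X' = X - 1 \<cdot>\<^sub>m 1\<^sub>m a"
  have X': "X' \<in> carrier_mat a a" and XX': "X = X' + 1 \<cdot>\<^sub>m 1\<^sub>m a"
    using xs(1) by (auto simp: X'_def intro!: eq_matI)
  have "structure_eqs a c 1 (A + B11) B22 B21 X' Y' V"
    using eqs' structure_eqs_embedding_blocks[OF cs(1) B(2-5) X' f(3-6), of 1]
    unfolding f(1,2) B(1) X'_def[symmetric] XX'[symmetric] by blast
  moreover have "has_roots X (map (\<lambda>x. x + 1) ps) \<and> has_roots Y (ps @ qs)"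
    if roots: "has_roots X' ps" "has_roots Y' qs" for ps qs
  proof
    have "1 \<cdot>\<^sub>m X' + 1 \<cdot>\<^sub>m 1\<^sub>m a = X" unfolding XX' using X' by (intro eq_matI) auto
    then show "has_roots X (map (\<lambda>x. x + 1) ps)"
      using has_roots_affine[OF X' roots(1), of 1 1] by simp
    show "has_roots Y (ps @ qs)"
      using has_roots_four_block[OF X' f(3,4) roots] has_roots_similar[OF gh(1-4) xs(2)]
      by (simp only: f(1) X'_def)
  qed
  ultimately show ?thesis using frob' that by blast
qed

lemma has_roots_neg_transposeD:
  assumes "M \<in> carrier_mat n n" and "has_roots (- transpose_mat M) es"
  shows "has_roots M (map uminus es)"
proof -
  have "- transpose_mat (- transpose_mat M) = M" by (intro eq_matI) auto
  then show ?thesis using has_roots_neg_transpose[of "- transpose_mat M" n es] assms by simp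
qed

lemma coprime_euclid_step:
  assumes "coprime a b" "a \<le> (b::nat)"
  shows "coprime a (b - a)"
  using assms by (auto simp: le_iff_add coprime_iff_gcd_eq_1)

text \<open>The eigenvalues of a principal element do not depend on the functional, apart from a common shift
  that disappears in their differences.\<close>

theorem principal_element_roots:
  assumes "frobenius_data a b A B U" "structure_eqs a b 1 A B U X Y Z" "0 < a" "coprime a b"
  shows "\<exists>c. has_roots X (map (\<lambda>k. c + of_int k) (fst (exponents a b))) \<and>
             has_roots Y (map (\<lambda>k. c + of_int k) (snd (exponents a b)))"
  using assms
proof (induction a b arbitrary: A B U X Y Z rule: exponents.induct)
  case (1 a b)
  have xs: "X \<in> carrier_mat a a" "Y \<in> carrier_mat b b" "Z \<in> carrier_mat a b"
    using 1 by (auto simp: structure_eqs_def)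
  consider "b = 0" | "b \<noteq> 0" "a \<le> b" | "b \<noteq> 0" "\<not> a \<le> b" by blast
  then show ?case
  proof cases
    case 1
    with \<open>coprime a b\<close> have a: "a = 1" by simp
    have "upper_triangular X" "upper_triangular Y" using xs 1 a by auto
    then have "has_roots X [X $$ (0, 0)]" "has_roots Y []"
      using char_poly_upper_triangular[OF xs(1)] char_poly_upper_triangular[OF xs(2)] xs 1 a
      by (auto simp: has_roots_def diag_mat_def)
    then show ?thesis using 1 by (intro exI[of _ "X $$ (0, 0)"]) (simp add: exponents.simps)
  next
    case 2
    obtain P Q where PQ: "exponents a (b - a) = (P, Q)" by fastforce
    have d: "exponents a b = (map (\<lambda>x. x + 1) P, P @ Q)"
      using 2 \<open>0 < a\<close> by (simp add: exponents.simps[of a b] PQ)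
    have b: "b = a + (b - a)" using 2 by simp
    obtain A' B' U' X' Y' V where r: "frobenius_data a (b - a) A' B' U'"
      "structure_eqs a (b - a) 1 A' B' U' X' Y' V"
      "\<And>xs ys. has_roots X' xs \<Longrightarrow> has_roots Y' ys \<Longrightarrow>
         has_roots X (map (\<lambda>x. x + 1) xs) \<and> has_roots Y (xs @ ys)"
      using principal_reduction[of a "b - a" A B U X Y Z] 1 b by metis
    obtain c where c: "has_roots X' (map (\<lambda>k. c + of_int k) P)" "has_roots Y' (map (\<lambda>k. c + of_int k) Q)"
      using "1.IH"(1)[OF _ _ r(1,2) \<open>0 < a\<close>] coprime_euclid_step[OF \<open>coprime a b\<close>] 2 \<open>0 < a\<close> PQ by auto
    show ?thesis
      using r(3)[OF c] unfolding d by (intro exI[of _ c]) (simp add: o_def add.assoc)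
  next
    case 3
    obtain P Q where PQ: "exponents (a - b) b = (P, Q)" by fastforce
    have d: "exponents a b = (P @ Q, map (\<lambda>x. x - 1) Q)"
      using 3 \<open>0 < a\<close> by (simp add: exponents.simps[of a b] PQ)
    have cs: "A \<in> carrier_mat a a" "B \<in> carrier_mat b b" "U \<in> carrier_mat b a"
      using 1 by (auto simp: frobenius_data_def)
    have "a = b + (a - b)" using 3 by simp
    then obtain A' B' U' X' Y' V where r: "frobenius_data b (a - b) A' B' U'"
      "structure_eqs b (a - b) 1 A' B' U' X' Y' V"
      "\<And>xs ys. has_roots X' xs \<Longrightarrow> has_roots Y' ys \<Longrightarrow>
         has_roots (- transpose_mat Y) (map (\<lambda>x. x + 1) xs) \<and> has_roots (- transpose_mat X) (xs @ ys)"
      using principal_reduction[of b "a - b"] frobenius_data_dual[OF "1.prems"(1)]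
        structure_eqs_dual[OF cs "1.prems"(2)] by metis
    have cs': "A' \<in> carrier_mat b b" "B' \<in> carrier_mat (a - b) (a - b)" "U' \<in> carrier_mat (a - b) b"
      using r(1) by (auto simp: frobenius_data_def)
    have xs': "X' \<in> carrier_mat b b" "Y' \<in> carrier_mat (a - b) (a - b)"
      using r(2) by (auto simp: structure_eqs_def)
    have "coprime (a - b) b" using coprime_euclid_step[of b a] \<open>coprime a b\<close> 3
      by (simp add: coprime_commute)
    then obtain c where c: "has_roots (- transpose_mat Y') (map (\<lambda>k. c + of_int k) P)"
      "has_roots (- transpose_mat X') (map (\<lambda>k. c + of_int k) Q)"
      using "1.IH"(2)[OF _ _ frobenius_data_dual[OF r(1)] structure_eqs_dual[OF cs' r(2)]] 3 \<open>0 < a\<close> PQ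
      by auto
    have roots: "has_roots (- transpose_mat Y) (map (\<lambda>x. x + 1) (map uminus (map (\<lambda>k. c + of_int k) Q)))"
      "has_roots (- transpose_mat X) (map uminus (map (\<lambda>k. c + of_int k) Q) @ map uminus (map (\<lambda>k. c + of_int k) P))"
      using r(3)[OF has_roots_neg_transposeD[OF xs'(1) c(2)] has_roots_neg_transposeD[OF xs'(2) c(1)]] by auto
    have "has_roots Y (map (\<lambda>k. c + of_int k) (map (\<lambda>x. x - 1) Q))"
      using has_roots_neg_transposeD[OF xs(2) roots(1)] by (rule has_roots_cong) simp
    moreover have "has_roots X (map (\<lambda>k. c + of_int k) (P @ Q))"
      using has_roots_neg_transposeD[OF xs(1) roots(2)]
      by (subst has_roots_mset[where fs = "map (\<lambda>k. c + of_int k) Q @ map (\<lambda>k. c + of_int k) P"])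
         (simp_all add: o_def add.commute)
    ultimately show ?thesis unfolding d by auto
  qed
qed

text \<open>The Euclidean step backwards.\<close>

lemma embedding_lift:
  assumes frob: "frobenius_data a c A B U" and eqs: "structure_eqs a c 1 A B U X Y V"
  shows "\<exists>A B U X Y Z. frobenius_data a (a + c) A B U \<and> structure_eqs a (a + c) 1 A B U X Y Z"
proof -
  have cs: "A \<in> carrier_mat a a" "B \<in> carrier_mat c c" "U \<in> carrier_mat c a"
    using frob by (auto simp: frobenius_data_def)
  have xs: "X \<in> carrier_mat a a" "Y \<in> carrier_mat c c" "V \<in> carrier_mat a c"
    using eqs by (auto simp: structure_eqs_def)
  have A0: "A + 0\<^sub>m a a = A" using cs by simp
  have "frobenius_data a (a + c) A (four_block_mat (0\<^sub>m a a) (0\<^sub>m a c) U B) (embedding_mat a c)"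
    using frobenius_data_embedding[OF cs(1) zero_carrier_mat zero_carrier_mat cs(3,2)] frob A0 by simp
  moreover have "structure_eqs a (a + c) 1 A (four_block_mat (0\<^sub>m a a) (0\<^sub>m a c) U B) (embedding_mat a c)
      (X + 1 \<cdot>\<^sub>m 1\<^sub>m a) (four_block_mat X V (0\<^sub>m c a) Y)
      (four_block_mat (A * X - X * A - 1 \<cdot>\<^sub>m A)
        (1 \<cdot>\<^sub>m 0\<^sub>m a c - (0\<^sub>m a a * V + 0\<^sub>m a c * Y) + (X * 0\<^sub>m a c + V * B)) (0\<^sub>m 0 a) (0\<^sub>m 0 c))"
    using cs xs eqs A0
    by (subst structure_eqs_embedding_blocks) (auto intro!: minus_carrier_mat)
  ultimately show ?thesis by blast
qed

theorem frobenius_data_exists: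
  assumes "0 < a" "coprime a b"
  shows "\<exists>A B U X Y Z. frobenius_data a b A B U \<and> structure_eqs a b 1 A B U X Y Z"
  using assms
proof (induction a b rule: exponents.induct)
  case (1 a b)
  consider "b = 0" | "b \<noteq> 0" "a \<le> b" | "b \<noteq> 0" "\<not> a \<le> b" by blast
  then show ?case
  proof cases
    case 1
    with \<open>coprime a b\<close> have a: "a = 1" by simp
    have "frobenius_data 1 0 (0\<^sub>m 1 1) (0\<^sub>m 0 0) (0\<^sub>m 0 1)"
      unfolding frobenius_data_def structure_eqs_def
    proof (intro conjI allI impI; (elim conjE)?)
      fix X Y Z :: "complex mat"
      assume "X \<in> carrier_mat 1 1" "Y \<in> carrier_mat 0 0" "Z \<in> carrier_mat 1 0"
      then show "\<exists>c. X = c \<cdot>\<^sub>m 1\<^sub>m 1 \<and> Y = c \<cdot>\<^sub>m 1\<^sub>m 0 \<and> Z = 0\<^sub>m 1 0"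
        by (intro exI[of _ "X $$ (0, 0)"]) (auto intro!: eq_matI)
    qed auto
    moreover have "structure_eqs 1 0 1 (0\<^sub>m 1 1) (0\<^sub>m 0 0) (0\<^sub>m 0 1) (0\<^sub>m 1 1) (0\<^sub>m 0 0) (0\<^sub>m 1 0)"
      unfolding structure_eqs_def by (auto intro!: eq_matI)
    ultimately show ?thesis using 1 a by blast
  next
    case 2
    then obtain A B U X Y Z where "frobenius_data a (b - a) A B U" "structure_eqs a (b - a) 1 A B U X Y Z"
      using "1.IH"(1) coprime_euclid_step[of a b] "1.prems" by auto
    from embedding_lift[OF this] show ?thesis using 2 by simp
  next
    case 3
    have "coprime (a - b) b" using coprime_euclid_step[of b a] \<open>coprime a b\<close> 3
      by (simp add: coprime_commute)
    then obtain A B U X Y Z where r: "frobenius_data (a - b) b A B U" "structure_eqs (a - b) b 1 A B U X Y Z"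
      using "1.IH"(2) 3 "1.prems" by auto
    have cs: "A \<in> carrier_mat (a - b) (a - b)" "B \<in> carrier_mat b b" "U \<in> carrier_mat b (a - b)"
      using r(1) by (auto simp: frobenius_data_def)
    obtain A' B' U' X' Y' Z' where r': "frobenius_data b a A' B' U'" "structure_eqs b a 1 A' B' U' X' Y' Z'"
      using embedding_lift[OF frobenius_data_dual[OF r(1)] structure_eqs_dual[OF cs r(2)]] 3 by auto
    have "A' \<in> carrier_mat b b" "B' \<in> carrier_mat a a" "U' \<in> carrier_mat a b"
      using r'(1) by (auto simp: frobenius_data_def)
    from frobenius_data_dual[OF r'(1)] structure_eqs_dual[OF this r'(2)] show ?thesis by blast
  qed
qed

section \<open>Linear functionals as trace forms\<close>

text \<open>The linear combination of the matrices \<open>v i\<close> with coefficients \<open>c i\<close>, written entrywise as in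
  \<open>represents\<close>.\<close>

definition lin_comb :: "nat \<Rightarrow> 'i set \<Rightarrow> ('i \<Rightarrow> complex mat) \<Rightarrow> ('i \<Rightarrow> complex) \<Rightarrow> complex mat" where
  "lin_comb n I v c = mat n n (\<lambda>(p, q). \<Sum>i\<in>I. c i * v i $$ (p, q))"

lemma lin_comb_carrier[simp]: "lin_comb n I v c \<in> carrier_mat n n"
  "dim_row (lin_comb n I v c) = n" "dim_col (lin_comb n I v c) = n"
  by (simp_all add: lin_comb_def)

lemma lin_comb_insert:
  assumes "finite I" "i \<notin> I" "v i \<in> carrier_mat n n"
  shows "lin_comb n (insert i I) v c = c i \<cdot>\<^sub>m v i + lin_comb n I v c"
  using assms by (auto simp: lin_comb_def intro!: eq_matI)

lemma lin_comb_empty: "lin_comb n {} v c = 0\<^sub>m n n"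
  by (auto simp: lin_comb_def intro!: eq_matI)

text \<open>The positions outside the lower left block, for a first block of size \<open>a\<close>.\<close>

abbreviation allowed :: "nat \<Rightarrow> nat \<Rightarrow> nat \<Rightarrow> bool" where
  "allowed a i j \<equiv> i < a \<or> a \<le> j"

lemma mat_trace_four_block:
  assumes "X \<in> carrier_mat a a" "Y \<in> carrier_mat b b"
  shows "mat_trace (four_block_mat X Z W Y) = mat_trace X + mat_trace (Y :: complex mat)"
proof -
  have "(\<Sum>i<a + b. four_block_mat X Z W Y $$ (i, i)) =
      (\<Sum>i<a. four_block_mat X Z W Y $$ (i, i)) + (\<Sum>i<b. four_block_mat X Z W Y $$ (a + i, a + i))"
    by (induction b) (simp_all add: add.assoc)
  then show ?thesis using assms by (simp add: mat_trace_def)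
qed

text \<open>The block upper triangular matrices, without the trace condition.\<close>

definition parabolic :: "nat \<Rightarrow> nat \<Rightarrow> complex mat set" where
  "parabolic a b = {x \<in> carrier_mat (a + b) (a + b).
     \<forall>i<a + b. \<forall>j<a + b. \<not> allowed a i j \<longrightarrow> x $$ (i, j) = 0}"

lemma parabolic_carrier: "x \<in> parabolic a b \<Longrightarrow> x \<in> carrier_mat (a + b) (a + b)"
  by (simp add: parabolic_def)

lemma parabolic_four_block:
  assumes "X \<in> carrier_mat a a" "Z \<in> carrier_mat a b" "Y \<in> carrier_mat b b"
  shows "four_block_mat X Z (0\<^sub>m b a) Y \<in> parabolic a b"
  using assms by (auto simp: parabolic_def)

lemma parabolic_cases:
  assumes x: "x \<in> parabolic a b"
  obtains X Z Y where "x = four_block_mat X Z (0\<^sub>m b a) Y"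
    "X \<in> carrier_mat a a" "Z \<in> carrier_mat a b" "Y \<in> carrier_mat b b"
proof -
  obtain X Z W Y where b: "x = four_block_mat X Z W Y" "X \<in> carrier_mat a a" "Z \<in> carrier_mat a b"
    "W \<in> carrier_mat b a" "Y \<in> carrier_mat b b"
    using four_block_mat_cases[OF parabolic_carrier[OF x]] by blast
  have "W = 0\<^sub>m b a"
  proof (rule eq_zero_matI)
    fix i j assume ij: "i < b" "j < a"
    moreover from this have "x $$ (a + i, j) = 0" using x by (auto simp: parabolic_def)
    ultimately show "W $$ (i, j) = 0" using b by auto
  qed (use b in auto)
  then show ?thesis using b that by blast
qed

lemma max_parabolic_eq: "x \<in> max_parabolic a b \<longleftrightarrow> x \<in> parabolic a b \<and> mat_trace x = 0"
proof
  assume "x \<in> max_parabolic a b"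
  then show "x \<in> parabolic a b \<and> mat_trace x = 0"
    unfolding max_parabolic_def using mat_trace_four_block by (auto intro: parabolic_four_block)
next
  assume x: "x \<in> parabolic a b \<and> mat_trace x = 0"
  then obtain X Z Y where b: "x = four_block_mat X Z (0\<^sub>m b a) Y" "X \<in> carrier_mat a a" "Z \<in> carrier_mat a b"
    "Y \<in> carrier_mat b b"
    using parabolic_cases by blast
  then show "x \<in> max_parabolic a b"
    unfolding max_parabolic_def using x mat_trace_four_block[OF b(2,4)] by auto
qed

lemma max_parabolic_iff:
  "x \<in> max_parabolic a b \<longleftrightarrow> x \<in> carrier_mat (a + b) (a + b) \<and>
     (\<forall>i<a + b. \<forall>j<a + b. \<not> allowed a i j \<longrightarrow> x $$ (i, j) = 0) \<and> mat_trace x = 0"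
  by (auto simp: max_parabolic_eq parabolic_def)

lemma mat_trace_add: "x \<in> carrier_mat n n \<Longrightarrow> y \<in> carrier_mat n n \<Longrightarrow>
    mat_trace (x + y) = mat_trace x + mat_trace (y :: complex mat)"
  by (simp add: mat_trace_def sum.distrib)

lemma mat_trace_minus: "x \<in> carrier_mat n n \<Longrightarrow> y \<in> carrier_mat n n \<Longrightarrow>
    mat_trace (x - y) = mat_trace x - mat_trace (y :: complex mat)"
  by (simp add: mat_trace_def sum_subtractf)

lemma mat_trace_smult: "x \<in> carrier_mat n n \<Longrightarrow> mat_trace (c \<cdot>\<^sub>m x) = c * mat_trace (x :: complex mat)"
  by (simp add: mat_trace_def sum_distrib_left)

lemma mat_trace_one: "mat_trace (1\<^sub>m n :: complex mat) = of_nat n"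
  by (simp add: mat_trace_def)

lemma mat_trace_mult:
  assumes "x \<in> carrier_mat n m" "y \<in> carrier_mat m n"
  shows "mat_trace (x * y :: complex mat) = (\<Sum>i<n. \<Sum>k<m. x $$ (i, k) * y $$ (k, i))"
  using assms by (simp add: mat_trace_def scalar_prod_def atLeast0LessThan)

lemma mat_trace_comm:
  assumes "x \<in> carrier_mat n m" "y \<in> carrier_mat m n"
  shows "mat_trace (x * y) = mat_trace (y * x :: complex mat)"
  unfolding mat_trace_mult[OF assms] mat_trace_mult[OF assms(2,1)]
  by (subst sum.swap) (simp add: mult.commute)

lemma max_parabolic_zero: "0\<^sub>m (a + b) (a + b) \<in> max_parabolic a b"
  by (simp add: max_parabolic_iff mat_trace_def)

lemma max_parabolic_add: "x \<in> max_parabolic a b \<Longrightarrow> y \<in> max_parabolic a b \<Longrightarrow> x + y \<in> max_parabolic a b"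
  using mat_trace_add[of x "a + b" y] by (auto simp: max_parabolic_iff)

lemma max_parabolic_smult: "x \<in> max_parabolic a b \<Longrightarrow> c \<cdot>\<^sub>m x \<in> max_parabolic a b"
  by (auto simp: max_parabolic_iff mat_trace_smult)

lemma max_parabolic_carrier: "x \<in> max_parabolic a b \<Longrightarrow> x \<in> carrier_mat (a + b) (a + b)"
  by (simp add: max_parabolic_iff)

lemma max_parabolic_comb:
  assumes "finite I" "\<And>i. i \<in> I \<Longrightarrow> v i \<in> max_parabolic a b"
  shows "lin_comb (a + b) I v c \<in> max_parabolic a b"
  using assms
proof (induction I rule: finite_induct)
  case empty
  then show ?case by (simp add: lin_comb_empty max_parabolic_zero)
next
  case (insert i I)
  then show ?case
    by (subst lin_comb_insert) (auto intro!: max_parabolic_add max_parabolic_smult max_parabolic_carrier)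
qed

lemma linear_functional_comb:
  assumes lin: "linear_functional_on (max_parabolic a b) \<phi>"
    and I: "finite I" "\<And>i. i \<in> I \<Longrightarrow> v i \<in> max_parabolic a b"
  shows "\<phi> (lin_comb (a + b) I v c) = (\<Sum>i\<in>I. c i * \<phi> (v i))"
  using I
proof (induction I rule: finite_induct)
  case empty
  have "\<phi> (0 \<cdot>\<^sub>m 0\<^sub>m (a + b) (a + b)) = 0 * \<phi> (0\<^sub>m (a + b) (a + b))"
    using lin max_parabolic_zero unfolding linear_functional_on_def by blast
  then show ?case by (simp add: lin_comb_empty)
next
  case (insert i I)
  have "\<phi> (c i \<cdot>\<^sub>m v i + lin_comb (a + b) I v c) = \<phi> (c i \<cdot>\<^sub>m v i) + \<phi> (lin_comb (a + b) I v c)"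
    using lin insert.prems insert.hyps max_parabolic_comb[of I v a b c] max_parabolic_smult
    unfolding linear_functional_on_def by auto
  also have "\<phi> (c i \<cdot>\<^sub>m v i) = c i * \<phi> (v i)"
    using lin insert.prems unfolding linear_functional_on_def by auto
  finally show ?case using insert by (subst lin_comb_insert) (auto intro: max_parabolic_carrier)
qed

text \<open>Matrix units, corrected by a multiple of the identity so that the trace vanishes. They span \<open>W(a, b)\<close>
  but are not independent.\<close>

definition traceless_unit :: "nat \<Rightarrow> nat \<times> nat \<Rightarrow> complex mat" where
  "traceless_unit n = (\<lambda>(i, j). mat n n (\<lambda>(p, q).
     of_bool (p = i \<and> q = j) - (if i = j \<and> p = q then 1 / of_nat n else 0)))"

definition allowed_pairs :: "nat \<Rightarrow> nat \<Rightarrow> (nat \<times> nat) set" where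
  "allowed_pairs a n = {(i, j). i < n \<and> j < n \<and> allowed a i j}"

lemma finite_allowed_pairs[simp]: "finite (allowed_pairs a n)"
  by (rule finite_subset[of _ "{..<n} \<times> {..<n}"]) (auto simp: allowed_pairs_def)

lemma traceless_unit_in:
  assumes "ij \<in> allowed_pairs a (a + b)"
  shows "traceless_unit (a + b) ij \<in> max_parabolic a b"
proof -
  obtain i j where ij: "ij = (i, j)" "i < a + b" "j < a + b" "allowed a i j"
    using assms by (auto simp: allowed_pairs_def)
  have "mat_trace (traceless_unit (a + b) (i, j)) =
      (\<Sum>p<a + b. of_bool (p = i \<and> p = j) - (if i = j then 1 / of_nat (a + b) else 0))"
    by (simp add: mat_trace_def traceless_unit_def)
  also have "\<dots> = (\<Sum>p<a + b. if p = i then of_bool (i = j) else 0) - (\<Sum>p<a + b. if i = j then 1 / of_nat (a + b) else 0)"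
    by (subst sum_subtractf[symmetric]) (auto intro!: sum.cong)
  also have "\<dots> = 0" using ij(2) by (auto simp: field_simps simp flip: of_nat_add)
  finally show ?thesis using ij by (auto simp: max_parabolic_iff traceless_unit_def)
qed

lemma sum_pairs: "(\<Sum>i<n. \<Sum>j<n. f i j) = (\<Sum>(i, j)\<in>{..<n} \<times> {..<n}. f i j)"
  by (simp add: sum.cartesian_product)

lemma sum_allowed_pairs:
  assumes "\<And>i j. i < n \<Longrightarrow> j < n \<Longrightarrow> \<not> allowed a i j \<Longrightarrow> f i j = (0::complex)"
  shows "(\<Sum>i<n. \<Sum>j<n. f i j) = (\<Sum>(i, j)\<in>allowed_pairs a n. f i j)"
  unfolding sum_pairs using assms
  by (intro sum.mono_neutral_right) (auto simp: allowed_pairs_def)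

lemma trace_form_traceless_unit:
  assumes G: "G \<in> carrier_mat n n" and "i < n" "j < n"
  shows "mat_trace (G * traceless_unit n (i, j)) = G $$ (j, i) - (if i = j then mat_trace G / of_nat n else 0)"
proof -
  have "mat_trace (G * traceless_unit n (i, j)) =
      (\<Sum>p<n. \<Sum>q<n. G $$ (p, q) * traceless_unit n (i, j) $$ (q, p))"
    using G by (intro mat_trace_mult) (auto simp: traceless_unit_def)
  also have "\<dots> = (\<Sum>p<n. \<Sum>q<n. (if p = j then (if q = i then G $$ (p, q) else 0) else 0)
      - (if p = q then G $$ (p, q) * (if i = j then 1 / of_nat n else 0) else 0))"
    by (intro sum.cong refl) (auto simp: traceless_unit_def algebra_simps)
  also have "\<dots> = (\<Sum>p<n. \<Sum>q<n. if p = j then (if q = i then G $$ (p, q) else 0) else 0)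
      - (\<Sum>p<n. \<Sum>q<n. if p = q then G $$ (p, q) * (if i = j then 1 / of_nat n else 0) else 0)"
    by (simp only: sum_subtractf)
  also have "(\<Sum>p<n. \<Sum>q<n. if p = q then G $$ (p, q) * (if i = j then 1 / of_nat n else 0) else 0)
      = (\<Sum>p<n. G $$ (p, p) * (if i = j then 1 / of_nat n else 0))"
    by (intro sum.cong refl) (subst sum.delta', auto)
  also have "\<dots> = mat_trace G * (if i = j then 1 / of_nat n else 0)"
    using G by (simp only: mat_trace_def sum_distrib_right carrier_matD)
  also have "(\<Sum>p<n. \<Sum>q<n. if p = j then (if q = i then G $$ (p, q) else 0) else 0) = G $$ (j, i)"
  proof -
    have "(\<Sum>q<n. if p = j then (if q = i then G $$ (p, q) else 0) else 0) = (if p = j then G $$ (p, i) else 0)" for p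
      using assms by (cases "p = j") simp_all
    then show ?thesis using assms by simp
  qed
  finally show ?thesis by auto
qed

lemma lin_comb_traceless_unit:
  assumes x: "x \<in> max_parabolic a b" and n: "0 < a + b"
  shows "x = lin_comb (a + b) (allowed_pairs a (a + b)) (traceless_unit (a + b)) (\<lambda>ij. x $$ ij)"
proof (rule eq_matI)
  let ?n = "a + b"
  have xs: "x \<in> carrier_mat ?n ?n" "\<And>i j. i < ?n \<Longrightarrow> j < ?n \<Longrightarrow> \<not> allowed a i j \<Longrightarrow> x $$ (i, j) = 0"
    "mat_trace x = 0" using x by (auto simp: max_parabolic_iff)
  then show "dim_row x = dim_row (lin_comb ?n (allowed_pairs a ?n) (traceless_unit ?n) (\<lambda>ij. x $$ ij))"
    "dim_col x = dim_col (lin_comb ?n (allowed_pairs a ?n) (traceless_unit ?n) (\<lambda>ij. x $$ ij))" by auto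
  fix p q assume "p < dim_row (lin_comb ?n (allowed_pairs a ?n) (traceless_unit ?n) (\<lambda>ij. x $$ ij))"
    "q < dim_col (lin_comb ?n (allowed_pairs a ?n) (traceless_unit ?n) (\<lambda>ij. x $$ ij))"
  then have pq: "p < ?n" "q < ?n" by auto
  have "lin_comb ?n (allowed_pairs a ?n) (traceless_unit ?n) (\<lambda>ij. x $$ ij) $$ (p, q) =
      (\<Sum>(i, j)\<in>allowed_pairs a ?n. x $$ (i, j) * traceless_unit ?n (i, j) $$ (p, q))"
    using pq by (auto simp: lin_comb_def case_prod_beta)
  also have "\<dots> = (\<Sum>i<?n. \<Sum>j<?n. x $$ (i, j) * traceless_unit ?n (i, j) $$ (p, q))"
    using xs by (intro sum_allowed_pairs[symmetric]) auto
  \<comment> \<open>The entry of a traceless unit is symmetric in the two positions involved, up to transposition.\<close>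
  also have "\<dots> = (\<Sum>i<?n. \<Sum>j<?n. x $$ (i, j) * traceless_unit ?n (q, p) $$ (j, i))"
    using pq by (intro sum.cong refl) (auto simp: traceless_unit_def)
  also have "\<dots> = mat_trace (x * traceless_unit ?n (q, p))"
    using xs(1) by (intro mat_trace_mult[symmetric]) (auto simp: traceless_unit_def)
  also have "\<dots> = x $$ (p, q) - (if q = p then mat_trace x / of_nat ?n else 0)"
    by (rule trace_form_traceless_unit[OF xs(1) pq(2,1)])
  finally show "x $$ (p, q) = lin_comb ?n (allowed_pairs a ?n) (traceless_unit ?n) (\<lambda>ij. x $$ ij) $$ (p, q)"
    using xs(3) by simp
qed

text \<open>The sum of the traceless diagonal units is \<open>0\<close>, so the diagonal coefficients obtained from them have
  sum \<open>0\<close>: the matrix of the trace form is trace-free.\<close>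

lemma functional_as_trace_form:
  assumes lin: "linear_functional_on (max_parabolic a b) \<phi>" and n: "0 < a + b"
  obtains A B U where "A \<in> carrier_mat a a" "B \<in> carrier_mat b b" "U \<in> carrier_mat b a"
    "mat_trace A + mat_trace B = 0"
    "\<And>x. x \<in> max_parabolic a b \<Longrightarrow> \<phi> x = mat_trace (four_block_mat A (0\<^sub>m a b) U B * x)"
proof -
  let ?n = "a + b" and ?e = "traceless_unit (a + b)"
  define F where "F = mat ?n ?n (\<lambda>(j, i). if allowed a i j then \<phi> (?e (i, j)) else 0)"
  have F: "F \<in> carrier_mat ?n ?n" by (simp add: F_def)
  obtain A W U B where Fb: "F = four_block_mat A W U B" "A \<in> carrier_mat a a" "W \<in> carrier_mat a b"
    "U \<in> carrier_mat b a" "B \<in> carrier_mat b b"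
    using four_block_mat_cases[OF F] by blast
  have "W = 0\<^sub>m a b"
  proof (rule eq_zero_matI)
    fix i j assume ij: "i < a" "j < b"
    then have "F $$ (i, a + j) = 0" by (simp add: F_def)
    then show "W $$ (i, j) = 0" using Fb ij by simp
  qed (use Fb in auto)
  moreover have "\<phi> x = mat_trace (F * x)" if x: "x \<in> max_parabolic a b" for x
  proof -
    have xs: "x \<in> carrier_mat ?n ?n" "\<And>i j. i < ?n \<Longrightarrow> j < ?n \<Longrightarrow> \<not> allowed a i j \<Longrightarrow> x $$ (i, j) = 0"
      using x by (auto simp: max_parabolic_iff)
    have "\<phi> x = (\<Sum>ij\<in>allowed_pairs a ?n. x $$ ij * \<phi> (?e ij))"
      by (subst lin_comb_traceless_unit[OF x n])
        (rule linear_functional_comb[OF lin finite_allowed_pairs traceless_unit_in])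
    also have "\<dots> = (\<Sum>(i, j)\<in>allowed_pairs a ?n. x $$ (i, j) * F $$ (j, i))"
      by (intro sum.cong) (auto simp: F_def allowed_pairs_def)
    also have "\<dots> = (\<Sum>i<?n. \<Sum>j<?n. x $$ (i, j) * F $$ (j, i))"
      using xs by (intro sum_allowed_pairs[symmetric]) auto
    also have "\<dots> = mat_trace (x * F)" by (rule mat_trace_mult[OF xs(1) F, symmetric])
    finally show ?thesis using mat_trace_comm[OF xs(1) F] by simp
  qed
  moreover have "mat_trace A + mat_trace B = 0"
  proof -
    let ?D = "(\<lambda>i. (i, i)) ` {..<?n}"
    have "mat_trace F = (\<Sum>ij\<in>?D. 1 * \<phi> (?e ij))"
      by (subst sum.reindex) (auto simp: F_def mat_trace_def inj_on_def intro!: sum.cong)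
    also have "\<dots> = \<phi> (lin_comb ?n ?D ?e (\<lambda>_. 1))"
      by (rule linear_functional_comb[OF lin, symmetric]) (auto intro!: traceless_unit_in simp: allowed_pairs_def)
    also have "lin_comb ?n ?D ?e (\<lambda>_. 1) = lin_comb ?n ({} :: nat set) (\<lambda>_. 0\<^sub>m ?n ?n) (\<lambda>_. 0)"
    proof -
      have "(\<Sum>i<?n. (of_bool (p = i \<and> q = i) :: complex) - (if p = q then 1 / of_nat ?n else 0)) = 0"
        if "p < ?n" "q < ?n" for p q
      proof -
        have "(\<Sum>i<?n. of_bool (p = i \<and> q = i) :: complex) = (\<Sum>i<?n. if p = i then of_bool (p = q) else 0)"
          by (intro sum.cong) auto
        also have "\<dots> = of_bool (p = q)" using that by simp
        finally have 1: "(\<Sum>i<?n. of_bool (p = i \<and> q = i) :: complex) = of_bool (p = q)" .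
        have 2: "(\<Sum>i<?n. if p = q then 1 / of_nat ?n else 0) = (of_bool (p = q) :: complex)"
          using n by (cases "p = q") (simp_all del: of_nat_add)
        show ?thesis unfolding sum_subtractf 1 2 by simp
      qed
      then show ?thesis
        by (intro eq_matI) (simp_all add: lin_comb_def sum.reindex inj_on_def traceless_unit_def)
    qed
    also have "\<phi> \<dots> = 0" by (subst linear_functional_comb[OF lin]) auto
    finally show ?thesis using mat_trace_four_block[OF Fb(2,5)] Fb(1) by simp
  qed
  ultimately show ?thesis using Fb that by blast
qed

section \<open>Brackets and Frobenius functionals\<close>

lemma parabolic_mult:
  assumes "x \<in> parabolic a b" "y \<in> parabolic a b"
  shows "x * y \<in> parabolic a b"
proof -
  obtain X Z Y where x: "x = four_block_mat X Z (0\<^sub>m b a) Y"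
    "X \<in> carrier_mat a a" "Z \<in> carrier_mat a b" "Y \<in> carrier_mat b b"
    using parabolic_cases[OF assms(1)] by blast
  obtain X' Z' Y' where y: "y = four_block_mat X' Z' (0\<^sub>m b a) Y'"
    "X' \<in> carrier_mat a a" "Z' \<in> carrier_mat a b" "Y' \<in> carrier_mat b b"
    using parabolic_cases[OF assms(2)] by blast
  show ?thesis
    unfolding x(1) y(1) mult_block_triangular[OF x(2-4) y(2-4)] using x y by (auto intro!: parabolic_four_block)
qed

lemma parabolic_minus: "x \<in> parabolic a b \<Longrightarrow> y \<in> parabolic a b \<Longrightarrow> x - y \<in> parabolic a b"
  by (auto simp: parabolic_def)

lemma parabolic_smult: "x \<in> parabolic a b \<Longrightarrow> c \<cdot>\<^sub>m x \<in> parabolic a b"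
  by (auto simp: parabolic_def)

lemma parabolic_one: "1\<^sub>m (a + b) \<in> parabolic a b"
  by (auto simp: parabolic_def)

lemma lie_bracket_in:
  assumes x: "x \<in> parabolic a b" and y: "y \<in> parabolic a b"
  shows "lie_bracket x y \<in> max_parabolic a b"
proof -
  note c = parabolic_carrier[OF x] parabolic_carrier[OF y]
  have "mat_trace (lie_bracket x y) = 0"
    using c mat_trace_minus[of "x * y" "a + b" "y * x"] mat_trace_comm[OF c] by (simp add: lie_bracket_def)
  then show ?thesis
    unfolding max_parabolic_eq lie_bracket_def using assms by (simp add: parabolic_mult parabolic_minus)
qed

lemma trace_form_bracket:
  assumes "F \<in> carrier_mat n n" "h \<in> carrier_mat n n" "x \<in> carrier_mat n n"
  shows "mat_trace (F * lie_bracket h x) - e * mat_trace (F * x) =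
    mat_trace ((F * h - h * F - e \<cdot>\<^sub>m F) * (x :: complex mat))"
proof -
  have "F * lie_bracket h x = F * h * x - F * x * h"
    unfolding lie_bracket_def using assms
    by (simp add: mult_minus_distrib_mat[of F n n "h * x" n "x * h"] assoc_mult_mat[of F n n _ n _ n])
  then have "mat_trace (F * lie_bracket h x) = mat_trace (F * h * x) - mat_trace (F * x * h)"
    using assms by (simp add: mat_trace_minus[of _ n])
  also have "mat_trace (F * x * h) = mat_trace (h * (F * x))"
    using assms by (intro mat_trace_comm) auto
  also have "h * (F * x) = h * F * x" using assms by (intro assoc_mult_mat[symmetric]) auto
  finally have 1: "mat_trace (F * lie_bracket h x) = mat_trace (F * h * x) - mat_trace (h * F * x)" .
  have "(F * h - h * F - e \<cdot>\<^sub>m F) * x = (F * h - h * F) * x - (e \<cdot>\<^sub>m F) * x"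
    using assms by (intro minus_mult_distrib_mat[of _ n n _ _ n]) (auto intro!: minus_carrier_mat)
  also have "(F * h - h * F) * x = F * h * x - h * F * x"
    using assms by (intro minus_mult_distrib_mat[of _ n n _ _ n]) auto
  also have "(e \<cdot>\<^sub>m F) * x = e \<cdot>\<^sub>m (F * x)" using assms by (intro mult_smult_assoc_mat[of _ n n]) auto
  finally have "(F * h - h * F - e \<cdot>\<^sub>m F) * x = F * h * x - h * F * x - e \<cdot>\<^sub>m (F * x)" .
  moreover have c: "F * h * x \<in> carrier_mat n n" "h * F * x \<in> carrier_mat n n" "F * x \<in> carrier_mat n n"
    using assms by auto
  ultimately show ?thesis
    using 1 mat_trace_minus[OF minus_carrier_mat[OF c(2)] smult_carrier_mat[OF c(3)], of "F * h * x" e]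
      mat_trace_minus[OF c(1,2)] mat_trace_smult[OF c(3)] by (simp only:)
qed

text \<open>Without \<open>tr G = 0\<close> the left-hand side would allow the diagonal blocks to be a common multiple of the identity.\<close>

lemma trace_form_zero_iff:
  assumes G: "G \<in> carrier_mat (a + b) (a + b)" and tr: "mat_trace G = 0"
  shows "(\<forall>x\<in>max_parabolic a b. mat_trace (G * x) = 0) \<longleftrightarrow>
    (\<forall>(i, j)\<in>allowed_pairs a (a + b). G $$ (j, i) = 0)"
proof
  assume 0: "\<forall>x\<in>max_parabolic a b. mat_trace (G * x) = 0"
  show "\<forall>(i, j)\<in>allowed_pairs a (a + b). G $$ (j, i) = 0"
  proof clarify
    fix i j assume ij: "(i, j) \<in> allowed_pairs a (a + b)"
    then show "G $$ (j, i) = 0"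
      using 0 traceless_unit_in[OF ij] trace_form_traceless_unit[OF G, of i j] tr
      by (auto simp: allowed_pairs_def)
  qed
next
  assume 0: "\<forall>(i, j)\<in>allowed_pairs a (a + b). G $$ (j, i) = 0"
  show "\<forall>x\<in>max_parabolic a b. mat_trace (G * x) = 0"
  proof
    fix x assume "x \<in> max_parabolic a b"
    then have xs: "x \<in> carrier_mat (a + b) (a + b)"
      "\<And>i j. i < a + b \<Longrightarrow> j < a + b \<Longrightarrow> \<not> allowed a i j \<Longrightarrow> x $$ (i, j) = 0"
      by (auto simp: max_parabolic_iff)
    have "mat_trace (G * x) = (\<Sum>i<a + b. \<Sum>j<a + b. x $$ (i, j) * G $$ (j, i))"
      using mat_trace_comm[OF G xs(1)] mat_trace_mult[OF xs(1) G] by simp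
    also have "\<dots> = 0"
    proof (intro sum.neutral ballI)
      fix i j assume "i \<in> {..<a + b}" "j \<in> {..<a + b}"
      then show "x $$ (i, j) * G $$ (j, i) = 0"
        using 0 xs(2)[of i j] by (cases "allowed a i j") (auto simp: allowed_pairs_def)
    qed
    finally show "mat_trace (G * x) = 0" .
  qed
qed

lemma allowed_blocks_zero_iff:
  assumes "G11 \<in> carrier_mat a a" "G12 \<in> carrier_mat a b" "G21 \<in> carrier_mat b a" "G22 \<in> carrier_mat b b"
  shows "(\<forall>(i, j)\<in>allowed_pairs a (a + b). four_block_mat G11 G12 G21 G22 $$ (j, i) = 0) \<longleftrightarrow>
    G11 = 0\<^sub>m a a \<and> G21 = 0\<^sub>m b a \<and> G22 = (0\<^sub>m b b :: complex mat)" (is "?L \<longleftrightarrow> ?R")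
proof
  assume L: ?L
  then have e: "four_block_mat G11 G12 G21 G22 $$ (j, i) = 0" if "i < a + b" "j < a + b" "allowed a i j" for i j
    using that by (auto simp: allowed_pairs_def)
  have "G11 = 0\<^sub>m a a"
  proof (rule eq_zero_matI)
    fix i j assume ij: "i < a" "j < a"
    then show "G11 $$ (i, j) = 0" using e[of j i] assms by auto
  qed (use assms in auto)
  moreover have "G21 = 0\<^sub>m b a"
  proof (rule eq_zero_matI)
    fix i j assume ij: "i < b" "j < a"
    then show "G21 $$ (i, j) = 0" using e[of j "a + i"] assms by auto
  qed (use assms in auto)
  moreover have "G22 = 0\<^sub>m b b"
  proof (rule eq_zero_matI)
    fix i j assume ij: "i < b" "j < b"
    then show "G22 $$ (i, j) = 0" using e[of "a + j" "a + i"] assms by auto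
  qed (use assms in auto)
  ultimately show ?R by blast
next
  assume ?R
  then show ?L using assms by (auto simp: allowed_pairs_def)
qed

lemma mat_minus_eq_zero_iff:
  assumes "P \<in> carrier_mat n m" "Q \<in> carrier_mat n m"
  shows "P - Q = 0\<^sub>m n m \<longleftrightarrow> P = (Q :: complex mat)"
proof
  assume "P - Q = 0\<^sub>m n m"
  then have "Q = P - 0\<^sub>m n m" using assms by (subst mat_minus_eq_swap[symmetric, of _ n m]) auto
  then show "P = Q" using assms by auto
next
  assume "P = Q"
  then show "P - Q = 0\<^sub>m n m" using assms by auto
qed

text \<open>For \<open>e \<noteq> 0\<close> the condition on the traces is needed since a scalar matrix added to \<open>F\<close> changes the
  equations but not the functional.\<close>

theorem bracket_structure_eqs:
  assumes cs: "A \<in> carrier_mat a a" "B \<in> carrier_mat b b" "U \<in> carrier_mat b a"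
    and tr: "e = 0 \<or> mat_trace A + mat_trace B = 0"
    and xs: "X \<in> carrier_mat a a" "Y \<in> carrier_mat b b" "Z \<in> carrier_mat a b"
    and \<phi>: "\<And>x. x \<in> max_parabolic a b \<Longrightarrow> \<phi> x = mat_trace (four_block_mat A (0\<^sub>m a b) U B * x)"
  shows "(\<forall>x\<in>max_parabolic a b. \<phi> (lie_bracket (four_block_mat X Z (0\<^sub>m b a) Y) x) = e * \<phi> x) \<longleftrightarrow>
    structure_eqs a b e A B U X Y Z"
proof -
  let ?n = "a + b" and ?F = "four_block_mat A (0\<^sub>m a b) U B" and ?h = "four_block_mat X Z (0\<^sub>m b a) Y"
  have F: "?F \<in> carrier_mat ?n ?n" and h: "?h \<in> carrier_mat ?n ?n" using cs xs by auto
  have hP: "?h \<in> parabolic a b" using xs by (intro parabolic_four_block) auto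
  define G where "G = ?F * ?h - ?h * ?F - e \<cdot>\<^sub>m ?F"
  have Fh: "?F * ?h = four_block_mat (A * X) (A * Z) (U * X) (U * Z + B * Y)"
    using cs xs by (subst mult_four_block_mat[where ?nr1.0 = a and ?nr2.0 = b and ?n1.0 = a and ?n2.0 = b])
      (auto simp: left_mult_zero_mat[of _ b] right_mult_zero_mat[of _ _ b])
  have hF: "?h * ?F = four_block_mat (X * A + Z * U) (Z * B) (Y * U) (Y * B)"
    using cs xs by (subst mult_four_block_mat[where ?nr1.0 = a and ?nr2.0 = b and ?n1.0 = a and ?n2.0 = b])
      (auto simp: left_mult_zero_mat[of _ a] right_mult_zero_mat[of _ _ a])
  have p: "A * X \<in> carrier_mat a a" "A * Z \<in> carrier_mat a b" "U * X \<in> carrier_mat b a"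
    "U * Z + B * Y \<in> carrier_mat b b" "X * A + Z * U \<in> carrier_mat a a" "Z * B \<in> carrier_mat a b"
    "Y * U \<in> carrier_mat b a" "Y * B \<in> carrier_mat b b"
    using cs xs by auto
  have G: "G = four_block_mat (A * X - (X * A + Z * U) - e \<cdot>\<^sub>m A) (A * Z - Z * B - e \<cdot>\<^sub>m 0\<^sub>m a b)
      (U * X - Y * U - e \<cdot>\<^sub>m U) (U * Z + B * Y - Y * B - e \<cdot>\<^sub>m B)"
    unfolding G_def Fh hF minus_four_block_mat[OF p] smult_four_block_mat[OF cs(1) zero_carrier_mat cs(3,2)]
    using p cs by (intro minus_four_block_mat) (auto intro!: minus_carrier_mat)
  have Gc: "G \<in> carrier_mat ?n ?n" unfolding G_def using F h by (auto intro!: minus_carrier_mat)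
  have FhC: "?F * ?h \<in> carrier_mat ?n ?n" "?h * ?F \<in> carrier_mat ?n ?n" using F h by auto
  have "mat_trace G = mat_trace (?F * ?h - ?h * ?F) - e * mat_trace ?F"
    unfolding G_def
    by (simp only: mat_trace_minus[OF minus_carrier_mat[OF FhC(2)] smult_carrier_mat[OF F]] mat_trace_smult[OF F])
  also have "mat_trace (?F * ?h - ?h * ?F) = 0"
    by (simp only: mat_trace_minus[OF FhC] mat_trace_comm[OF F h] diff_self)
  finally have trG: "mat_trace G = 0" using tr mat_trace_four_block[OF cs(1,2)] by auto
  have "\<phi> (lie_bracket ?h x) = e * \<phi> x \<longleftrightarrow> mat_trace (G * x) = 0" if x: "x \<in> max_parabolic a b" for x
    using trace_form_bracket[OF F h max_parabolic_carrier[OF x], of e] \<phi>[OF x]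
      \<phi>[OF lie_bracket_in[OF hP]] x unfolding G_def[symmetric] max_parabolic_eq by auto
  then have "(\<forall>x\<in>max_parabolic a b. \<phi> (lie_bracket ?h x) = e * \<phi> x) \<longleftrightarrow>
      (\<forall>x\<in>max_parabolic a b. mat_trace (G * x) = 0)" by blast
  also have "\<dots> \<longleftrightarrow> A * X - (X * A + Z * U) - e \<cdot>\<^sub>m A = 0\<^sub>m a a \<and> U * X - Y * U - e \<cdot>\<^sub>m U = 0\<^sub>m b a \<and>
      U * Z + B * Y - Y * B - e \<cdot>\<^sub>m B = 0\<^sub>m b b"
    unfolding trace_form_zero_iff[OF Gc trG] unfolding G
    using p cs by (intro allowed_blocks_zero_iff) (auto intro!: minus_carrier_mat)
  also have "\<dots> \<longleftrightarrow> structure_eqs a b e A B U X Y Z"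
  proof -
    have 1: "A * X - (X * A + Z * U) - e \<cdot>\<^sub>m A = 0\<^sub>m a a \<longleftrightarrow> A * X - X * A - Z * U = e \<cdot>\<^sub>m A"
    proof -
      have q: "X * A \<in> carrier_mat a a" "Z * U \<in> carrier_mat a a" using cs xs by auto
      have "P - (Q + R) = P - Q - R" if "P \<in> carrier_mat a a" "Q \<in> carrier_mat a a" "R \<in> carrier_mat a a"
        for P Q R :: "complex mat" using that by (intro eq_matI) auto
      from this[OF p(1) q] show ?thesis
        using mat_minus_eq_zero_iff[OF minus_carrier_mat[OF p(5)] smult_carrier_mat[OF cs(1)], of "A * X" e]
        by simp
    qed
    have 2: "U * X - Y * U - e \<cdot>\<^sub>m U = 0\<^sub>m b a \<longleftrightarrow> U * X - Y * U = e \<cdot>\<^sub>m U"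
      using p cs by (intro mat_minus_eq_zero_iff) (auto intro!: minus_carrier_mat)
    have 3: "U * Z + B * Y - Y * B - e \<cdot>\<^sub>m B = 0\<^sub>m b b \<longleftrightarrow> B * Y - Y * B + U * Z = e \<cdot>\<^sub>m B"
    proof -
      have q: "U * Z \<in> carrier_mat b b" "B * Y \<in> carrier_mat b b" using cs xs by auto
      from mat_add_minus_rotate[OF q p(8)] show ?thesis
        using mat_minus_eq_zero_iff[OF minus_carrier_mat[OF p(8)] smult_carrier_mat[OF cs(2)], of "U * Z + B * Y" e]
        by simp
    qed
    show ?thesis unfolding 1 2 3 structure_eqs_def using xs by blast
  qed
  finally show ?thesis .
qed

lemma scalar_four_block:
  "c \<cdot>\<^sub>m 1\<^sub>m (a + b) = four_block_mat (c \<cdot>\<^sub>m 1\<^sub>m a) (0\<^sub>m a b) (0\<^sub>m b a) (c \<cdot>\<^sub>m 1\<^sub>m b :: complex mat)"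
  by (intro eq_matI) auto

lemma lie_bracket_scalar_shift:
  assumes "h \<in> carrier_mat n n" "x \<in> carrier_mat n n"
  shows "lie_bracket (h - c \<cdot>\<^sub>m 1\<^sub>m n) x = lie_bracket h (x :: complex mat)"
proof -
  have "(h - c \<cdot>\<^sub>m 1\<^sub>m n) * x = h * x - c \<cdot>\<^sub>m x"
    using assms by (subst minus_mult_distrib_mat[of _ n n _ _ n]) (auto simp: mult_smult_assoc_mat[of _ n n])
  moreover have "x * (h - c \<cdot>\<^sub>m 1\<^sub>m n) = x * h - c \<cdot>\<^sub>m x"
    using assms by (subst mult_minus_distrib_mat[of _ n n _ n]) (auto simp: mult_smult_distrib[of _ n n])
  moreover have "(P - R) - (Q - R) = P - Q"
    if "P \<in> carrier_mat n n" "Q \<in> carrier_mat n n" "R \<in> carrier_mat n n" for P Q R :: "complex mat"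
    using that by (intro eq_matI) auto
  ultimately show ?thesis
    unfolding lie_bracket_def using assms by simp
qed

lemma traceless_part:
  assumes h: "h \<in> parabolic a b" and n: "0 < a + b"
  shows "h - (mat_trace h / of_nat (a + b)) \<cdot>\<^sub>m 1\<^sub>m (a + b) \<in> max_parabolic a b"
proof -
  have "mat_trace (h - (mat_trace h / of_nat (a + b)) \<cdot>\<^sub>m 1\<^sub>m (a + b)) = 0"
    using parabolic_carrier[OF h] n
    by (simp add: mat_trace_minus[of _ "a + b"] mat_trace_smult[of _ "a + b"] mat_trace_one del: of_nat_add)
  then show ?thesis
    unfolding max_parabolic_eq using h by (simp add: parabolic_minus parabolic_smult parabolic_one)
qed

lemma frobenius_functional_imp_data:
  assumes frob: "frobenius_functional (a + b) (max_parabolic a b) \<phi>"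
    and cs: "A \<in> carrier_mat a a" "B \<in> carrier_mat b b" "U \<in> carrier_mat b a"
    and \<phi>: "\<And>x. x \<in> max_parabolic a b \<Longrightarrow> \<phi> x = mat_trace (four_block_mat A (0\<^sub>m a b) U B * x)"
    and n: "0 < a + b"
  shows "frobenius_data a b A B U"
  unfolding frobenius_data_def
proof (intro conjI allI impI cs)
  fix X Y Z assume eqs: "structure_eqs a b 0 A B U X Y Z"
  have xs: "X \<in> carrier_mat a a" "Y \<in> carrier_mat b b" "Z \<in> carrier_mat a b"
    using eqs by (auto simp: structure_eqs_def)
  define h where "h = four_block_mat X Z (0\<^sub>m b a) Y"
  \<comment> \<open>Subtracting the trace part moves \<open>h\<close> into \<open>W(a, b)\<close> and does not change its brackets.\<close>
  define t where "t = mat_trace h / of_nat (a + b)"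
  have h: "h \<in> parabolic a b" unfolding h_def using xs by (intro parabolic_four_block)
  note hc = parabolic_carrier[OF h]
  have "\<phi> (lie_bracket h x) = 0 * \<phi> x" if "x \<in> max_parabolic a b" for x
    using bracket_structure_eqs[OF cs _ xs \<phi>, of 0] eqs that unfolding h_def by blast
  then have "\<phi> (lie_bracket (h - t \<cdot>\<^sub>m 1\<^sub>m (a + b)) x) = 0" if "x \<in> max_parabolic a b" for x
    using that lie_bracket_scalar_shift[OF hc max_parabolic_carrier[OF that]] by simp
  moreover have "h - t \<cdot>\<^sub>m 1\<^sub>m (a + b) \<in> max_parabolic a b"
    unfolding t_def using h n by (rule traceless_part)
  ultimately have "h - t \<cdot>\<^sub>m 1\<^sub>m (a + b) = 0\<^sub>m (a + b) (a + b)"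
    using frob unfolding frobenius_functional_def by blast
  then have "h = t \<cdot>\<^sub>m 1\<^sub>m (a + b)"
    using hc by (subst (asm) mat_minus_eq_zero_iff) auto
  then have "X = t \<cdot>\<^sub>m 1\<^sub>m a \<and> Z = 0\<^sub>m a b \<and> 0\<^sub>m b a = (0\<^sub>m b a :: complex mat) \<and> Y = t \<cdot>\<^sub>m 1\<^sub>m b"
    unfolding h_def scalar_four_block using xs by (subst (asm) four_block_mat_eq_iff) auto
  then show "\<exists>c. X = c \<cdot>\<^sub>m 1\<^sub>m a \<and> Y = c \<cdot>\<^sub>m 1\<^sub>m b \<and> Z = 0\<^sub>m a b" by blast
qed

lemma principal_element_form:
  assumes frob: "frobenius_functional (a + b) (max_parabolic a b) \<phi>"
    and princ: "principal_element (max_parabolic a b) \<phi> h"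
    and ab: "0 < a" "coprime a b"
  obtains c X Y Z where "h = four_block_mat X Z (0\<^sub>m b a) Y"
    "X \<in> carrier_mat a a" "Z \<in> carrier_mat a b" "Y \<in> carrier_mat b b"
    "has_roots X (map (\<lambda>k. c + of_int k) (fst (exponents a b)))"
    "has_roots Y (map (\<lambda>k. c + of_int k) (snd (exponents a b)))"
proof -
  have lin: "linear_functional_on (max_parabolic a b) \<phi>"
    using frob by (simp add: frobenius_functional_def)
  have n: "0 < a + b" using ab by simp
  obtain A B U where cs: "A \<in> carrier_mat a a" "B \<in> carrier_mat b b" "U \<in> carrier_mat b a"
    and tr: "mat_trace A + mat_trace B = 0"
    and \<phi>: "\<And>x. x \<in> max_parabolic a b \<Longrightarrow> \<phi> x = mat_trace (four_block_mat A (0\<^sub>m a b) U B * x)"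
    using functional_as_trace_form[OF lin n] by blast
  have data: "frobenius_data a b A B U" by (rule frobenius_functional_imp_data[OF frob cs \<phi> n])
  have h: "h \<in> parabolic a b" and hx: "\<forall>x\<in>max_parabolic a b. \<phi> (lie_bracket h x) = \<phi> x"
    using princ by (auto simp: principal_element_def max_parabolic_eq)
  obtain X Z Y where hb: "h = four_block_mat X Z (0\<^sub>m b a) Y"
    "X \<in> carrier_mat a a" "Z \<in> carrier_mat a b" "Y \<in> carrier_mat b b"
    using parabolic_cases[OF h] by blast
  have "structure_eqs a b 1 A B U X Y Z"
    using bracket_structure_eqs[OF cs _ hb(2,4,3) \<phi>, of 1] tr hx unfolding hb(1) by simp
  from principal_element_roots[OF data this ab] show ?thesis using hb that by blast
qed

text \<open>The inhomogeneous equations force the trace normalization, because commutators have trace \<open>0\<close>.\<close>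

lemma structure_eqs_trace_zero:
  assumes cs: "A \<in> carrier_mat a a" "B \<in> carrier_mat b b" "U \<in> carrier_mat b a"
    and eqs: "structure_eqs a b 1 A B U X Y Z"
  shows "mat_trace A + mat_trace B = 0"
proof -
  have xs: "X \<in> carrier_mat a a" "Y \<in> carrier_mat b b" "Z \<in> carrier_mat a b"
    and 1: "A * X - X * A - Z * U = 1 \<cdot>\<^sub>m A" and 2: "B * Y - Y * B + U * Z = 1 \<cdot>\<^sub>m B"
    using eqs by (auto simp: structure_eqs_def)
  have p: "A * X \<in> carrier_mat a a" "X * A \<in> carrier_mat a a" "Z * U \<in> carrier_mat a a"
    "B * Y \<in> carrier_mat b b" "Y * B \<in> carrier_mat b b" "U * Z \<in> carrier_mat b b"
    using cs xs by auto
  have "mat_trace (1 \<cdot>\<^sub>m A) = mat_trace (A * X) - mat_trace (X * A) - mat_trace (Z * U)"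
    unfolding 1[symmetric] mat_trace_minus[OF minus_carrier_mat[OF p(2)] p(3)] mat_trace_minus[OF p(1,2)] ..
  moreover have "mat_trace (1 \<cdot>\<^sub>m B) = mat_trace (B * Y) - mat_trace (Y * B) + mat_trace (U * Z)"
    unfolding 2[symmetric] mat_trace_add[OF minus_carrier_mat[OF p(5)] p(6)] mat_trace_minus[OF p(4,5)] ..
  ultimately show ?thesis
    using mat_trace_comm[OF cs(1) xs(1)] mat_trace_comm[OF cs(2) xs(2)] mat_trace_comm[OF cs(3) xs(3)]
    by (simp add: mat_trace_smult[OF cs(1)] mat_trace_smult[OF cs(2)])
qed

theorem frobenius_functional_exists:
  assumes ab: "0 < a" "coprime a b"
  obtains \<phi> h where "frobenius_functional (a + b) (max_parabolic a b) \<phi>"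
    "principal_element (max_parabolic a b) \<phi> h"
proof -
  obtain A B U X Y Z where data: "frobenius_data a b A B U" and eqs: "structure_eqs a b 1 A B U X Y Z"
    using frobenius_data_exists[OF ab] by blast
  have cs: "A \<in> carrier_mat a a" "B \<in> carrier_mat b b" "U \<in> carrier_mat b a"
    using data by (auto simp: frobenius_data_def)
  have xs: "X \<in> carrier_mat a a" "Y \<in> carrier_mat b b" "Z \<in> carrier_mat a b"
    using eqs by (auto simp: structure_eqs_def)
  have n: "0 < a + b" using ab by simp
  define F where "F = four_block_mat A (0\<^sub>m a b) U B"
  define \<phi> where "\<phi> x = mat_trace (F * x)" for x
  have F: "F \<in> carrier_mat (a + b) (a + b)" unfolding F_def using cs by auto
  have \<phi>: "\<phi> x = mat_trace (four_block_mat A (0\<^sub>m a b) U B * x)" for x by (simp add: \<phi>_def F_def)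
  have "linear_functional_on (max_parabolic a b) \<phi>"
    unfolding linear_functional_on_def
  proof (intro conjI ballI allI)
    fix x y assume "x \<in> max_parabolic a b" "y \<in> max_parabolic a b"
    then have c: "x \<in> carrier_mat (a + b) (a + b)" "y \<in> carrier_mat (a + b) (a + b)"
      by (auto intro: max_parabolic_carrier)
    have "F * (x + y) = F * x + F * y" by (rule mult_add_distrib_mat[OF F c])
    then show "\<phi> (x + y) = \<phi> x + \<phi> y"
      unfolding \<phi>_def using mat_trace_add[OF mult_carrier_mat[OF F c(1)] mult_carrier_mat[OF F c(2)]] by simp
  next
    fix c x assume "x \<in> max_parabolic a b"
    then have x: "x \<in> carrier_mat (a + b) (a + b)" by (rule max_parabolic_carrier)
    show "\<phi> (c \<cdot>\<^sub>m x) = c * \<phi> x"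
      unfolding \<phi>_def mult_smult_distrib[OF F x] by (rule mat_trace_smult[OF mult_carrier_mat[OF F x]])
  qed
  moreover have "x = 0\<^sub>m (a + b) (a + b)"
    if x: "x \<in> max_parabolic a b" and x0: "\<forall>y\<in>max_parabolic a b. \<phi> (lie_bracket x y) = 0" for x
  proof -
    have xP: "x \<in> parabolic a b" using x by (simp add: max_parabolic_eq)
    obtain X' Z' Y' where b: "x = four_block_mat X' Z' (0\<^sub>m b a) Y'"
      "X' \<in> carrier_mat a a" "Z' \<in> carrier_mat a b" "Y' \<in> carrier_mat b b"
      using parabolic_cases[OF xP] by blast
    have "structure_eqs a b 0 A B U X' Y' Z'"
      using bracket_structure_eqs[OF cs _ b(2,4,3) \<phi>, of 0] x0 unfolding b(1) by simp
    then obtain c where "X' = c \<cdot>\<^sub>m 1\<^sub>m a" "Y' = c \<cdot>\<^sub>m 1\<^sub>m b" "Z' = 0\<^sub>m a b"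
      using data unfolding frobenius_data_def by blast
    then have xc: "x = c \<cdot>\<^sub>m 1\<^sub>m (a + b)" unfolding b(1) scalar_four_block by simp
    have "c * of_nat (a + b) = mat_trace x"
      unfolding xc mat_trace_smult[OF one_carrier_mat] mat_trace_one ..
    also have "\<dots> = 0" using x by (simp add: max_parabolic_eq)
    finally have "c * of_nat (a + b) = 0" .
    moreover have "of_nat (a + b) \<noteq> (0::complex)" using n by (simp only: of_nat_eq_0_iff)
    ultimately have "c = 0" by (simp only: mult_eq_0_iff) simp
    then show ?thesis unfolding xc by (intro eq_matI) auto
  qed
  ultimately have "frobenius_functional (a + b) (max_parabolic a b) \<phi>"
    unfolding frobenius_functional_def by blast
  moreover
  define h where "h = four_block_mat X Z (0\<^sub>m b a) Y"
  define t where "t = mat_trace h / of_nat (a + b)"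
  have h: "h \<in> parabolic a b" unfolding h_def using xs by (intro parabolic_four_block)
  have "\<phi> (lie_bracket h x) = 1 * \<phi> x" if "x \<in> max_parabolic a b" for x
    using bracket_structure_eqs[OF cs _ xs \<phi>, of 1] structure_eqs_trace_zero[OF cs eqs] eqs that
    unfolding h_def by blast
  then have "principal_element (max_parabolic a b) \<phi> (h - t \<cdot>\<^sub>m 1\<^sub>m (a + b))"
    unfolding principal_element_def t_def
    using traceless_part[OF h n] lie_bracket_scalar_shift[OF parabolic_carrier[OF h] max_parabolic_carrier]
    by simp
  ultimately show ?thesis by (rule that)
qed

section \<open>Bases of the parabolic\<close>

lemma vectorspace_max_parabolic:
  "vectorspace class_ring (mat_subspace (a + b) (max_parabolic a b))"
proof -
  interpret V: vectorspace "class_ring :: complex ring" "module_mat TYPE(complex) (a + b) (a + b)"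
    by (rule matrix_vs)
  have "submodule class_ring (max_parabolic a b) (module_mat TYPE(complex) (a + b) (a + b))"
    using V.module_axioms
    by (auto simp: submodule_def module_mat_simps max_parabolic_carrier max_parabolic_zero
        max_parabolic_add max_parabolic_smult)
  then have "VectorSpace.subspace class_ring (max_parabolic a b) (module_mat TYPE(complex) (a + b) (a + b))"
    using V.vectorspace_axioms by (simp add: VectorSpace.subspace_def)
  then show ?thesis by (rule V.subspace_is_vs)
qed

lemma lincomb_max_parabolic:
  assumes "finite S" "S \<subseteq> max_parabolic a b"
  shows "module.lincomb (mat_subspace (a + b) (max_parabolic a b)) c S = lin_comb (a + b) S (\<lambda>v. v) c"
proof -
  let ?V = "mat_subspace (a + b) (max_parabolic a b)"
  interpret V: vectorspace "class_ring :: complex ring" ?V by (rule vectorspace_max_parabolic)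
  show ?thesis
    using assms
  proof (induction S rule: finite_induct)
    case empty
    show ?case by (simp add: V.lincomb_def lin_comb_empty module_mat_simps)
  next
    case (insert v S)
    have "V.lincomb c (insert v S) = (c v \<odot>\<^bsub>?V\<^esub> v) \<oplus>\<^bsub>?V\<^esub> V.lincomb c S"
      unfolding V.lincomb_def using insert.prems insert.hyps
      by (intro V.M.finsum_insert) (auto simp: module_mat_simps max_parabolic_smult)
    then show ?case
      using insert by (simp add: module_mat_simps lin_comb_insert max_parabolic_carrier)
  qed
qed

lemma lin_comb_list:
  assumes "distinct bs"
  shows "lin_comb n (set bs) (\<lambda>v. v) c = lin_comb n {..<length bs} (\<lambda>i. bs ! i) (\<lambda>i. c (bs ! i))"
proof -
  have "(\<Sum>v\<in>set bs. f v) = (\<Sum>i<length bs. f (bs ! i))" for f :: "complex mat \<Rightarrow> complex"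
    using sum.reindex_bij_betw[OF bij_betw_nth[OF assms refl refl], of f] by (simp add: lessThan_def)
  then show ?thesis by (simp add: lin_comb_def)
qed

lemma ordered_basis_max_parabolicD:
  assumes "ordered_basis (a + b) (max_parabolic a b) bs"
  shows "\<And>i. i < length bs \<Longrightarrow> bs ! i \<in> max_parabolic a b"
    and "\<And>x. x \<in> max_parabolic a b \<Longrightarrow> \<exists>c. x = lin_comb (a + b) {..<length bs} (\<lambda>i. bs ! i) c"
    and "\<And>c i. lin_comb (a + b) {..<length bs} (\<lambda>i. bs ! i) c = 0\<^sub>m (a + b) (a + b) \<Longrightarrow> i < length bs \<Longrightarrow> c i = 0"
proof -
  let ?V = "mat_subspace (a + b) (max_parabolic a b)"
  interpret V: vectorspace "class_ring :: complex ring" ?V by (rule vectorspace_max_parabolic)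
  have d: "distinct bs" and "V.basis (set bs)" using assms by (auto simp: ordered_basis_def)
  then have indep: "V.lin_indpt (set bs)" and gen: "V.span (set bs) = max_parabolic a b"
    and sub: "set bs \<subseteq> max_parabolic a b"
    unfolding V.basis_def by (auto simp: module_mat_simps)
  show "\<And>i. i < length bs \<Longrightarrow> bs ! i \<in> max_parabolic a b" using sub by auto
  show "\<exists>c. x = lin_comb (a + b) {..<length bs} (\<lambda>i. bs ! i) c" if x: "x \<in> max_parabolic a b" for x
  proof -
    have "V.span (set bs) = {V.lincomb c (set bs) | c. c \<in> set bs \<rightarrow> carrier class_ring}"
      using sub by (intro V.finite_span) auto
    with x have "x \<in> {V.lincomb c (set bs) | c. c \<in> set bs \<rightarrow> carrier class_ring}"
      by (simp only: gen)
    then obtain c where "x = V.lincomb c (set bs)" by blast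
    also have "\<dots> = lin_comb (a + b) {..<length bs} (\<lambda>i. bs ! i) (\<lambda>i. c (bs ! i))"
      by (simp only: lincomb_max_parabolic[OF finite_set sub] lin_comb_list[OF d])
    finally show ?thesis by blast
  qed
  show "c i = 0" if 0: "lin_comb (a + b) {..<length bs} (\<lambda>i. bs ! i) c = 0\<^sub>m (a + b) (a + b)" and i: "i < length bs" for c i
  proof (rule ccontr)
    assume ci: "c i \<noteq> 0"
    define pos where "pos = the_inv_into {..<length bs} (\<lambda>i. bs ! i)"
    have pos: "pos (bs ! k) = k" if "k < length bs" for k
      unfolding pos_def using that d by (intro the_inv_into_f_f) (auto simp: inj_on_nth)
    have "V.lincomb (c \<circ> pos) (set bs) = lin_comb (a + b) {..<length bs} (\<lambda>i. bs ! i) (\<lambda>i. (c \<circ> pos) (bs ! i))"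
      using lincomb_max_parabolic[OF _ sub] lin_comb_list[OF d] by simp
    also have "\<dots> = lin_comb (a + b) {..<length bs} (\<lambda>i. bs ! i) c"
      using pos by (auto simp: lin_comb_def intro!: eq_matI sum.cong)
    finally have "V.lincomb (c \<circ> pos) (set bs) = \<zero>\<^bsub>?V\<^esub>" using 0 by (simp add: module_mat_simps)
    moreover have "(c \<circ> pos) (bs ! i) \<noteq> \<zero>\<^bsub>class_ring\<^esub>" using ci pos i by (simp add: class_ring_simps)
    ultimately have "V.lin_dep (set bs)"
      unfolding V.lin_dep_def using i
      by (intro exI[of _ "set bs"] exI[of _ "c \<circ> pos"] exI[of _ "bs ! i"]) (auto simp: class_ring_simps)
    then show False using indep by blast
  qed
qed

lemma ordered_basis_max_parabolic_exists:
  assumes n: "0 < a + b"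
  shows "\<exists>bs. ordered_basis (a + b) (max_parabolic a b) bs"
proof -
  let ?V = "mat_subspace (a + b) (max_parabolic a b)"
  let ?S = "traceless_unit (a + b) ` allowed_pairs a (a + b)"
  interpret V: vectorspace "class_ring :: complex ring" ?V by (rule vectorspace_max_parabolic)
  have S: "?S \<subseteq> max_parabolic a b" using traceless_unit_in by auto
  have e: "V.span ?S \<subseteq> max_parabolic a b" using V.span_is_subset2[of ?S] S by (simp add: module_mat_simps)
  have lin_comb_in: "lin_comb (a + b) I (traceless_unit (a + b)) c \<in> V.span ?S"
    if "finite I" "I \<subseteq> allowed_pairs a (a + b)" for I c
    using that
  proof (induction I rule: finite_induct)
    case empty
    have "\<zero>\<^bsub>?V\<^esub> \<in> V.span ?S"
      using V.span_is_submodule[of ?S] S unfolding submodule_def by (auto simp: module_mat_simps)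
    then show ?case by (simp add: lin_comb_empty module_mat_simps)
  next
    case (insert i I)
    have sm: "submodule class_ring (V.span ?S) ?V"
      using V.span_is_submodule[of ?S] S by (auto simp: module_mat_simps)
    have "traceless_unit (a + b) i \<in> V.span ?S"
      using V.in_own_span[of ?S] S insert.prems by (auto simp: module_mat_simps)
    then have "c i \<cdot>\<^sub>m traceless_unit (a + b) i \<in> V.span ?S"
      using sm unfolding submodule_def by (auto simp: module_mat_simps class_ring_simps)
    then have "c i \<cdot>\<^sub>m traceless_unit (a + b) i + lin_comb (a + b) I (traceless_unit (a + b)) c \<in> V.span ?S"
      using sm insert unfolding submodule_def by (auto simp: module_mat_simps)
    then show ?case
      using insert by (subst lin_comb_insert) (auto intro!: max_parabolic_carrier traceless_unit_in)
  qed
  have "max_parabolic a b \<subseteq> V.span ?S"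
  proof
    fix x assume x: "x \<in> max_parabolic a b"
    show "x \<in> V.span ?S"
      by (subst lin_comb_traceless_unit[OF x n]) (rule lin_comb_in[OF finite_allowed_pairs order.refl])
  qed
  then have "V.fin_dim"
    unfolding V.fin_dim_def using e S by (intro exI[of _ ?S]) (auto simp: module_mat_simps)
  then obtain B where B: "finite B" "V.basis B" using V.finite_basis_exists by blast
  then obtain bs where "set bs = B" "distinct bs" using finite_distinct_list by blast
  then show ?thesis using B by (auto simp: ordered_basis_def)
qed

lemma represents_exists:
  assumes basis: "ordered_basis (a + b) (max_parabolic a b) bs"
    and T: "\<And>x. x \<in> max_parabolic a b \<Longrightarrow> T x \<in> max_parabolic a b"
  shows "\<exists>A. represents (a + b) bs T A"
proof -
  note D = ordered_basis_max_parabolicD[OF basis]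
  have "\<exists>c. T (bs ! j) = lin_comb (a + b) {..<length bs} (\<lambda>i. bs ! i) c" if "j < length bs" for j
    using D(1,2) T that by blast
  then obtain c where c: "\<And>j. j < length bs \<Longrightarrow> T (bs ! j) = lin_comb (a + b) {..<length bs} (\<lambda>i. bs ! i) (c j)"
    by metis
  then show ?thesis
    by (intro exI[of _ "mat (length bs) (length bs) (\<lambda>(i, j). c j i)"])
       (auto simp: represents_def lin_comb_def intro!: eq_matI sum.cong)
qed

section \<open>The characteristic polynomial of the adjoint map\<close>

lemma lin_comb_upper_list:
  "lin_comb n {..<length (bs @ [x])} (\<lambda>i. (bs @ [x]) ! i) c =
     lin_comb n {..<length bs} (\<lambda>i. bs ! i) c + c (length bs) \<cdot>\<^sub>m x"
  if "x \<in> carrier_mat n n"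
  using that by (auto simp: lin_comb_def nth_append intro!: eq_matI)

lemma lin_comb_conj:
  assumes gh: "gi \<in> carrier_mat n n" "g \<in> carrier_mat n n"
    and I: "finite I" "\<And>i. i \<in> I \<Longrightarrow> v i \<in> carrier_mat n n"
  shows "gi * lin_comb n I v c * g = lin_comb n I (\<lambda>i. gi * v i * g) c"
  using I
proof (induction I rule: finite_induct)
  case empty
  then show ?case using gh by (simp add: lin_comb_empty)
next
  case (insert i I)
  have vi: "v i \<in> carrier_mat n n" using insert by auto
  have "gi * (c i \<cdot>\<^sub>m v i + lin_comb n I v c) = c i \<cdot>\<^sub>m (gi * v i) + gi * lin_comb n I v c"
    using gh vi by (simp add: mult_add_distrib_mat[of gi n n _ n] mult_smult_distrib[of gi n n _ n])
  also have "\<dots> * g = (c i \<cdot>\<^sub>m (gi * v i)) * g + gi * lin_comb n I v c * g"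
    using gh vi by (intro add_mult_distrib_mat[of _ n n _ _ n]) auto
  also have "(c i \<cdot>\<^sub>m (gi * v i)) * g = c i \<cdot>\<^sub>m (gi * v i * g)"
    using gh vi by (intro mult_smult_assoc_mat[of _ n n _ n]) auto
  finally have 1: "gi * (c i \<cdot>\<^sub>m v i + lin_comb n I v c) * g =
      c i \<cdot>\<^sub>m (gi * v i * g) + lin_comb n I (\<lambda>i. gi * v i * g) c"
    using insert by simp
  have "gi * v i * g \<in> carrier_mat n n" using gh vi by auto
  from lin_comb_insert[where v = "\<lambda>i. gi * v i * g", OF insert.hyps this] lin_comb_insert[where v = v, OF insert.hyps vi] 1
  show ?case by (simp only:)
qed

lemma lie_bracket_conj:
  assumes "h \<in> carrier_mat n n" "x \<in> carrier_mat n n" "g \<in> carrier_mat n n" "gi \<in> carrier_mat n n"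
    and g: "g * gi = 1\<^sub>m n"
  shows "gi * lie_bracket h x * g = lie_bracket (gi * h * g) (gi * x * g :: complex mat)"
proof -
  have m: "(gi * p * g) * (gi * q * g) = gi * (p * q) * g"
    if "p \<in> carrier_mat n n" "q \<in> carrier_mat n n" for p q
  proof -
    have "(gi * p * g) * (gi * q * g) = (gi * p * g) * (gi * (q * g))"
      using assms that by (simp add: assoc_mult_mat[of _ n n _ n _ n])
    also have "\<dots> = (gi * p) * (q * g)"
      using assms that by (intro mult_conj_mat[of gi n g _ n _ n]) auto
    finally show ?thesis using assms that by (simp add: assoc_mult_mat[of _ n n _ n _ n])
  qed
  have c: "h * x \<in> carrier_mat n n" "x * h \<in> carrier_mat n n" using assms by auto
  have "gi * (h * x - x * h) = gi * (h * x) - gi * (x * h)"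
    by (rule mult_minus_distrib_mat[OF assms(4) c])
  also have "\<dots> * g = gi * (h * x) * g - gi * (x * h) * g"
    using assms c by (intro minus_mult_distrib_mat[of _ n n _ _ n]) auto
  finally show ?thesis unfolding lie_bracket_def m[OF assms(1,2)] m[OF assms(2,1)] .
qed

text \<open>The positions outside the lower left block, in an order in which commutation with an upper triangular
  matrix is upper triangular: rows downwards, and each row from right to left.\<close>

definition position_list :: "nat \<Rightarrow> nat \<Rightarrow> (nat \<times> nat) list" where
  "position_list a n = concat (map (\<lambda>i. map (Pair i) (filter (allowed a i) (rev [0..<n]))) [0..<n])"

lemma set_position_list: "set (position_list a n) = allowed_pairs a n"
  by (auto simp: position_list_def allowed_pairs_def)

lemma sorted_position_list:
  "sorted_wrt (\<lambda>(i, j) (i', j'). i < i' \<or> i = i' \<and> j' < j) (position_list a n)" (is "sorted_wrt ?R _")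
proof -
  have row: "sorted_wrt ?R (map (Pair i) (filter (allowed a i) (rev [0..<n])))" for i
    by (simp add: sorted_wrt_map sorted_wrt_filter sorted_wrt_rev)
  have "sorted_wrt ?R (concat (map (\<lambda>i. map (Pair i) (filter (allowed a i) (rev [0..<n]))) [0..<m]))" for m
    by (induction m) (use row in \<open>auto simp: sorted_wrt_append\<close>)
  then show ?thesis by (simp add: position_list_def)
qed

lemma distinct_position_list: "distinct (position_list a n)"
proof -
  have less: "position_list a n ! I \<noteq> position_list a n ! J" if "I < J" "J < length (position_list a n)" for I J
    using sorted_wrt_nth_less[OF sorted_position_list that] by auto
  show ?thesis
    unfolding distinct_conv_nth
  proof (intro allI impI)
    fix I J assume "I < length (position_list a n)" "J < length (position_list a n)" "I \<noteq> J"
    then show "position_list a n ! I \<noteq> position_list a n ! J"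
      using less[of I J] less[of J I] by (cases "I < J") auto
  qed
qed

lemma sum_position_list:
  "(\<Sum>J<length (position_list a n). f (position_list a n ! J)) = (\<Sum>ij\<in>allowed_pairs a n. f ij)"
  using sum.reindex_bij_betw[OF bij_betw_nth[OF distinct_position_list refl set_position_list[symmetric]], of f]
  by simp

text \<open>The matrix of \<open>y \<mapsto> T y - y T\<close> on block upper triangular matrices, in terms of the matrix units.\<close>

definition ad_mat :: "nat \<Rightarrow> nat \<Rightarrow> complex mat \<Rightarrow> complex mat" where
  "ad_mat a n T = (let ps = position_list a n in mat (length ps) (length ps) (\<lambda>(I, J).
     case (ps ! I, ps ! J) of ((i, j), (i', j')) \<Rightarrow>
       (if j = j' then T $$ (i, i') else 0) - (if i = i' then T $$ (j', j) else 0)))"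

lemma ad_mat_carrier: "ad_mat a n T \<in> carrier_mat (length (position_list a n)) (length (position_list a n))"
  by (simp add: ad_mat_def Let_def)

lemma ad_mat_bracket:
  assumes T: "T \<in> carrier_mat (a + b) (a + b)" and y: "y \<in> parabolic a b"
    and I: "I < length (position_list a (a + b))"
  shows "lie_bracket T y $$ (position_list a (a + b) ! I) =
    (\<Sum>J<length (position_list a (a + b)). ad_mat a (a + b) T $$ (I, J) * y $$ (position_list a (a + b) ! J))"
proof -
  let ?n = "a + b" and ?ps = "position_list a (a + b)"
  obtain i j where ij: "?ps ! I = (i, j)" by fastforce
  then have b: "i < ?n" "j < ?n"
    using nth_mem[OF I] by (auto simp: set_position_list allowed_pairs_def)
  define f where "f i' j' = ((if j = j' then T $$ (i, i') else 0) - (if i = i' then T $$ (j', j) else 0)) * y $$ (i', j')"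
    for i' j'
  note yc = parabolic_carrier[OF y]
  have "(\<Sum>J<length ?ps. ad_mat a ?n T $$ (I, J) * y $$ (?ps ! J)) = (\<Sum>J<length ?ps. case_prod f (?ps ! J))"
    using I by (intro sum.cong refl) (auto simp: ad_mat_def Let_def ij f_def split: prod.splits)
  also have "\<dots> = (\<Sum>(i', j')\<in>allowed_pairs a ?n. f i' j')" by (rule sum_position_list)
  also have "\<dots> = (\<Sum>i'<?n. \<Sum>j'<?n. f i' j')"
    using y by (intro sum_allowed_pairs[symmetric]) (auto simp: f_def parabolic_def)
  also have "\<dots> = (\<Sum>i'<?n. \<Sum>j'<?n. (if j = j' then T $$ (i, i') * y $$ (i', j') else 0)
      - (if i = i' then T $$ (j', j) * y $$ (i', j') else 0))"
    by (intro sum.cong refl) (auto simp: f_def algebra_simps)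
  also have "\<dots> = (\<Sum>i'<?n. \<Sum>j'<?n. if j = j' then T $$ (i, i') * y $$ (i', j') else 0)
      - (\<Sum>i'<?n. \<Sum>j'<?n. if i = i' then T $$ (j', j) * y $$ (i', j') else 0)"
    by (simp only: sum_subtractf)
  also have "(\<Sum>i'<?n. \<Sum>j'<?n. if j = j' then T $$ (i, i') * y $$ (i', j') else 0) = (T * y) $$ (i, j)"
    using T yc b by (simp add: scalar_prod_def atLeast0LessThan)
  also have "(\<Sum>i'<?n. \<Sum>j'<?n. if i = i' then T $$ (j', j) * y $$ (i', j') else 0) = (y * T) $$ (i, j)"
    using T yc b by (subst sum.swap) (simp add: scalar_prod_def atLeast0LessThan mult.commute)
  finally show ?thesis unfolding lie_bracket_def ij using T yc b by simp
qed

lemma char_poly_ad_mat: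
  assumes T: "T \<in> carrier_mat n n" and tri: "upper_triangular T"
  shows "char_poly (ad_mat a n T) = (\<Prod>(i, j)\<leftarrow>position_list a n. [:- (T $$ (i, i) - T $$ (j, j)), 1:])"
proof -
  let ?ps = "position_list a n"
  have "upper_triangular (ad_mat a n T)"
  proof (rule upper_triangularI)
    fix J I assume JI: "J < I" and "I < dim_row (ad_mat a n T)"
    then have I: "I < length ?ps" using ad_mat_carrier[of a n T] by simp
    obtain i j where ij: "?ps ! I = (i, j)" by fastforce
    obtain i' j' where ij': "?ps ! J = (i', j')" by fastforce
    have "i < n" "j' < n"
      using nth_mem[OF I] nth_mem[of J ?ps] JI I ij ij' by (auto simp: set_position_list allowed_pairs_def)
    moreover have "i' < i \<or> i' = i \<and> j < j'"
      using sorted_wrt_nth_less[OF sorted_position_list JI I] by (simp add: ij ij')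
    ultimately show "ad_mat a n T $$ (I, J) = 0"
      using upper_triangularD[OF tri] T I JI by (auto simp: ad_mat_def Let_def ij ij')
  qed
  from char_poly_upper_triangular[OF ad_mat_carrier this]
  have "char_poly (ad_mat a n T) = (\<Prod>e\<leftarrow>diag_mat (ad_mat a n T). [:- e, 1:])" .
  also have "diag_mat (ad_mat a n T) = map (\<lambda>(i, j). T $$ (i, i) - T $$ (j, j)) ?ps"
    by (intro nth_equalityI) (auto simp: diag_mat_def ad_mat_def Let_def split: prod.splits)
  finally show ?thesis by (simp add: o_def case_prod_beta')
qed

lemma triangularize_parabolic:
  assumes X: "X \<in> carrier_mat a a" and Z: "Z \<in> carrier_mat a b" and Y: "Y \<in> carrier_mat b b"
    and roots: "has_roots X xs" "has_roots Y ys"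
  obtains g gi where "g \<in> parabolic a b" "gi \<in> parabolic a b" "g * gi = 1\<^sub>m (a + b)" "gi * g = 1\<^sub>m (a + b)"
    "upper_triangular (gi * four_block_mat X Z (0\<^sub>m b a) Y * g)"
    "diag_mat (gi * four_block_mat X Z (0\<^sub>m b a) Y * g) = xs @ ys"
proof -
  obtain T1 P1 Q1 where "schur_decomposition X xs = (T1, P1, Q1)" by (cases "schur_decomposition X xs")
  with schur_decomposition[OF X _ this] roots(1)
  have 1: "similar_mat_wit X T1 P1 Q1" "upper_triangular T1" "diag_mat T1 = xs" by (auto simp: has_roots_def)
  obtain T2 P2 Q2 where "schur_decomposition Y ys = (T2, P2, Q2)" by (cases "schur_decomposition Y ys")
  with schur_decomposition[OF Y _ this] roots(2)
  have 2: "similar_mat_wit Y T2 P2 Q2" "upper_triangular T2" "diag_mat T2 = ys" by (auto simp: has_roots_def)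
  note w1 = similar_mat_witD2[OF X 1(1)] and w2 = similar_mat_witD2[OF Y 2(1)]
  have one: "four_block_mat (1\<^sub>m a) (0\<^sub>m a b) (0\<^sub>m b a) (1\<^sub>m b) = (1\<^sub>m (a + b) :: complex mat)"
    by (intro eq_matI) auto
  define g where "g = four_block_mat P1 (0\<^sub>m a b) (0\<^sub>m b a) P2"
  define gi where "gi = four_block_mat Q1 (0\<^sub>m a b) (0\<^sub>m b a) Q2"
  have "g \<in> parabolic a b" "gi \<in> parabolic a b"
    unfolding g_def gi_def using w1 w2 by (auto intro!: parabolic_four_block)
  moreover have "g * gi = 1\<^sub>m (a + b)" "gi * g = 1\<^sub>m (a + b)"
    unfolding g_def gi_def using w1 w2 by (simp_all add: mult_block_triangular[of _ a _ b] one)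
  moreover have t: "gi * four_block_mat X Z (0\<^sub>m b a) Y * g = four_block_mat T1 (Q1 * Z * P2) (0\<^sub>m b a) T2"
  proof -
    have "gi * four_block_mat X Z (0\<^sub>m b a) Y = four_block_mat (Q1 * X) (Q1 * Z) (0\<^sub>m b a) (Q2 * Y)"
      unfolding gi_def using w1 w2 X Y Z by (subst mult_block_triangular) auto
    also have "\<dots> * g = four_block_mat (Q1 * X * P1) (Q1 * Z * P2) (0\<^sub>m b a) (Q2 * Y * P2)"
      unfolding g_def using w1 w2 X Y Z by (subst mult_block_triangular) auto
    also have "Q1 * X * P1 = T1"
      using similar_mat_witD2(3)[OF w1(5) similar_mat_wit_sym[OF 1(1)]] by simp
    also have "Q2 * Y * P2 = T2"
      using similar_mat_witD2(3)[OF w2(5) similar_mat_wit_sym[OF 2(1)]] by simp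
    finally show ?thesis .
  qed
  moreover have "upper_triangular (four_block_mat T1 (Q1 * Z * P2) (0\<^sub>m b a) T2)"
    using w1 w2 1 2 by (intro upper_triangular_four_block) auto
  moreover have "diag_mat (four_block_mat T1 (Q1 * Z * P2) (0\<^sub>m b a) T2) = xs @ ys"
    using w1 w2 1 2 by (subst diag_four_block_mat) auto
  ultimately show ?thesis using that by simp
qed

lemma char_poly_zero_1: "char_poly (0\<^sub>m 1 1 :: complex mat) = [:0, 1:]"
proof -
  have "char_poly (0\<^sub>m 1 1 :: complex mat) = (\<Prod>e\<leftarrow>diag_mat (0\<^sub>m 1 1 :: complex mat). [:- e, 1:])"
    by (intro char_poly_upper_triangular[of _ 1]) auto
  also have "diag_mat (0\<^sub>m 1 1 :: complex mat) = [0]" by (simp add: diag_mat_def)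
  finally show ?thesis by simp
qed

lemma lie_bracket_one: "h \<in> carrier_mat n n \<Longrightarrow> lie_bracket h (1\<^sub>m n) = (0\<^sub>m n n :: complex mat)"
  by (simp add: lie_bracket_def)

text \<open>\<open>S\<close> has a right inverse and no kernel, so it is invertible; comparing the traces of \<open>R S\<close> and \<open>S R\<close>
  shows that it is square.\<close>

lemma similar_of_intertwining:
  fixes A E S R :: "complex mat"
  assumes A: "A \<in> carrier_mat m m" and E: "E \<in> carrier_mat k k"
    and S: "S \<in> carrier_mat k m" and R: "R \<in> carrier_mat m k"
    and SA: "S * A = E * S" and SR: "S * R = 1\<^sub>m k"
    and inj: "\<And>v. v \<in> carrier_vec m \<Longrightarrow> S *\<^sub>v v = 0\<^sub>v k \<Longrightarrow> v = 0\<^sub>v m"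
  shows "char_poly A = char_poly E"
proof -
  have RS_c: "R * S \<in> carrier_mat m m" using R S by simp
  have "S * (R * S) = S" using assoc_mult_mat[OF S R S] SR S by simp
  then have 0: "S * (R * S - 1\<^sub>m m) = 0\<^sub>m k m"
    using mult_minus_distrib_mat[OF S RS_c one_carrier_mat] S by simp
  have "R * S - 1\<^sub>m m = 0\<^sub>m m m"
  proof (rule mat_col_eqI)
    fix j assume "j < dim_col (0\<^sub>m m m :: complex mat)"
    then have j: "j < m" by simp
    have "S *\<^sub>v col (R * S - 1\<^sub>m m) j = col (S * (R * S - 1\<^sub>m m)) j"
      using S R j by (intro col_mult2[symmetric, of _ k m _ m]) (auto intro: minus_carrier_mat)
    also have "\<dots> = 0\<^sub>v k" unfolding 0 using j by simp
    finally have "col (R * S - 1\<^sub>m m) j = 0\<^sub>v m"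
      by (intro inj) (auto simp: carrier_vecI)
    then show "col (R * S - 1\<^sub>m m) j = col (0\<^sub>m m m) j" using j by simp
  qed auto
  then have RS: "R * S = 1\<^sub>m m" using mat_minus_eq_zero_iff[OF RS_c one_carrier_mat] by simp
  have "of_nat m = mat_trace (R * S)" unfolding RS mat_trace_one ..
  also have "\<dots> = mat_trace (S * R)" by (rule mat_trace_comm[OF R S])
  also have "\<dots> = of_nat k" unfolding SR mat_trace_one ..
  finally have mk: "m = k" by simp
  have "R * E * S = R * (S * A)" unfolding SA using assoc_mult_mat[OF R E S] by simp
  also have "\<dots> = A" using assoc_mult_mat[OF R S A] RS A by simp
  finally have "A = R * E * S" by simp
  then have "similar_mat_wit A E R S"
    using A E S R RS SR unfolding mk by (intro similar_mat_witI[of _ _ k]) auto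
  then show ?thesis by (intro char_poly_similar) (auto simp: similar_mat_def)
qed

text \<open>A basis of \<open>W(a, b)\<close> together with the identity matrix, on which \<open>ad h\<close> vanishes, is a basis of the
  block upper triangular matrices. The matrix \<open>S\<close> of its coordinates with respect to the conjugated
  matrix units \<open>g E g\<^sup>-\<^sup>1\<close> intertwines the two matrices of \<open>ad h\<close>.\<close>

theorem char_poly_ad_parabolic:
  assumes n: "0 < a + b"
    and basis: "ordered_basis (a + b) (max_parabolic a b) bs"
    and h: "h \<in> parabolic a b"
    and rep: "represents (a + b) bs (lie_bracket h) A"
    and g: "g \<in> parabolic a b" "gi \<in> parabolic a b" "g * gi = 1\<^sub>m (a + b)" "gi * g = 1\<^sub>m (a + b)"
  shows "char_poly A * [:0, 1:] = char_poly (ad_mat a (a + b) (gi * h * g))"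
proof -
  let ?n = "a + b" and ?ps = "position_list a (a + b)"
  let ?m = "length bs" and ?K = "length (position_list a (a + b))"
  define bs' where "bs' = bs @ [1\<^sub>m ?n]"
  let ?M = "length bs'"
  have M: "?M = ?m + 1" by (simp add: bs'_def)
  note D = ordered_basis_max_parabolicD[OF basis]
  note gc = parabolic_carrier[OF g(1)] and gic = parabolic_carrier[OF g(2)] and hc = parabolic_carrier[OF h]
  have A: "A \<in> carrier_mat ?m ?m" using rep by (simp add: represents_def)
  have bs'P: "bs' ! i \<in> parabolic a b" if "i < ?M" for i
    using that D(1)[of i] parabolic_one by (auto simp: bs'_def nth_append max_parabolic_eq)
  then have bs'c: "bs' ! i \<in> carrier_mat ?n ?n" if "i < ?M" for i using that parabolic_carrier by blast
  have split: "lin_comb ?n {..<?M} (\<lambda>i. bs' ! i) c = lin_comb ?n {..<?m} (\<lambda>i. bs ! i) c + c ?m \<cdot>\<^sub>m 1\<^sub>m ?n" for c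
    unfolding bs'_def by (rule lin_comb_upper_list) simp
  \<comment> \<open>The additional row and column belong to the identity matrix.\<close>
  define A' where "A' = four_block_mat A (0\<^sub>m ?m 1) (0\<^sub>m 1 ?m) (0\<^sub>m 1 1)"
  have A': "A' \<in> carrier_mat ?M ?M" unfolding A'_def M using A by auto
  have cpA': "char_poly A' = char_poly A * [:0, 1:]"
    unfolding A'_def char_poly_zero_1[symmetric]
    using has_roots_exists[OF A] has_roots_exists[of "0\<^sub>m 1 1" 1] A
    by (intro char_poly_0_block[OF refl]) (auto simp: has_roots_def)
  have A'_entries: "A' $$ (I, J) = (if I < ?m \<and> J < ?m then A $$ (I, J) else 0)" if "I < ?M" "J < ?M" for I J
    using that A unfolding A'_def M by (auto simp: less_Suc_eq)
  have rep': "lie_bracket h (bs' ! J) = lin_comb ?n {..<?M} (\<lambda>i. bs' ! i) (\<lambda>i. A' $$ (i, J))" if J: "J < ?M" for J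
  proof (cases "J < ?m")
    case True
    have "lie_bracket h (bs ! J) = lin_comb ?n {..<?m} (\<lambda>i. bs ! i) (\<lambda>i. A $$ (i, J))"
      using rep True by (auto simp: represents_def lin_comb_def)
    also have "\<dots> = lin_comb ?n {..<?m} (\<lambda>i. bs ! i) (\<lambda>i. A' $$ (i, J))"
      using A'_entries J True M by (auto simp: lin_comb_def intro!: eq_matI sum.cong)
    finally show ?thesis
      unfolding split using True A'_entries[of ?m J] J M by (auto simp: bs'_def nth_append intro!: eq_matI)
  next
    case False
    then have "J = ?m" using J M by simp
    then have "lie_bracket h (bs' ! J) = 0\<^sub>m ?n ?n" using lie_bracket_one[OF hc] by (simp add: bs'_def)
    also have "\<dots> = lin_comb ?n {..<?M} (\<lambda>i. bs' ! i) (\<lambda>i. A' $$ (i, J))"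
      using False A'_entries J by (auto simp: lin_comb_def intro!: eq_matI)
    finally show ?thesis .
  qed
  have cancel: "g * (gi * x * g) * gi = x" "gi * (g * x * gi) * g = x" if "x \<in> carrier_mat ?n ?n" for x
  proof -
    have "p * (q * x * p) * q = x" if "p \<in> carrier_mat ?n ?n" "q \<in> carrier_mat ?n ?n" "p * q = 1\<^sub>m ?n" for p q
    proof -
      have "p * (q * x * p) * q = p * ((q * x) * (p * q))"
        using that \<open>x \<in> carrier_mat ?n ?n\<close> by (simp add: assoc_mult_mat[of _ ?n ?n _ ?n _ ?n])
      also have "\<dots> = (p * q) * x"
        using that \<open>x \<in> carrier_mat ?n ?n\<close> assoc_mult_mat[OF that(1,2), of x ?n] by simp
      finally show ?thesis using that \<open>x \<in> carrier_mat ?n ?n\<close> by simp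
    qed
    from this[OF gc gic g(3)] this[OF gic gc g(4)]
    show "g * (gi * x * g) * gi = x" "gi * (g * x * gi) * g = x" .
  qed
  define y where "y J = gi * (bs' ! J) * g" for J
  have y: "y J \<in> parabolic a b" if "J < ?M" for J
    unfolding y_def using that bs'P g by (intro parabolic_mult)
  have conj: "gi * lin_comb ?n {..<?M} (\<lambda>i. bs' ! i) c * g = lin_comb ?n {..<?M} y c" for c
    unfolding y_def[abs_def] using bs'c by (intro lin_comb_conj gic gc) auto
  define T where "T = gi * h * g"
  have T: "T \<in> carrier_mat ?n ?n" unfolding T_def using gc gic hc by auto
  define S where "S = mat ?K ?M (\<lambda>(I, J). y J $$ (?ps ! I))"
  have S: "S \<in> carrier_mat ?K ?M" by (simp add: S_def)
  have pos: "fst (?ps ! I) < ?n \<and> snd (?ps ! I) < ?n" if "I < ?K" for I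
    using nth_mem[OF that] by (auto simp: set_position_list allowed_pairs_def)
  \<comment> \<open>\<open>S\<close> computes the coordinates of linear combinations of the basis.\<close>
  have coords: "(\<Sum>L<?M. S $$ (I, L) * c L) = (gi * lin_comb ?n {..<?M} (\<lambda>i. bs' ! i) c * g) $$ (?ps ! I)"
    if "I < ?K" for I c
    unfolding conj using pos[OF that] that
    by (cases "?ps ! I") (auto simp: lin_comb_def S_def mult.commute intro!: sum.cong)
  have SA: "S * A' = ad_mat a ?n T * S"
  proof (rule eq_matI)
    fix I J assume "I < dim_row (ad_mat a ?n T * S)" "J < dim_col (ad_mat a ?n T * S)"
    then have I: "I < ?K" and J: "J < ?M" using ad_mat_carrier[of a ?n T] S by auto
    have "(S * A') $$ (I, J) = (\<Sum>L<?M. S $$ (I, L) * A' $$ (L, J))"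
      using S A' I J by (simp add: scalar_prod_def atLeast0LessThan)
    also have "\<dots> = (gi * lie_bracket h (bs' ! J) * g) $$ (?ps ! I)"
      unfolding rep'[OF J] by (rule coords[OF I])
    also have "\<dots> = lie_bracket T (y J) $$ (?ps ! I)"
      unfolding T_def y_def lie_bracket_conj[OF hc bs'c[OF J] gc gic g(3)] ..
    also have "\<dots> = (\<Sum>L<?K. ad_mat a ?n T $$ (I, L) * y J $$ (?ps ! L))"
      by (rule ad_mat_bracket[OF T y[OF J] I])
    also have "\<dots> = (ad_mat a ?n T * S) $$ (I, J)"
      using S ad_mat_carrier[of a ?n T] I J by (simp add: scalar_prod_def atLeast0LessThan S_def)
    finally show "(S * A') $$ (I, J) = (ad_mat a ?n T * S) $$ (I, J)" .
  qed (use S A' ad_mat_carrier[of a ?n T] in auto)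
  have inj: "v = 0\<^sub>v ?M" if v: "v \<in> carrier_vec ?M" and Sv: "S *\<^sub>v v = 0\<^sub>v ?K" for v
  proof -
    define x where "x = lin_comb ?n {..<?M} (\<lambda>i. bs' ! i) (\<lambda>i. v $ i)"
    have xc: "x \<in> carrier_mat ?n ?n" by (simp add: x_def)
    have xs: "x = lin_comb ?n {..<?m} (\<lambda>i. bs ! i) (\<lambda>i. v $ i) + v $ ?m \<cdot>\<^sub>m 1\<^sub>m ?n"
      unfolding x_def by (rule split)
    have inL: "lin_comb ?n {..<?m} (\<lambda>i. bs ! i) (\<lambda>i. v $ i) \<in> max_parabolic a b"
      using D(1) by (intro max_parabolic_comb) auto
    then have xP: "x \<in> parabolic a b"
      unfolding xs by (auto simp: max_parabolic_eq parabolic_def)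
    have zero: "(gi * x * g) $$ (?ps ! I) = 0" if I: "I < ?K" for I
    proof -
      have "(gi * x * g) $$ (?ps ! I) = (S *\<^sub>v v) $ I"
        unfolding x_def coords[OF I, symmetric] using S v I by (simp add: scalar_prod_def atLeast0LessThan)
      then show ?thesis using Sv I by simp
    qed
    have "gi * x * g = 0\<^sub>m ?n ?n"
    proof (rule eq_zero_matI)
      fix i j assume ij: "i < ?n" "j < ?n"
      have "gi * x * g \<in> parabolic a b" using g xP by (intro parabolic_mult)
      moreover have "(gi * x * g) $$ (i, j) = 0" if "allowed a i j"
      proof -
        have "(i, j) \<in> set ?ps" using that ij by (simp add: set_position_list allowed_pairs_def)
        then obtain I where "I < ?K" "?ps ! I = (i, j)" by (auto simp: in_set_conv_nth)
        then show ?thesis using zero[of I] by simp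
      qed
      ultimately show "(gi * x * g) $$ (i, j) = 0"
        using ij by (cases "allowed a i j") (auto simp: parabolic_def)
    qed (use gc gic xc in auto)
    then have x0: "x = 0\<^sub>m ?n ?n" using cancel(1)[OF xc] gc gic by simp
    have "v $ ?m * of_nat ?n = mat_trace x"
      using inL unfolding xs mat_trace_add[OF lin_comb_carrier(1) smult_carrier_mat[OF one_carrier_mat]]
        mat_trace_smult[OF one_carrier_mat] mat_trace_one max_parabolic_eq by simp
    also have "\<dots> = 0" unfolding x0 by (simp add: mat_trace_def)
    finally have "v $ ?m * of_nat ?n = 0" .
    moreover have "of_nat ?n \<noteq> (0::complex)" using n by (simp only: of_nat_eq_0_iff)
    ultimately have vm: "v $ ?m = 0" by (simp only: mult_eq_0_iff) simp
    have "lin_comb ?n {..<?m} (\<lambda>i. bs ! i) (\<lambda>i. v $ i) = x" unfolding xs vm by (intro eq_matI) auto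
    then have "v $ i = 0" if "i < ?m" for i using D(3) that x0 by simp
    with vm show ?thesis using v M by (intro eq_vecI) (auto simp: less_Suc_eq)
  qed
  have "\<exists>r. g * mat ?n ?n (\<lambda>ij. of_bool (ij = ?ps ! J)) * gi = lin_comb ?n {..<?M} (\<lambda>i. bs' ! i) r"
    if J: "J < ?K" for J
  proof -
    let ?e = "mat ?n ?n (\<lambda>ij. of_bool (ij = ?ps ! J))"
    define x where "x = g * ?e * gi"
    define t where "t = mat_trace x / of_nat ?n"
    have "?e \<in> parabolic a b"
      using nth_mem[OF J] by (auto simp: parabolic_def set_position_list allowed_pairs_def)
    then have x: "x \<in> parabolic a b" unfolding x_def using g by (intro parabolic_mult)
    from traceless_part[OF x n] D(2) obtain c
      where c: "x - t \<cdot>\<^sub>m 1\<^sub>m ?n = lin_comb ?n {..<?m} (\<lambda>i. bs ! i) c" unfolding t_def by blast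
    have "lin_comb ?n {..<?M} (\<lambda>i. bs' ! i) (\<lambda>i. if i < ?m then c i else t) = (x - t \<cdot>\<^sub>m 1\<^sub>m ?n) + t \<cdot>\<^sub>m 1\<^sub>m ?n"
      unfolding split c by (auto simp: lin_comb_def intro!: arg_cong2[where f = "(+)"] eq_matI sum.cong)
    also have "\<dots> = x" using parabolic_carrier[OF x] by (intro eq_matI) auto
    finally show ?thesis unfolding x_def by metis
  qed
  then obtain r where r: "\<And>J. J < ?K \<Longrightarrow>
      g * mat ?n ?n (\<lambda>ij. of_bool (ij = ?ps ! J)) * gi = lin_comb ?n {..<?M} (\<lambda>i. bs' ! i) (r J)"
    by metis
  define R where "R = mat ?M ?K (\<lambda>(L, J). r J L)"
  have R: "R \<in> carrier_mat ?M ?K" by (simp add: R_def)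
  have SR: "S * R = 1\<^sub>m ?K"
  proof (rule eq_matI)
    fix I J assume "I < dim_row (1\<^sub>m ?K :: complex mat)" "J < dim_col (1\<^sub>m ?K :: complex mat)"
    then have I: "I < ?K" and J: "J < ?K" by auto
    have "(S * R) $$ (I, J) = (\<Sum>L<?M. S $$ (I, L) * r J L)"
      using S I J by (simp add: scalar_prod_def atLeast0LessThan R_def)
    also have "\<dots> = (gi * (g * mat ?n ?n (\<lambda>ij. of_bool (ij = ?ps ! J)) * gi) * g) $$ (?ps ! I)"
      unfolding r[OF J] by (rule coords[OF I])
    also have "\<dots> = mat ?n ?n (\<lambda>ij. of_bool (ij = ?ps ! J)) $$ (?ps ! I)"
      by (subst cancel(2)) auto
    also have "\<dots> = of_bool (?ps ! I = ?ps ! J)" using pos[OF I] by (cases "?ps ! I") simp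
    also have "\<dots> = 1\<^sub>m ?K $$ (I, J)"
      using nth_eq_iff_index_eq[OF distinct_position_list I J] I J by simp
    finally show "(S * R) $$ (I, J) = 1\<^sub>m ?K $$ (I, J)" .
  qed (use S R in auto)
  have "char_poly A' = char_poly (ad_mat a ?n T)"
    by (rule similar_of_intertwining[OF A' ad_mat_carrier S R SA SR inj])
  then show ?thesis unfolding cpA' T_def .
qed

section \<open>The Ooms spectrum\<close>

lemma has_roots_length:
  assumes "M \<in> carrier_mat n n" "has_roots M es"
  shows "length es = n"
  using degree_monic_char_poly[OF assms(1)] assms(2) degree_linear_factors[of uminus es]
  by (simp add: has_roots_def)

lemma proots_linear_factors: "proots (\<Prod>e\<leftarrow>es. [:- e, 1:]) = mset (es :: complex list)"
proof (induction es)
  case (Cons e es)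
  have "(\<Prod>e\<leftarrow>es. [:- e, 1:]) \<noteq> 0" by (auto simp: prod_list_zero_iff)
  then show ?case using Cons by (simp add: proots_mult del: mult_pCons_left)
qed simp

lemma diff_count_nth:
  "diff_count xs ys k = (\<Sum>i<length xs. \<Sum>j<length ys. of_bool (xs ! i - ys ! j = k))"
  unfolding diff_count_def by (simp add: sum_list_sum_nth atLeast0LessThan)

lemma sum_split_add: "(\<Sum>i<a + b. f i) = (\<Sum>i<a. f i) + (\<Sum>i<b. f (a + i))" for f :: "nat \<Rightarrow> int"
  by (induction b) (simp_all add: add.assoc)

lemma count_differences:
  assumes "length P = a" "length Q = b"
  shows "int (count (mset (map (\<lambda>(i, j). (P @ Q) ! i - (P @ Q) ! j) (position_list a (a + b)))) k) =
    diff_count P P k + diff_count Q Q k + diff_count P Q k"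
proof -
  let ?n = "a + b" and ?d = "P @ Q"
  have cnt: "int (count (mset xs) k) = (\<Sum>x\<leftarrow>xs. of_bool (x = k))" for xs :: "int list"
    by (induction xs) auto
  have "int (count (mset (map (\<lambda>(i, j). ?d ! i - ?d ! j) (position_list a ?n))) k) =
      (\<Sum>ij\<leftarrow>position_list a ?n. of_bool ((\<lambda>(i, j). ?d ! i - ?d ! j) ij = k))"
    unfolding cnt by (simp add: o_def)
  also have "\<dots> = (\<Sum>ij\<in>allowed_pairs a ?n. of_bool ((\<lambda>(i, j). ?d ! i - ?d ! j) ij = k))"
    by (simp add: sum_list_distinct_conv_sum_set[OF distinct_position_list] set_position_list)
  also have "\<dots> = (\<Sum>(i, j)\<in>{..<?n} \<times> {..<?n}. of_bool (allowed a i j \<and> ?d ! i - ?d ! j = k))"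
    by (intro sum.mono_neutral_cong_left) (auto simp: allowed_pairs_def)
  also have "\<dots> = (\<Sum>i<?n. \<Sum>j<?n. of_bool (allowed a i j \<and> ?d ! i - ?d ! j = k))"
    by (rule sum_pairs[symmetric])
  also have "\<dots> = (\<Sum>i<a. \<Sum>j<a. of_bool (P ! i - P ! j = k)) + (\<Sum>i<a. \<Sum>j<b. of_bool (P ! i - Q ! j = k))
      + (\<Sum>i<b. \<Sum>j<b. of_bool (Q ! i - Q ! j = k))"
    unfolding sum_split_add using assms by (simp add: nth_append sum.distrib)
  finally show ?thesis using assms by (simp add: diff_count_nth)
qed

theorem ooms_spectrum_max_parabolic:
  assumes spec: "is_ooms_spectrum (a + b) (max_parabolic a b) M"
    and ab: "0 < a" "coprime a b"
  shows "M + {#0#} = image_mset of_int (mset (map (\<lambda>(i, j). (fst (exponents a b) @ snd (exponents a b)) ! i -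
      (fst (exponents a b) @ snd (exponents a b)) ! j) (position_list a (a + b))))"
    and "length (fst (exponents a b)) = a" and "length (snd (exponents a b)) = b"
proof -
  let ?n = "a + b" and ?d = "fst (exponents a b) @ snd (exponents a b)"
  obtain \<phi> h bs A where frob: "frobenius_functional ?n (max_parabolic a b) \<phi>"
    and princ: "principal_element (max_parabolic a b) \<phi> h"
    and basis: "ordered_basis ?n (max_parabolic a b) bs"
    and rep: "represents ?n bs (lie_bracket h) A" and M: "M = proots (char_poly A)"
    using spec unfolding is_ooms_spectrum_def by blast
  obtain c X Y Z where hb: "h = four_block_mat X Z (0\<^sub>m b a) Y"
    "X \<in> carrier_mat a a" "Z \<in> carrier_mat a b" "Y \<in> carrier_mat b b"
    and roots: "has_roots X (map (\<lambda>k. c + of_int k) (fst (exponents a b)))"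
    "has_roots Y (map (\<lambda>k. c + of_int k) (snd (exponents a b)))"
    by (rule principal_element_form[OF frob princ ab])
  show len: "length (fst (exponents a b)) = a" "length (snd (exponents a b)) = b"
    using has_roots_length[OF hb(2) roots(1)] has_roots_length[OF hb(4) roots(2)] by simp_all
  obtain g gi where g: "g \<in> parabolic a b" "gi \<in> parabolic a b" "g * gi = 1\<^sub>m ?n" "gi * g = 1\<^sub>m ?n"
    and tri: "upper_triangular (gi * h * g)"
    and diag: "diag_mat (gi * h * g) = map (\<lambda>k. c + of_int k) (fst (exponents a b)) @ map (\<lambda>k. c + of_int k) (snd (exponents a b))"
    by (rule triangularize_parabolic[OF hb(2-4) roots, folded hb(1)])
  define T where "T = gi * h * g"
  have hP: "h \<in> parabolic a b" unfolding hb(1) by (rule parabolic_four_block[OF hb(2-4)])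
  have T: "T \<in> carrier_mat ?n ?n" unfolding T_def using parabolic_carrier[OF g(1)] parabolic_carrier[OF g(2)]
    parabolic_carrier[OF hP] by auto
  have entry: "T $$ (i, i) = c + of_int (?d ! i)" if "i < ?n" for i
  proof -
    have "T $$ (i, i) = diag_mat T ! i" using T that by (simp add: diag_mat_def)
    also have "\<dots> = map (\<lambda>k. c + of_int k) ?d ! i" using diag by (simp add: T_def)
    also have "\<dots> = c + of_int (?d ! i)" using that len by (intro nth_map) simp
    finally show ?thesis .
  qed
  have "char_poly A * [:0, 1:] = char_poly (ad_mat a ?n T)"
    unfolding T_def using ab by (intro char_poly_ad_parabolic[OF _ basis hP rep g]) simp
  also have "\<dots> = (\<Prod>(i, j)\<leftarrow>position_list a ?n. [:- (T $$ (i, i) - T $$ (j, j)), 1:])"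
    using tri by (intro char_poly_ad_mat[OF T]) (simp add: T_def)
  also have "\<dots> = (\<Prod>e\<leftarrow>map (\<lambda>(i, j). of_int (?d ! i - ?d ! j)) (position_list a ?n). [:- e, 1:])"
  proof -
    have "map (\<lambda>(i, j). [:- (T $$ (i, i) - T $$ (j, j)), 1:]) (position_list a ?n) =
        map (\<lambda>e. [:- e, 1:]) (map (\<lambda>(i, j). of_int (?d ! i - ?d ! j)) (position_list a ?n))"
      using entry by (auto simp: set_position_list allowed_pairs_def)
    then show ?thesis by (simp only:)
  qed
  finally have cp: "char_poly A * [:0, 1:] = (\<Prod>e\<leftarrow>map (\<lambda>(i, j). of_int (?d ! i - ?d ! j)) (position_list a ?n). [:- e, 1:])" .
  have "A \<in> carrier_mat (length bs) (length bs)" using rep by (simp add: represents_def)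
  from degree_monic_char_poly[OF this] have "char_poly A \<noteq> 0" by auto
  then have "proots (char_poly A * [:0, 1:]) = M + {#0#}"
    unfolding M by (subst proots_mult) auto
  then show "M + {#0#} = image_mset of_int (mset (map (\<lambda>(i, j). ?d ! i - ?d ! j) (position_list a ?n)))"
    unfolding cp proots_linear_factors by (simp add: case_prod_beta' o_def multiset.map_comp)
qed

lemma count_image_mset_of_int:
  "count (image_mset complex_of_int N) (of_int k) = count N k"
  by (induction N) auto

lemma ooms_spectrum_count:
  assumes "is_ooms_spectrum (a + b) (max_parabolic a b) M" "0 < a" "coprime a b"
  shows "int (count M (of_int k)) = spectrum_count (exponents a b) k"
    and "z \<in># M \<Longrightarrow> z \<in> range of_int"
proof -
  note spec = ooms_spectrum_max_parabolic[OF assms]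
  have "int (count (M + {#0#}) (of_int k)) =
      diff_count (fst (exponents a b)) (fst (exponents a b)) k + diff_count (snd (exponents a b)) (snd (exponents a b)) k
      + diff_count (fst (exponents a b)) (snd (exponents a b)) k"
    unfolding spec(1) count_image_mset_of_int by (rule count_differences[OF spec(2,3)])
  then show "int (count M (of_int k)) = spectrum_count (exponents a b) k"
    by (auto simp: spectrum_count_def split: if_splits)
  show "z \<in> range of_int" if "z \<in># M"
  proof -
    have "z \<in># M + {#0#}" using that by simp
    then show ?thesis unfolding spec(1) by auto
  qed
qed

lemma log_concave_parabolicI:
  assumes ab: "0 < a" "coprime a b" and lc: "half_log_concave (spectrum_count (exponents a b))"
  shows "log_concave_parabolic a b"
  unfolding log_concave_parabolic_def
proof (intro conjI allI impI)
  obtain \<phi> h where \<phi>: "frobenius_functional (a + b) (max_parabolic a b) \<phi>"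
    and h: "principal_element (max_parabolic a b) \<phi> h"
    using frobenius_functional_exists[OF ab] by blast
  obtain bs where bs: "ordered_basis (a + b) (max_parabolic a b) bs"
    using ordered_basis_max_parabolic_exists[of a b] ab(1) by auto
  have "lie_bracket h x \<in> max_parabolic a b" if "x \<in> max_parabolic a b" for x
    using h that by (intro lie_bracket_in) (auto simp: principal_element_def max_parabolic_eq)
  then obtain A where "represents (a + b) bs (lie_bracket h) A" using represents_exists[OF bs] by blast
  with \<phi> h bs show "\<exists>M. is_ooms_spectrum (a + b) (max_parabolic a b) M"
    unfolding is_ooms_spectrum_def
    by (intro exI[of _ "proots (char_poly A)"] exI[of _ \<phi>] exI[of _ h] exI[of _ bs] exI[of _ A] conjI refl)
next
  fix M assume spec: "is_ooms_spectrum (a + b) (max_parabolic a b) M"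
  let ?c = "spectrum_count (exponents a b)"
  note cnt = ooms_spectrum_count(1)[OF spec ab]
  have sym: "?c (1 - k) = ?c k" for k by (rule spectrum_count_exponents_sym)
  obtain t where t: "1 \<le> t" "\<And>k. 1 \<le> k \<Longrightarrow> 0 < ?c k \<longleftrightarrow> k \<le> t"
    and lc1: "\<And>k. 1 \<le> k \<Longrightarrow> ?c (k - 1) * ?c (k + 1) \<le> ?c k * ?c k"
    using lc unfolding half_log_concave_def by blast
  have lc2: "?c (k - 1) * ?c (k + 1) \<le> ?c k * ?c k" for k
  proof (cases "1 \<le> k")
    case False
    then show ?thesis
      using lc1[of "1 - k"] sym[of k] sym[of "k - 1"] sym[of "k + 1"] by (simp add: mult.commute algebra_simps)
  qed (rule lc1)
  have pos: "0 < ?c k \<longleftrightarrow> 1 - t \<le> k \<and> k \<le> t" for k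
  proof (cases "1 \<le> k")
    case False
    then show ?thesis using t(2)[of "1 - k"] sym[of k] t(1) by auto
  qed (use t in auto)
  define ks where "ks = [1 - t..t]"
  define cs where "cs = map (\<lambda>k. nat (?c k)) ks"
  have len: "int (length ks) = 2 * t" using t(1) by (simp add: ks_def)
  have nth: "cs ! j = nat (?c (1 - t + int j))" if "j < length ks" for j
    using that by (simp add: cs_def ks_def nth_upto)
  have "multiplicity_sequence M cs"
    unfolding multiplicity_sequence_def
  proof (intro exI[of _ "map real_of_int ks"] conjI)
    show "sorted_wrt (<) (map real_of_int ks)"
      by (simp add: sorted_wrt_map ks_def)
    have "z \<in># M \<longleftrightarrow> (\<exists>k\<in>set ks. z = of_int k)" for z
    proof
      assume z: "z \<in># M"
      then obtain k where k: "z = of_int k" using ooms_spectrum_count(2)[OF spec ab] by blast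
      then have "0 < int (count M (of_int k))" using z by simp
      then have "k \<in> set ks" unfolding cnt pos by (simp add: ks_def)
      then show "\<exists>k\<in>set ks. z = of_int k" using k by blast
    next
      assume "\<exists>k\<in>set ks. z = of_int k"
      then obtain k where k: "k \<in> set ks" "z = of_int k" by blast
      then have "0 < int (count M (of_int k))" unfolding cnt pos by (simp add: ks_def)
      then show "z \<in># M" using k by simp
    qed
    moreover have "complex_of_real ` set (map real_of_int ks) = of_int ` set ks"
      by (simp add: image_image)
    ultimately show "complex_of_real ` set (map real_of_int ks) = set_mset M" by auto
    have "nat (?c k) = count M (of_int k)" for k unfolding cnt[symmetric] by simp
    then show "cs = map (\<lambda>e. count M (complex_of_real e)) (map real_of_int ks)"
      by (simp add: cs_def)
  qed
  moreover have "log_concave cs"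
    unfolding log_concave_def
  proof (intro conjI allI impI ballI)
    show "cs \<noteq> []" using len t(1) by (auto simp: cs_def)
    show "0 < c" if "c \<in> set cs" for c using that pos by (auto simp: cs_def ks_def)
    fix j assume j: "1 \<le> j \<and> j + 1 < length cs"
    then have jl: "j - 1 < length ks" "j < length ks" "j + 1 < length ks" by (auto simp: cs_def)
    define k where "k = 1 - t + int j"
    have k: "1 - t + int (j - 1) = k - 1" "1 - t + int (j + 1) = k + 1" using j by (auto simp: k_def)
    have "0 < ?c (k - 1)" "0 < ?c k" "0 < ?c (k + 1)"
      unfolding pos k_def using j len jl by auto
    then have "int (nat (?c (k - 1)) * nat (?c (k + 1))) \<le> int ((nat (?c k))\<^sup>2)"
      using lc2[of k] by (simp add: power2_eq_square)
    then show "cs ! (j - 1) * cs ! (j + 1) \<le> (cs ! j)\<^sup>2"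
      unfolding nth[OF jl(1)] nth[OF jl(2)] nth[OF jl(3)] k k_def[symmetric] by (simp only: of_nat_le_iff)
  qed
  ultimately show "\<exists>cs. multiplicity_sequence M cs \<and> log_concave cs" by blast
qed

text \<open>Exchanging \<open>a\<close> and \<open>b\<close> replaces \<open>P\<close> and \<open>Q\<close> by \<open>- Q\<close> and \<open>- P\<close>, up to order and a common shift.
  Difference counts are blind to such a shift.\<close>

lemma diff_count_exponents_swap:
  assumes "0 < a" "0 < b"
  shows "\<forall>k. diff_count (fst (exponents b a)) (fst (exponents b a)) k = diff_count (snd (exponents a b)) (snd (exponents a b)) k \<and>
    diff_count (snd (exponents b a)) (snd (exponents b a)) k = diff_count (fst (exponents a b)) (fst (exponents a b)) k \<and>
    diff_count (fst (exponents b a)) (snd (exponents b a)) k = diff_count (fst (exponents a b)) (snd (exponents a b)) k"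
  using assms
proof (induction a b rule: exponents.induct)
  case (1 a b)
  have shift: "diff_count (map (\<lambda>x. x - 1) xs) ys k = diff_count xs ys (k + 1)"
    "diff_count xs (map (\<lambda>x. x - 1) ys) k = diff_count xs ys (k - 1)" for xs ys k
    using diff_count_shift_left[of "-1" xs ys k] diff_count_shift_right[of xs "-1" ys k] by simp_all
  consider "a = b" | "a < b" | "b < a" by linarith
  then show ?case
  proof cases
    case 1
    then have "exponents a b = ([1], [0])" "exponents b a = ([1], [0])"
      using \<open>0 < a\<close> exponents.simps[of a a] exponents.simps[of a 0] by simp_all
    then show ?thesis by (simp add: diff_count_def)
  next
    case 2
    obtain P Q where PQ: "exponents a (b - a) = (P, Q)" by fastforce
    obtain P' Q' where PQ': "exponents (b - a) a = (P', Q')" by fastforce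
    have d: "exponents a b = (map (\<lambda>x. x + 1) P, P @ Q)" "exponents b a = (P' @ Q', map (\<lambda>x. x - 1) Q')"
      using 2 \<open>0 < a\<close> exponents.simps[of a b] exponents.simps[of b a] by (simp_all add: PQ PQ')
    have IH: "diff_count P' P' k = diff_count Q Q k" "diff_count Q' Q' k = diff_count P P k" "diff_count P' Q' k = diff_count P Q k" for k
      using "1.IH"(1) 2 \<open>0 < a\<close> by (auto simp: PQ PQ')
    show ?thesis
      using diff_count_flip[of Q P] diff_count_flip[of Q' P']
      by (simp add: d diff_count_append_left diff_count_append_right diff_count_shift_left diff_count_shift_right shift IH)
  next
    case 3
    obtain P Q where PQ: "exponents (a - b) b = (P, Q)" by fastforce
    obtain P' Q' where PQ': "exponents b (a - b) = (P', Q')" by fastforce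
    have d: "exponents a b = (P @ Q, map (\<lambda>x. x - 1) Q)" "exponents b a = (map (\<lambda>x. x + 1) P', P' @ Q')"
      using 3 \<open>0 < b\<close> exponents.simps[of a b] exponents.simps[of b a] by (simp_all add: PQ PQ')
    have IH: "diff_count P' P' k = diff_count Q Q k" "diff_count Q' Q' k = diff_count P P k" "diff_count P' Q' k = diff_count P Q k" for k
      using "1.IH"(2) 3 \<open>0 < b\<close> by (auto simp: PQ PQ')
    show ?thesis
      using diff_count_flip[of Q P] diff_count_flip[of Q' P']
      by (simp add: d diff_count_append_left diff_count_append_right diff_count_shift_left diff_count_shift_right shift IH)
  qed
qed

lemma spectrum_count_exponents_swap:
  assumes "0 < a" "0 < b"
  shows "spectrum_count (exponents b a) = spectrum_count (exponents a b)"
  using diff_count_exponents_swap[OF assms] by (auto simp: spectrum_count_def)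

theorem corollary1p3:
  fixes a b :: nat
  assumes "0 < a" and "0 < b" and "coprime a b"
    and "min a b \<le> 8 \<or> min a b = 10"
  shows "log_concave_parabolic a b"
proof (rule log_concave_parabolicI[OF assms(1,3)])
  show "half_log_concave (spectrum_count (exponents a b))"
  proof (cases "a \<le> b")
    case True
    then show ?thesis using assms by (intro half_log_concave_exponents) (auto simp: min_def)
  next
    case False
    have "coprime b a" using assms(3) by (simp add: coprime_commute)
    then have "half_log_concave (spectrum_count (exponents b a))"
      using assms False by (intro half_log_concave_exponents) (auto simp: min_def)
    then show ?thesis by (simp only: spectrum_count_exponents_swap[OF assms(1,2)])
  qed
qed

end
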